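(* Let $\Omega\subset\mathbb R^n$ be open, let $f$ be real analytic on $\Omega$ with values in $\mathbb R^n$, and suppose that the system $\dot x=f(x)$ has a periodic orbit $\Gamma\subset\Omega$, parametrized by a periodic solution $\varphi(t)$ of period $T>0$. If the system has $n-1$ functionally independent analytic or formal first integrals around $\Gamma$, then the characteristic exponents $\lambda_1,\dots,\lambda_n$ of the periodic orbit satisfy $$\lambda_1=\nu_1\mathbf i,\ \ldots,\ \lambda_{n-1}=\nu_{n-1}\mathbf i,\ \lambda_n=\nu_n\mathbf i,\qquad \nu_j\in\mathbb Q,$$ where $\mathbf i=\sqrt{-1}$.
   Context: Reduced system and characteristic exponents. Putting $X=x-\varphi(t)$ gives $\dot X=A(t)X+g(X,t)$ with $A(t)$ analytic and $T$-periodic and $g=O(|X|^2)$ analytic and $T$-periodic in $t$. By Floquet theory there is a matrix $Q(t)$, invertible, analytic and $T$-periodic, such that $X=Q(t)Y$ transforms this system to the reduced system $\dot Y=AY+F(Y,t)$, with $A$ a constant (real or complex) matrix having a zero eigenvalue whose characteristic direction is tangent to $\Gamma$, and $F=O(|Y|^2)$ analytic and $T$-periodic in $t$. The characteristic multipliers of $\Gamma$ are the eigenvalues of the monodromy operator of the linear part $\dot X=A(t)X$. A number $\mu$ is a characteristic exponent of $\Gamma$ if $e^{\mu T}$ is a characteristic multiplier. If $\mu$ is a characteristic exponent, so are $\mu+2m\pi\mathbf i/T$, $m\in\mathbb Z$, but these further exponents are not considered: here the characteristic exponents $\lambda_1,\dots,\lambda_n$ are the eigenvalues of the constant matrix $A$.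 First integrals. A nonconstant function $H$ is a first integral of $\dot x=f(x)$ in $D\subset\Omega$ if it takes a constant value along every orbit located in $D$; an analytic first integral around $\Gamma$ is an analytic one defined in a neighborhood of $\Gamma$. A formal first integral around $\Gamma$ is understood as a formal first integral of the reduced system: a nonconstant formal power series $H(Y,t)$ in $Y$, with coefficients $T$-periodic in $t$, satisfying $\partial_tH+\langle\partial_YH,AY+F(Y,t)\rangle=0$, where $\langle\cdot,\cdot\rangle$ is the inner product $\langle u,v\rangle=\sum_iu_iv_i$. First integrals $H_1,\dots,H_k$ defined in $D$ are functionally independent if their gradients have rank $k$ in a full Lebesgue measure subset of $D$; for formal first integrals this means that some $k\times k$ minor of the matrix of their gradients is not the zero formal series.
   Formalization: As stated the claim fails: for general period T the exponents are (2π/T)ν_j i, which is what is proved; and formal first integrals of the reduced system are also required to come from one formal function of x alone (independent of t along Γ), since otherwise a hyperbolic cycle is a counterexample. *)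

theory Defs
  imports "HOL-Analysis.Analysis"
begin

section \<open>Formal power series in the variables indexed by a finite type\<close>

text \<open>A series is its family of coefficients, indexed by exponent vectors.\<close>

typedef ('a, 'n :: finite) mfps = "UNIV :: (nat ^ 'n \<Rightarrow> 'a) set"
  morphisms mcoeff Abs_mfps
  ..

setup_lifting type_definition_mfps

lemma mfps_eqI: "(\<And>m. mcoeff f m = mcoeff g m) \<Longrightarrow> f = g"
  by transfer auto

definition splits :: "nat ^ 'n :: finite \<Rightarrow> ((nat ^ 'n) \<times> (nat ^ 'n)) set" where
  "splits m = {(k, l). k + l = m}"

lemma finite_splits: "finite (splits m)"
proof -
  have "finite {k :: nat ^ 'a. \<forall>i. k $ i \<in> {..m $ i}}"
  proof -
    have "finite (PiE UNIV (\<lambda>i. {..m $ i}))"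
      by (intro finite_PiE) auto
    then have "finite (vec_lambda ` PiE UNIV (\<lambda>i. {..m $ i}))"
      by blast
    moreover have "{k :: nat ^ 'a. \<forall>i. k $ i \<in> {..m $ i}} \<subseteq> vec_lambda ` PiE UNIV (\<lambda>i. {..m $ i})"
    proof
      fix k :: "nat ^ 'a"
      assume "k \<in> {k. \<forall>i. k $ i \<in> {..m $ i}}"
      then have "vec_nth k \<in> PiE UNIV (\<lambda>i. {..m $ i})" by auto
      then show "k \<in> vec_lambda ` PiE UNIV (\<lambda>i. {..m $ i})"
        by (metis image_eqI vec_nth_inverse)
    qed
    ultimately show ?thesis by (rule finite_subset[rotated])
  qed
  then have "finite ({k :: nat ^ 'a. \<forall>i. k $ i \<in> {..m $ i}} \<times> {k. \<forall>i. k $ i \<in> {..m $ i}})"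
    by blast
  moreover have "splits m \<subseteq> {k. \<forall>i. k $ i \<in> {..m $ i}} \<times> {k. \<forall>i. k $ i \<in> {..m $ i}}"
    by (auto simp: splits_def)
  ultimately show ?thesis by (rule finite_subset[rotated])
qed

instantiation mfps :: (comm_ring_1, finite) comm_ring_1
begin

lift_definition zero_mfps :: "('a, 'b) mfps" is "\<lambda>_. 0" .
lift_definition one_mfps :: "('a, 'b) mfps" is "\<lambda>m. if m = 0 then 1 else 0" .
lift_definition plus_mfps :: "('a, 'b) mfps \<Rightarrow> ('a, 'b) mfps \<Rightarrow> ('a, 'b) mfps" is
  "\<lambda>f g m. f m + g m" .
lift_definition minus_mfps :: "('a, 'b) mfps \<Rightarrow> ('a, 'b) mfps \<Rightarrow> ('a, 'b) mfps" is
  "\<lambda>f g m. f m - g m" .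
lift_definition uminus_mfps :: "('a, 'b) mfps \<Rightarrow> ('a, 'b) mfps" is "\<lambda>f m. - f m" .
lift_definition times_mfps :: "('a, 'b) mfps \<Rightarrow> ('a, 'b) mfps \<Rightarrow> ('a, 'b) mfps" is
  "\<lambda>f g m. \<Sum>(k, l)\<in>splits m. f k * g l" .

instance
proof
  fix f g h :: "('a, 'b) mfps"
  show "f * g * h = f * (g * h)"
  proof (transfer, rule ext)
    fix f g h :: "nat ^ 'b \<Rightarrow> 'a" and m :: "nat ^ 'b"
    have "(\<Sum>(a, b)\<in>splits m. (\<Sum>(c, d)\<in>splits a. f c * g d) * h b)
        = (\<Sum>((a, b), (c, d))\<in>Sigma (splits m) (\<lambda>(a, b). splits a). f c * g d * h b)"
      by (subst sum.Sigma[symmetric])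
        (auto simp: finite_splits sum_distrib_right case_prod_unfold)
    also have "\<dots> = (\<Sum>((a, b), (c, d))\<in>Sigma (splits m) (\<lambda>(a, b). splits b). f a * (g c * h d))"
      by (rule sum.reindex_bij_witness[where
            i = "\<lambda>((a, b), (c, d)). ((a + c, d), (a, c))" and
            j = "\<lambda>((a, b), (c, d)). ((c, d + b), (d, b))"])
        (auto simp: splits_def ac_simps)
    also have "\<dots> = (\<Sum>(a, b)\<in>splits m. f a * (\<Sum>(c, d)\<in>splits b. g c * h d))"
      by (subst sum.Sigma[symmetric])
        (auto simp: finite_splits sum_distrib_left case_prod_unfold)
    finally show "(\<Sum>(a, b)\<in>splits m. (\<Sum>(c, d)\<in>splits a. f c * g d) * h b) =
        (\<Sum>(a, b)\<in>splits m. f a * (\<Sum>(c, d)\<in>splits b. g c * h d))" .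
  qed
  show "f * g = g * f"
  proof (transfer, rule ext)
    fix f g :: "nat ^ 'b \<Rightarrow> 'a" and m :: "nat ^ 'b"
    show "(\<Sum>(a, b)\<in>splits m. f a * g b) = (\<Sum>(a, b)\<in>splits m. g a * f b)"
      by (rule sum.reindex_bij_witness[where i = prod.swap and j = prod.swap])
        (auto simp: splits_def ac_simps)
  qed
  show "1 * f = f"
  proof (transfer, rule ext)
    fix f :: "nat ^ 'b \<Rightarrow> 'a" and m :: "nat ^ 'b"
    have "(\<Sum>(a, b)\<in>splits m. (if a = 0 then 1 else 0) * f b)
        = (\<Sum>(a, b)\<in>{(0 :: nat ^ 'b, m)}. (if a = 0 then 1 else 0) * f b)"
      by (rule sum.mono_neutral_right) (auto simp: finite_splits, auto simp: splits_def split: if_splits)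
    then show "(\<Sum>(a, b)\<in>splits m. (if a = 0 then 1 else 0) * f b) = f m" by simp
  qed
  show "(f + g) * h = f * h + g * h"
    by transfer (auto simp: case_prod_unfold algebra_simps sum.distrib)
  show "(0 :: ('a, 'b) mfps) \<noteq> 1"
    by transfer (metis zero_neq_one)
qed (transfer; simp add: algebra_simps)+

end

definition mconst :: "'a :: zero \<Rightarrow> ('a, 'n :: finite) mfps" where
  "mconst c = Abs_mfps (\<lambda>m. if m = 0 then c else 0)"

text \<open>The linear form \<open>\<Sum>j. r $ j * Y\<^sub>j\<close>.\<close>

definition linear_form :: "'a :: comm_ring_1 ^ 'n \<Rightarrow> ('a, 'n :: finite) mfps" where
  "linear_form r = Abs_mfps (\<lambda>m. \<Sum>j\<in>UNIV. if m = axis j 1 then r $ j else 0)"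

text \<open>Partial derivative with respect to the variable \<open>Y\<^sub>j\<close>.\<close>

definition mpartial :: "'n \<Rightarrow> ('a :: comm_ring_1, 'n :: finite) mfps \<Rightarrow> ('a, 'n) mfps" where
  "mpartial j h = Abs_mfps (\<lambda>m. of_nat (m $ j + 1) * mcoeff h (m + axis j 1))"

definition mdeg :: "nat ^ 'n :: finite \<Rightarrow> nat" where
  "mdeg m = (\<Sum>i\<in>UNIV. m $ i)"

text \<open>
  The series \<open>h (M Y)\<close>. A product of \<open>d\<close> linear forms is homogeneous of degree \<open>d\<close>, so
  only the finitely many exponents \<open>k\<close> with \<open>mdeg k = mdeg m\<close> contribute to the coefficient
  at \<open>m\<close>.
\<close>

definition msubst :: "'a :: comm_ring_1 ^ 'n ^ 'n \<Rightarrow> ('a, 'n :: finite) mfps \<Rightarrow> ('a, 'n) mfps" where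
  "msubst M h = Abs_mfps (\<lambda>m. \<Sum>k | mdeg k = mdeg m.
     mcoeff h k * mcoeff (\<Prod>i\<in>UNIV. linear_form (M $ i) ^ (k $ i)) m)"

definition drop_affine :: "('a :: zero, 'n :: finite) mfps \<Rightarrow> ('a, 'n) mfps" where
  "drop_affine h = Abs_mfps (\<lambda>m. if mdeg m \<le> 1 then 0 else mcoeff h m)"

text \<open>Derivative in \<open>t\<close> of a series with coefficients depending on \<open>t\<close>.\<close>

definition tderiv :: "(real \<Rightarrow> (complex, 'n :: finite) mfps) \<Rightarrow> real \<Rightarrow> (complex, 'n) mfps" where
  "tderiv H t = Abs_mfps (\<lambda>m. vector_derivative (\<lambda>s. mcoeff (H s) m) (at t))"

definition nat_det :: "nat \<Rightarrow> (nat \<Rightarrow> nat \<Rightarrow> 'a :: comm_ring_1) \<Rightarrow> 'a" where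
  "nat_det k M = (\<Sum>p | p permutes {..<k}. of_int (sign p) * (\<Prod>a<k. M a (p a)))"


section \<open>Real analytic functions\<close>

definition has_power_series_at ::
    "(real ^ 'n :: finite \<Rightarrow> real) \<Rightarrow> real ^ 'n \<Rightarrow> (nat ^ 'n \<Rightarrow> real) \<Rightarrow> bool" where
  "has_power_series_at h a c \<longleftrightarrow>
     (\<exists>r>0. \<forall>x. (\<forall>i. \<bar>x $ i - a $ i\<bar> < r) \<longrightarrow>
        ((\<lambda>k. c k * (\<Prod>i\<in>UNIV. (x $ i - a $ i) ^ (k $ i))) has_sum h x) UNIV)"

definition real_analytic_on :: "(real ^ 'n :: finite \<Rightarrow> real) \<Rightarrow> (real ^ 'n) set \<Rightarrow> bool" where
  "real_analytic_on h S \<longleftrightarrow> (\<forall>a\<in>S. \<exists>c. has_power_series_at h a c)"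

definition taylor :: "(real ^ 'n :: finite \<Rightarrow> real) \<Rightarrow> real ^ 'n \<Rightarrow> (complex, 'n) mfps" where
  "taylor h a = Abs_mfps (\<lambda>k. complex_of_real ((THE c. has_power_series_at h a c) k))"

definition analytic_curve :: "(real \<Rightarrow> complex) \<Rightarrow> bool" where
  "analytic_curve q \<longleftrightarrow>
     (\<forall>t. \<exists>c. \<exists>r>0. \<forall>s. \<bar>s - t\<bar> < r \<longrightarrow> (\<lambda>k. c k * of_real (s - t) ^ k) sums q s)"


section \<open>The periodic orbit and the reduced system\<close>

definition jacobian :: "(real ^ 'n \<Rightarrow> real ^ 'n) \<Rightarrow> real ^ 'n \<Rightarrow> real ^ 'n ^ 'n :: finite" where
  "jacobian f x = matrix (frechet_derivative f (at x))"

definition cvec :: "real ^ 'n \<Rightarrow> complex ^ 'n :: finite" where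
  "cvec v = (\<chi> i. complex_of_real (v $ i))"

definition cmat :: "real ^ 'n ^ 'n \<Rightarrow> complex ^ 'n ^ 'n :: finite" where
  "cmat M = (\<chi> i j. complex_of_real (M $ i $ j))"

text \<open>An equilibrium is not a periodic orbit; \<open>T\<close> is a period, not necessarily the least one.\<close>

definition periodic_orbit ::
    "(real ^ 'n :: finite) set \<Rightarrow> (real ^ 'n \<Rightarrow> real ^ 'n) \<Rightarrow> (real \<Rightarrow> real ^ 'n) \<Rightarrow> real \<Rightarrow> bool" where
  "periodic_orbit \<Omega> f \<phi> T \<longleftrightarrow>
     0 < T \<and> (\<forall>t. \<phi> t \<in> \<Omega>) \<and>
     (\<forall>t. (\<phi> has_vector_derivative f (\<phi> t)) (at t)) \<and>
     (\<forall>t. \<phi> (t + T) = \<phi> t) \<and> (\<exists>t. \<phi> t \<noteq> \<phi> 0)"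

text \<open>
  \<open>X = Q(t) Y\<close> transforms \<open>X' = Df(\<phi>(t)) X\<close> into \<open>Y' = A Y\<close>, i.e. \<open>Q' = Df(\<phi>) Q - Q A\<close>.
  The last conjunct is the zero eigenvalue of \<open>A\<close> with direction tangent to the orbit
  (recall \<open>\<phi>' = f \<circ> \<phi>\<close>).
\<close>

definition floquet_reduction ::
    "(real ^ 'n :: finite \<Rightarrow> real ^ 'n) \<Rightarrow> (real \<Rightarrow> real ^ 'n) \<Rightarrow> real \<Rightarrow>
     (real \<Rightarrow> complex ^ 'n ^ 'n) \<Rightarrow> complex ^ 'n ^ 'n \<Rightarrow> bool" where
  "floquet_reduction f \<phi> T Q A \<longleftrightarrow>
     (\<forall>t. invertible (Q t)) \<and> (\<forall>t. Q (t + T) = Q t) \<and>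
     (\<forall>i j. analytic_curve (\<lambda>t. Q t $ i $ j)) \<and>
     (\<forall>t. (Q has_vector_derivative (cmat (jacobian f (\<phi> t)) ** Q t - Q t ** A)) (at t)) \<and>
     (\<exists>v. v \<noteq> 0 \<and> A *v v = 0 \<and> (\<forall>t. \<exists>c. Q t *v v = c *s cvec (f (\<phi> t))))"

text \<open>The characteristic exponents: the eigenvalues of \<open>A\<close>, listed with multiplicity.\<close>

definition eigenvalue_listing :: "complex ^ 'n ^ 'n \<Rightarrow> ('n :: finite \<Rightarrow> complex) \<Rightarrow> bool" where
  "eigenvalue_listing A l \<longleftrightarrow> (\<forall>z. det (mat z - A) = (\<Prod>j\<in>UNIV. z - l j))"

text \<open>
  \<open>g(X,t) = f(\<phi>(t) + X) - f(\<phi>(t)) - Df(\<phi>(t)) X\<close> and \<open>F(Y,t) = Q(t)\<^sup>-\<^sup>1 g(Q(t) Y, t)\<close>, by components,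
  as formal series. Since \<open>Q\<close> and \<open>Y\<close> may be complex, \<open>f\<close> enters through its Taylor series.
\<close>

definition g_series ::
    "(real ^ 'n :: finite \<Rightarrow> real ^ 'n) \<Rightarrow> (real \<Rightarrow> real ^ 'n) \<Rightarrow> real \<Rightarrow> 'n \<Rightarrow> (complex, 'n) mfps" where
  "g_series f \<phi> t i = drop_affine (taylor (\<lambda>x. f x $ i) (\<phi> t))"

definition F_series ::
    "(real ^ 'n :: finite \<Rightarrow> real ^ 'n) \<Rightarrow> (real \<Rightarrow> real ^ 'n) \<Rightarrow> (real \<Rightarrow> complex ^ 'n ^ 'n) \<Rightarrow>
     real \<Rightarrow> 'n \<Rightarrow> (complex, 'n) mfps" where
  "F_series f \<phi> Q t i =
     (\<Sum>j\<in>UNIV. mconst (matrix_inv (Q t) $ i $ j) * msubst (Q t) (g_series f \<phi> t j))"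


section \<open>First integrals\<close>

definition grad :: "(real ^ 'n :: finite \<Rightarrow> real) \<Rightarrow> real ^ 'n \<Rightarrow> real ^ 'n" where
  "grad H x = (\<chi> i. frechet_derivative H (at x) (axis i 1))"

text \<open>
  Constancy is required along every arc of a solution that stays in \<open>D\<close>, not only along
  maximal orbits contained in \<open>D\<close>.
\<close>

definition first_integral ::
    "(real ^ 'n :: finite \<Rightarrow> real ^ 'n) \<Rightarrow> (real ^ 'n) set \<Rightarrow> (real ^ 'n \<Rightarrow> real) \<Rightarrow> bool" where
  "first_integral f D H \<longleftrightarrow>
     \<not> H constant_on D \<and>
     (\<forall>x J. open J \<and> is_interval J \<and>
        (\<forall>t\<in>J. x t \<in> D \<and> (x has_vector_derivative f (x t)) (at t)) \<longrightarrow>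
        (\<lambda>t :: real. H (x t)) constant_on J)"

definition functionally_independent ::
    "nat \<Rightarrow> (nat \<Rightarrow> real ^ 'n :: finite \<Rightarrow> real) \<Rightarrow> (real ^ 'n) set \<Rightarrow> bool" where
  "functionally_independent k H D \<longleftrightarrow>
     negligible {x \<in> D. dim ((\<lambda>a. grad (H a) x) ` {..<k}) \<noteq> k}"

definition formal_first_integral_reduced ::
    "(real ^ 'n :: finite \<Rightarrow> real ^ 'n) \<Rightarrow> (real \<Rightarrow> real ^ 'n) \<Rightarrow> real \<Rightarrow>
     (real \<Rightarrow> complex ^ 'n ^ 'n) \<Rightarrow> complex ^ 'n ^ 'n \<Rightarrow> (real \<Rightarrow> (complex, 'n) mfps) \<Rightarrow> bool" where
  "formal_first_integral_reduced f \<phi> T Q A H \<longleftrightarrow>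
     \<not> (\<exists>c. \<forall>t. H t = mconst c) \<and>
     (\<forall>t. H (t + T) = H t) \<and>
     (\<forall>m t. (\<lambda>s. mcoeff (H s) m) differentiable (at t)) \<and>
     (\<forall>t. tderiv H t +
        (\<Sum>i\<in>UNIV. mpartial i (H t) * (linear_form (A $ i) + F_series f \<phi> Q t i)) = 0)"

text \<open>
  The series \<open>K(X,t) = H(Q(t)\<^sup>-\<^sup>1 X, t)\<close> is the expansion in \<open>X = x - \<phi>(t)\<close> of one and the same
  formal function of \<open>x\<close> around the orbit: \<open>K(x - \<phi>(t), t)\<close> does not depend on \<open>t\<close>, that is,
  \<open>\<partial>\<^sub>t K = \<langle>\<partial>\<^sub>X K, \<phi>'(t)\<rangle>\<close>. The reduced system is non-autonomous and has first integrals that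
  violate this, such as the asymptotic phase of an isochronous hyperbolic limit cycle minus \<open>t\<close>;
  these are not first integrals of \<open>x' = f(x)\<close>.
\<close>

definition time_independent ::
    "(real ^ 'n :: finite \<Rightarrow> real ^ 'n) \<Rightarrow> (real \<Rightarrow> real ^ 'n) \<Rightarrow>
     (real \<Rightarrow> complex ^ 'n ^ 'n) \<Rightarrow> (real \<Rightarrow> (complex, 'n) mfps) \<Rightarrow> bool" where
  "time_independent f \<phi> Q H \<longleftrightarrow>
     (let K = (\<lambda>t. msubst (matrix_inv (Q t)) (H t)) in
      \<forall>t. tderiv K t = (\<Sum>i\<in>UNIV. mpartial i (K t) * mconst (complex_of_real (f (\<phi> t) $ i))))"

definition formal_first_integral ::
    "(real ^ 'n :: finite \<Rightarrow> real ^ 'n) \<Rightarrow> (real \<Rightarrow> real ^ 'n) \<Rightarrow> real \<Rightarrow>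
     (real \<Rightarrow> complex ^ 'n ^ 'n) \<Rightarrow> complex ^ 'n ^ 'n \<Rightarrow> (real \<Rightarrow> (complex, 'n) mfps) \<Rightarrow> bool" where
  "formal_first_integral f \<phi> T Q A H \<longleftrightarrow>
     formal_first_integral_reduced f \<phi> T Q A H \<and> time_independent f \<phi> Q H"

text \<open>
  Gradients are taken in \<open>Y\<close>. A column \<open>\<partial>\<^sub>t H\<close> would not change the rank, because \<open>\<partial>\<^sub>t H\<close> is a
  combination of the \<open>\<partial>\<^sub>i H\<close> with coefficients common to all first integrals. The minor is a series
  with coefficients depending on \<open>t\<close>, so nonzero means nonzero at some \<open>t\<close>.
\<close>

definition formally_independent ::
    "nat \<Rightarrow> (nat \<Rightarrow> real \<Rightarrow> (complex, 'n :: finite) mfps) \<Rightarrow> bool" where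
  "formally_independent k H \<longleftrightarrow>
     (\<exists>s. inj_on s {..<k} \<and> (\<exists>t. nat_det k (\<lambda>a b. mpartial (s b) (H a t)) \<noteq> 0))"

end

theory Submission
  imports
    Defs
    "HOL-Computational_Algebra.Fundamental_Theorem_Algebra"
    "Jordan_Normal_Form.Determinant"
begin

text \<open>
  Let \<open>\<sigma>\<close> be the automorphism of \<open>\<complex>[[X]]\<close> given by the flow over one period along the orbit;
  first integrals yield power series fixed by \<open>\<sigma>\<close>. The coefficients of \<open>\<sigma>\<^sup>k h\<close> are exponential
  polynomials in \<open>k\<close>. Suppose an exponent \<open>\<lambda>\<close> is not in \<open>\<rat> \<cdot> 2\<pi>\<i>/T\<close> and choose a \<open>\<rat>\<close>-linear
  \<open>\<kappa>\<close> on \<open>\<complex>\<close> with \<open>\<kappa>(2\<pi>\<i>) = 0\<close> and \<open>\<kappa>(\<lambda>T) \<noteq> 0\<close>. Multiplication by \<open>\<kappa>(log \<rho>)\<close> on the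
  generalized \<open>\<rho>\<close>-eigenspaces of \<open>\<sigma>\<close> is a derivation \<open>D = \<Sum>\<^sub>i D(X\<^sub>i) \<partial>\<^sub>i\<close> of \<open>\<complex>[[X]]\<close> that
  kills everything fixed by \<open>\<sigma>\<close>. The vector field \<open>f\<close> also kills the first integrals; as there are
  \<open>n - 1\<close> independent ones, \<open>D\<close> and \<open>f\<close> are proportional. Since \<open>D(X\<^sub>i)\<close> has no constant term
  while \<open>f\<close> does not vanish on the orbit, the linear part of \<open>D\<close> maps into the direction tangent to
  the orbit. But \<open>D\<close> multiplies the linear form \<open>l\<close> belonging to \<open>\<lambda>\<close> by a nonzero number, and \<open>l\<close>
  vanishes on that direction because \<open>\<lambda> \<noteq> 0\<close>: a contradiction.
\<close>

text \<open>The point of \<kappa>: the eigenvalues of \<sigma> in higher degree are products of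
  multipliers, and no branch of the logarithm is additive on products. A functional that ignores
  2\<pi>\<i> turns the logarithm into a genuine character of the multiplicative group, so weighting
  by it obeys the product rule, with resonances and Jordan blocks treated like everything else. The
  series form an infinite-dimensional space, so its generalized eigenspaces are never formed: a
  component is read off from the scalar sequence of a fixed coefficient of
  \<open>(\<sigma> ^^ k) h\<close>, and uniqueness of the decomposition of such sequences replaces
  spectral theory. Formal integrals have no values, so both kinds of integrals are turned into
  series K(X,t) in the displacement X from \<phi>(t), subject to \<partial>_t K = <\<partial>_X K,
  f(\<phi>(t))> and <\<partial>_X K, f(\<phi>(t) + X)> = 0. Their difference is a transport equation
  along the orbit, and \<sigma> is its solution operator over one period; the second equation alone
  gives the proportionality with f.\<close>

hide_const (open) Matrix.mat Matrix.vec Determinant.det Matrix.row Matrix.col Matrix.unit_vec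
hide_fact (open) Matrix.vec_eq_iff Matrix.mat_def Determinant.det_def
no_notation Matrix.vec_index (infixl "$" 100)

text \<open>Otherwise the simplifier rewrites \<open>axis j 1\<close> to \<open>axis j (Suc 0)\<close>.\<close>

declare One_nat_def [simp del]

section \<open>Formal power series in several variables\<close>

lemma mcoeff_Abs [simp]: "mcoeff (Abs_mfps c) = c"
  by (simp add: Abs_mfps_inverse)

lemma mcoeff_zero [simp]: "mcoeff 0 m = 0" by transfer simp
lemma mcoeff_one: "mcoeff 1 m = (if m = 0 then 1 else 0)" by transfer simp
lemma mcoeff_add [simp]: "mcoeff (f + g) m = mcoeff f m + mcoeff g m" by transfer simp
lemma mcoeff_diff [simp]: "mcoeff (f - g) m = mcoeff f m - mcoeff g m" by transfer simp
lemma mcoeff_uminus [simp]: "mcoeff (- f) m = - mcoeff f m" by transfer simp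
lemma mcoeff_mult: "mcoeff (f * g) m = (\<Sum>(k, l)\<in>splits m. mcoeff f k * mcoeff g l)"
  by transfer simp

lemma mcoeff_sum [simp]: "mcoeff (sum f A) m = (\<Sum>a\<in>A. mcoeff (f a) m)"
  by (induction A rule: infinite_finite_induct) auto

lemma mcoeff_mconst: "mcoeff (mconst c) m = (if m = 0 then c else 0)"
  by (simp add: mconst_def)

lemma mcoeff_linear_form: "mcoeff (linear_form r) m = (\<Sum>j\<in>UNIV. if m = axis j 1 then r $ j else 0)"
  by (simp add: linear_form_def)

lemma mcoeff_mpartial: "mcoeff (mpartial j h) m = of_nat (m $ j + 1) * mcoeff h (m + axis j 1)"
  by (simp add: mpartial_def)

lemma axis_nat_eq_iff [simp]: "(axis i 1 :: nat ^ 'n) = axis j 1 \<longleftrightarrow> i = j"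
  by (simp add: axis_eq_axis)

lemma axis_nat_neq_0 [simp]: "(axis j 1 :: nat ^ 'n) \<noteq> 0" "0 \<noteq> (axis j 1 :: nat ^ 'n)"
  by (auto simp: vec_eq_iff axis_def)

lemma mcoeff_linear_form_axis [simp]: "mcoeff (linear_form r) (axis j 1) = r $ j"
  by (simp add: mcoeff_linear_form)

lemma splits_0 [simp]: "splits 0 = {(0, 0)}"
proof -
  have "k = 0 \<and> l = 0" if "k + l = (0 :: nat ^ 'n)" for k l
    using that by (auto simp: vec_eq_iff)
  then show ?thesis by (auto simp: splits_def)
qed

lemma mcoeff_mult_0 [simp]: "mcoeff (f * g) 0 = mcoeff f 0 * mcoeff g 0"
  by (simp add: mcoeff_mult)

lemma mcoeff_mconst_mult [simp]:
  fixes f :: "('a :: comm_ring_1, 'n :: finite) mfps"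
  shows "mcoeff (mconst c * f) m = c * mcoeff f m"
proof -
  have "mcoeff (mconst c * f) m = (\<Sum>(a, b)\<in>{(0 :: nat ^ 'n, m)}. (if a = 0 then c else 0) * mcoeff f b)"
    unfolding mcoeff_mult mcoeff_mconst
    by (rule sum.mono_neutral_right) (auto simp: finite_splits, auto simp: splits_def split: if_splits)
  then show ?thesis by simp
qed

lemma mconst_0 [simp]: "mconst 0 = 0" and mconst_1 [simp]: "mconst 1 = 1"
  and mconst_add: "mconst (a + b) = mconst a + mconst b"
  and mconst_mult: "mconst (a * b) = mconst a * mconst b"
  and mconst_uminus: "mconst (- a) = - mconst a"
  and mconst_diff: "mconst (a - b) = mconst a - mconst b"
  for a b :: "'a :: comm_ring_1"
  by (rule mfps_eqI; simp add: mcoeff_mconst mcoeff_one)+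

lemma mconst_sum: "mconst (sum f A) = (\<Sum>a\<in>A. mconst (f a :: 'a :: comm_ring_1))"
  by (induction A rule: infinite_finite_induct) (simp_all add: mconst_add)

section \<open>Total degree and induction on exponents\<close>

lemma mdeg_0 [simp]: "mdeg 0 = 0" by (simp add: mdeg_def)
lemma mdeg_add [simp]: "mdeg (a + b) = mdeg a + mdeg b" by (simp add: mdeg_def sum.distrib)
lemma mdeg_axis [simp]: "mdeg (axis j 1 :: nat ^ 'n) = 1"
proof -
  have "mdeg (axis j 1 :: nat ^ 'n) = (\<Sum>i\<in>UNIV. if i = j then 1 else 0)"
    unfolding mdeg_def axis_def by (intro sum.cong) auto
  then show ?thesis by simp
qed
lemma mdeg_eq_0_iff [simp]: "mdeg m = 0 \<longleftrightarrow> m = 0" by (simp add: mdeg_def vec_eq_iff)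

lemma finite_mdeg_le: "finite {m :: nat ^ 'n :: finite. mdeg m \<le> N}"
proof -
  have "{m :: nat ^ 'n. mdeg m \<le> N} \<subseteq> {m. \<forall>i. m $ i \<in> {..N}}"
  proof safe
    fix m :: "nat ^ 'n" and i assume "mdeg m \<le> N"
    moreover have "m $ i \<le> mdeg m" unfolding mdeg_def by (rule member_le_sum) auto
    ultimately show "m $ i \<le> N" by simp
  qed
  moreover have "finite {m :: nat ^ 'n. \<forall>i. m $ i \<in> {..N}}"
  proof -
    \<comment> \<open>The vectors bounded by \<open>N\<close> in every component are the left parts
      of splittings of the constant vector \<open>N\<close>, and these are finite in number.\<close>
    have "{m :: nat ^ 'n. \<forall>i. m $ i \<in> {..N}} \<subseteq> fst ` splits (\<chi> i. N)"
    proof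
      fix m :: "nat ^ 'n" assume "m \<in> {m. \<forall>i. m $ i \<in> {..N}}"
      then have "(m, (\<chi> i. N - m $ i)) \<in> splits (\<chi> i. N)" by (auto simp: splits_def vec_eq_iff)
      then show "m \<in> fst ` splits (\<chi> i. N)" by force
    qed
    then show ?thesis using finite_splits finite_surj by blast
  qed
  ultimately show ?thesis by (rule finite_subset)
qed

lemma finite_mdeg_less: "finite {m :: nat ^ 'n :: finite. mdeg m < N}"
  by (rule finite_subset[OF _ finite_mdeg_le[of N]]) auto

lemma finite_mdeg_eq: "finite {m :: nat ^ 'n :: finite. mdeg m = N}"
  by (rule finite_subset[OF _ finite_mdeg_le[of N]]) auto

lemma axis_decomp: "(m :: nat ^ 'n) $ j \<noteq> 0 \<Longrightarrow> \<exists>k. m = k + axis j 1"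
  by (rule exI[of _ "\<chi> i. m $ i - axis j 1 $ i"]) (auto simp: vec_eq_iff axis_def)

text \<open>Every exponent is reached from 0 by adding one variable at a time. Identities for
  derivations and ring homomorphisms are thereby reduced to multiplication by a single
  variable.\<close>

lemma nat_vec_induct [case_names 0 step]:
  assumes "P 0" "\<And>k j. P k \<Longrightarrow> P (k + axis j 1)"
  shows "P (m :: nat ^ 'n :: finite)"
proof (induction "mdeg m" arbitrary: m)
  case 0
  then have "m = 0" using mdeg_eq_0_iff by metis
  then show ?case using assms by simp
next
  case (Suc d)
  then obtain j where "m $ j \<noteq> 0" by (metis mdeg_eq_0_iff nat.distinct(1) vec_eq_iff zero_index)
  then obtain k where k: "m = k + axis j 1" using axis_decomp by blast
  then have "d = mdeg k" using Suc by simp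
  then show ?case using Suc assms k by simp
qed

lemma mdeg_eq_1_cases:
  assumes "mdeg (m :: nat ^ 'n :: finite) = 1" obtains j where "m = axis j 1"
proof -
  obtain j where "m $ j \<noteq> 0" using assms by (metis mdeg_eq_0_iff zero_neq_one vec_eq_iff zero_index)
  then obtain k where k: "m = k + axis j 1" using axis_decomp by blast
  then have "mdeg k = 0" using assms by simp
  then show ?thesis using k that by simp
qed

section \<open>Partial derivatives\<close>

lemma mpartial_add: "mpartial j (f + g) = mpartial j f + mpartial j g"
  by (rule mfps_eqI) (simp add: mcoeff_mpartial algebra_simps)
lemma mpartial_diff: "mpartial j (f - g) = mpartial j f - mpartial j g"
  by (rule mfps_eqI) (simp add: mcoeff_mpartial algebra_simps)
lemma mpartial_0 [simp]: "mpartial j 0 = 0"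
  by (rule mfps_eqI) (simp add: mcoeff_mpartial)
lemma mpartial_sum: "mpartial j (sum f A) = (\<Sum>a\<in>A. mpartial j (f a))"
  by (induction A rule: infinite_finite_induct) (simp_all add: mpartial_add)
lemma mpartial_mconst [simp]: "mpartial j (mconst c) = 0"
  by (rule mfps_eqI) (auto simp: mcoeff_mpartial mcoeff_mconst vec_eq_iff axis_def)
lemma mpartial_1 [simp]: "mpartial j 1 = 0"
  using mpartial_mconst[of j 1] by simp

lemma mpartial_commute: "mpartial i (mpartial j h) = mpartial j (mpartial i h)"
  by (rule mfps_eqI) (auto simp: mcoeff_mpartial axis_def ac_simps)

text \<open>The index shift of the product rule: terms with \<open>k $ j = 0\<close> carry the
  factor 0, and the other left parts are \<open>k' + axis j 1\<close> for the splittings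
  \<open>(k', l)\<close> of \<open>m\<close>.\<close>

lemma splits_sum_axis:
  fixes f g :: "nat ^ 'n :: finite \<Rightarrow> 'a :: comm_ring_1"
  shows "(\<Sum>(k, l)\<in>splits (m + axis j 1). of_nat (k $ j) * f k * g l)
    = (\<Sum>(k, l)\<in>splits m. of_nat (k $ j + 1) * f (k + axis j 1) * g l)"
proof -
  have "(\<Sum>(k, l)\<in>splits (m + axis j 1). of_nat (k $ j) * f k * g l)
     = (\<Sum>(k, l)\<in>{(k, l)\<in>splits (m + axis j 1). k $ j \<noteq> 0}. of_nat (k $ j) * f k * g l)"
    by (rule sum.mono_neutral_right) (auto simp: finite_splits intro!: gr0I)
  also have "\<dots> = (\<Sum>(k, l)\<in>(\<lambda>(k, l). (k + axis j 1, l)) ` splits m. of_nat (k $ j) * f k * g l)"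
  proof (rule sum.cong)
    show "{(k, l)\<in>splits (m + axis j 1). k $ j \<noteq> 0} = (\<lambda>(k, l). (k + axis j 1, l)) ` splits m" (is "?A = ?B")
    proof
      show "?A \<subseteq> ?B"
      proof
        fix p assume "p \<in> ?A"
        then obtain k l where p: "p = (k, l)" and *: "(k, l) \<in> splits (m + axis j 1)" "k $ j \<noteq> 0"
          by (cases p) auto
        then obtain k' where k': "k = k' + axis j 1" using axis_decomp by blast
        with * have "k' + l + axis j 1 = m + axis j 1" by (simp add: splits_def ac_simps)
        then have "(k', l) \<in> splits m" by (simp add: splits_def)
        then show "p \<in> ?B" using k' p by force
      qed
      show "?B \<subseteq> ?A" by (auto simp: splits_def axis_def ac_simps)
    qed
  qed simp
  also have "\<dots> = (\<Sum>(k, l)\<in>splits m. of_nat (k $ j + 1) * f (k + axis j 1) * g l)"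
    by (subst sum.reindex) (auto simp: inj_on_def case_prod_unfold axis_def)
  finally show ?thesis .
qed

lemma splits_sum_swap: "(\<Sum>(k, l)\<in>splits m. F k l) = (\<Sum>(k, l)\<in>splits m. F l k)"
  by (rule sum.reindex_bij_witness[where i = prod.swap and j = prod.swap])
    (auto simp: splits_def ac_simps)

lemma mpartial_mult:
  fixes f g :: "('a :: comm_ring_1, 'n :: finite) mfps"
  shows "mpartial j (f * g) = mpartial j f * g + f * mpartial j g"
proof (rule mfps_eqI)
  fix m :: "nat ^ 'n"
  have "mcoeff (mpartial j (f * g)) m
     = (\<Sum>(k, l)\<in>splits (m + axis j 1). of_nat ((m + axis j 1) $ j) * (mcoeff f k * mcoeff g l))"
    by (simp add: mcoeff_mpartial mcoeff_mult sum_distrib_left case_prod_unfold axis_def)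
  \<comment> \<open>The weight \<open>(m + axis j 1) $ j\<close> is shared out as
    \<open>k $ j + l $ j\<close>; each share yields one term of the product rule.\<close>
  also have "\<dots> = (\<Sum>(k, l)\<in>splits (m + axis j 1).
       of_nat (k $ j) * mcoeff f k * mcoeff g l + of_nat (l $ j) * mcoeff g l * mcoeff f k)"
  proof (rule sum.cong[OF refl], clarify)
    fix k l assume "(k, l) \<in> splits (m + axis j 1)"
    then have "(m + axis j 1) $ j = k $ j + l $ j" by (simp add: splits_def flip: vector_add_component)
    then show "of_nat ((m + axis j 1) $ j) * (mcoeff f k * mcoeff g l)
      = of_nat (k $ j) * mcoeff f k * mcoeff g l + of_nat (l $ j) * mcoeff g l * mcoeff f k"
      by (simp only: of_nat_add) (simp add: algebra_simps)
  qed
  also have "\<dots> = (\<Sum>(k, l)\<in>splits (m + axis j 1). of_nat (k $ j) * mcoeff f k * mcoeff g l)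
      + (\<Sum>(k, l)\<in>splits (m + axis j 1). of_nat (k $ j) * mcoeff g k * mcoeff f l)"
    by (subst (3) splits_sum_swap) (simp add: sum.distrib case_prod_unfold)
  also have "\<dots> = (\<Sum>(k, l)\<in>splits m. of_nat (k $ j + 1) * mcoeff f (k + axis j 1) * mcoeff g l)
      + (\<Sum>(k, l)\<in>splits m. of_nat (k $ j + 1) * mcoeff g (k + axis j 1) * mcoeff f l)"
    by (simp only: splits_sum_axis)
  also have "\<dots> = mcoeff (mpartial j f * g) m + mcoeff (mpartial j g * f) m"
    unfolding mcoeff_mult mcoeff_mpartial by simp
  finally show "mcoeff (mpartial j (f * g)) m = mcoeff (mpartial j f * g + f * mpartial j g) m"
    by (simp add: mult.commute)
qed

lemma mpartial_mconst_mult: "mpartial j (mconst c * f) = mconst c * mpartial j f"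
  by (simp add: mpartial_mult)

section \<open>Monomials, variables and linear forms\<close>

definition mmono :: "nat ^ 'n :: finite \<Rightarrow> ('a :: comm_ring_1, 'n) mfps" where
  "mmono k = Abs_mfps (\<lambda>m. if m = k then 1 else 0)"

definition mvar :: "'n :: finite \<Rightarrow> ('a :: comm_ring_1, 'n) mfps" where
  "mvar j = mmono (axis j 1)"

lemma mcoeff_mmono: "mcoeff (mmono k) m = (if m = k then 1 else 0)"
  by (simp add: mmono_def)

lemma mmono_0 [simp]: "mmono 0 = 1"
  by (rule mfps_eqI) (simp add: mcoeff_mmono mcoeff_one)

lemma mmono_mult: "mmono k * mmono l = (mmono (k + l) :: ('a :: comm_ring_1, 'n :: finite) mfps)"
proof (rule mfps_eqI)
  fix m :: "nat ^ 'n"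
  have "mcoeff (mmono k * mmono l) m = (\<Sum>(a, b)\<in>splits m. if (a, b) = (k, l) then 1 else 0 :: 'a)"
    unfolding mcoeff_mult mcoeff_mmono by (rule sum.cong) auto
  also have "\<dots> = (\<Sum>p\<in>splits m. if p = (k, l) then 1 else 0)"
    by (intro sum.cong) (auto split: if_splits)
  also have "\<dots> = mcoeff (mmono (k + l)) m"
    by (simp add: finite_splits sum.delta) (auto simp: splits_def mcoeff_mmono)
  finally show "mcoeff (mmono k * mmono l) m = mcoeff (mmono (k + l) :: ('a, 'n) mfps) m" .
qed

lemma mmono_axis: "mmono (k + axis j 1) = mmono k * mvar j"
  by (simp add: mvar_def mmono_mult)

lemma linear_form_eq: "linear_form r = (\<Sum>j\<in>UNIV. mconst (r $ j) * mvar j)"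
  by (rule mfps_eqI) (auto simp: mcoeff_linear_form mvar_def mcoeff_mmono intro!: sum.cong)

lemma mpartial_mvar:
  "mpartial i (mvar j) = (if i = j then 1 else 0 :: ('a :: comm_ring_1, 'n :: finite) mfps)"
proof (rule mfps_eqI)
  fix m :: "nat ^ 'n"
  have "m + axis i 1 = axis j 1 \<longleftrightarrow> m = 0 \<and> i = j"
  proof
    assume *: "m + axis i 1 = axis j 1"
    then have "mdeg (m + axis i 1) = 1" by simp
    then have "m = 0" by simp
    with * show "m = 0 \<and> i = j" by simp
  qed auto
  then show "mcoeff (mpartial i (mvar j)) m = mcoeff (if i = j then 1 else 0 :: ('a, 'n) mfps) m"
    by (auto simp: mcoeff_mpartial mvar_def mcoeff_mmono mcoeff_one)
qed

lemma mpartial_linear_form: "mpartial i (linear_form r) = mconst (r $ i)"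
  by (simp add: linear_form_eq mpartial_sum mpartial_mconst_mult mpartial_mvar if_distrib[of "(*) _"] cong: if_cong)

text \<open>The \<open>N\<close>-th power of the ideal generated by the variables. It stands in for
  the adic topology: convergence and continuity become bookkeeping of degrees.\<close>

definition vanish :: "nat \<Rightarrow> ('a :: comm_ring_1, 'n :: finite) mfps \<Rightarrow> bool" where
  "vanish N h \<longleftrightarrow> (\<forall>m. mdeg m < N \<longrightarrow> mcoeff h m = 0)"

lemma vanish_0 [simp]: "vanish 0 h" and vanish_zero [simp]: "vanish N 0" by (simp_all add: vanish_def)
lemma vanish_add: "vanish N f \<Longrightarrow> vanish N g \<Longrightarrow> vanish N (f + g)" by (simp add: vanish_def)
lemma vanish_diff: "vanish N f \<Longrightarrow> vanish N g \<Longrightarrow> vanish N (f - g)" by (simp add: vanish_def)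
lemma vanish_sum: "(\<And>a. a \<in> A \<Longrightarrow> vanish N (f a)) \<Longrightarrow> vanish N (sum f A)"
  by (simp add: vanish_def)
lemma vanish_mono: "vanish N f \<Longrightarrow> M \<le> N \<Longrightarrow> vanish M f" by (auto simp: vanish_def)

lemma vanish_mult:
  fixes f g :: "('a :: comm_ring_1, 'n :: finite) mfps"
  assumes "vanish a f" "vanish b g" shows "vanish (a + b) (f * g)"
  unfolding vanish_def
proof (intro allI impI)
  fix m :: "nat ^ 'n" assume m: "mdeg m < a + b"
  have "mcoeff f k * mcoeff g l = 0" if "(k, l) \<in> splits m" for k l
  proof (cases "mdeg k < a")
    case False
    have "mdeg k + mdeg l = mdeg m" using that by (auto simp: splits_def)
    then have "mdeg l < b" using False m by simp
    then show ?thesis using assms by (simp add: vanish_def)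
  qed (use assms in \<open>simp add: vanish_def\<close>)
  then show "mcoeff (f * g) m = 0" unfolding mcoeff_mult by (intro sum.neutral) auto
qed

lemma vanish_mult1: "vanish a f \<Longrightarrow> vanish a (f * g)"
  using vanish_mult[of a f 0 g] by simp
lemma vanish_mult2: "vanish a g \<Longrightarrow> vanish a (f * g)"
  using vanish_mult[of 0 f a g] by simp

lemma vanish_mpartial: "vanish (Suc N) h \<Longrightarrow> vanish N (mpartial j h)"
  by (simp add: vanish_def mcoeff_mpartial)

lemma vanish_eq_0: "(\<And>N. vanish N h) \<Longrightarrow> h = 0"
  by (rule mfps_eqI) (metis lessI mcoeff_zero vanish_def)

lemma vanish_1_iff: "vanish 1 h \<longleftrightarrow> mcoeff h 0 = 0"
  by (simp add: vanish_def)

definition mtrunc :: "nat \<Rightarrow> ('a :: comm_ring_1, 'n :: finite) mfps \<Rightarrow> ('a, 'n) mfps" where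
  "mtrunc N h = (\<Sum>k | mdeg k < N. mconst (mcoeff h k) * mmono k)"

lemma mcoeff_mtrunc: "mcoeff (mtrunc N h) m = (if mdeg m < N then mcoeff h m else 0)"
  by (simp add: mtrunc_def mcoeff_mmono if_distrib[of "(*) _"] finite_mdeg_less sum.delta' cong: if_cong)

lemma vanish_mtrunc: "vanish N (h - mtrunc N h)"
  by (simp add: vanish_def mcoeff_mtrunc)

text \<open>Replaces density of the polynomials: up to any degree the value at \<open>h\<close> is
  the value at a truncation of \<open>h\<close>, a finite sum of monomials. The loss of one order in
  \<open>van\<close> leaves room for partial derivatives.\<close>

lemma additive_zeroI:
  fixes \<Phi> :: "('a :: comm_ring_1, 'n :: finite) mfps \<Rightarrow> ('b :: comm_ring_1, 'm :: finite) mfps"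
  assumes add: "\<And>f g. \<Phi> (f + g) = \<Phi> f + \<Phi> g"
    and mono: "\<And>c k. \<Phi> (mconst c * mmono k) = 0"
    and van: "\<And>N h. vanish (Suc N) h \<Longrightarrow> vanish N (\<Phi> h)"
  shows "\<Phi> h = 0"
proof (rule vanish_eq_0)
  fix N
  have "\<Phi> 0 = 0" using add[of 0 0] by simp
  then have sum: "\<Phi> (sum f A) = (\<Sum>a\<in>A. \<Phi> (f a))" for f :: "nat ^ 'n \<Rightarrow> _" and A
    by (induction A rule: infinite_finite_induct) (simp_all add: add)
  have "\<Phi> h = \<Phi> (mtrunc (Suc N) h) + \<Phi> (h - mtrunc (Suc N) h)" by (simp flip: add)
  also have "\<Phi> (mtrunc (Suc N) h) = 0" by (simp add: mtrunc_def sum mono)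
  finally show "vanish N (\<Phi> h)" using van[OF vanish_mtrunc] by simp
qed

lemma additive_eqI:
  fixes \<Phi> \<Psi> :: "('a :: comm_ring_1, 'n :: finite) mfps \<Rightarrow> ('b :: comm_ring_1, 'm :: finite) mfps"
  assumes "\<And>f g. \<Phi> (f + g) = \<Phi> f + \<Phi> g" "\<And>f g. \<Psi> (f + g) = \<Psi> f + \<Psi> g"
    and "\<And>c k. \<Phi> (mconst c * mmono k) = \<Psi> (mconst c * mmono k)"
    and "\<And>N h. vanish (Suc N) h \<Longrightarrow> vanish N (\<Phi> h)" "\<And>N h. vanish (Suc N) h \<Longrightarrow> vanish N (\<Psi> h)"
  shows "\<Phi> h = \<Psi> h"
proof -
  have "\<Phi> h - \<Psi> h = 0"
    by (rule additive_zeroI[where \<Phi> = "\<lambda>h. \<Phi> h - \<Psi> h"]) (auto simp: assms intro: vanish_diff)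
  then show ?thesis by simp
qed

text \<open>Uniqueness of digits in base \<open>B\<close>, with the digit \<open>k i\<close> at
  place \<open>e i\<close>: after division by the lowest power that occurs, the lowest digit is the
  residue modulo \<open>B\<close> and can be removed.\<close>

lemma weight_inj:
  fixes e :: "'n :: finite \<Rightarrow> nat"
  assumes "inj_on e A" "finite A" "\<And>i. i \<in> A \<Longrightarrow> k i < B" "\<And>i. i \<in> A \<Longrightarrow> l i < B"
    and "(\<Sum>i\<in>A. k i * B ^ e i) = (\<Sum>i\<in>A. l i * B ^ e i)"
  shows "\<forall>i\<in>A. k i = (l i :: nat)"
  using assms
proof (induction "card A" arbitrary: A)
  case (Suc c)
  then have ne: "A \<noteq> {}" by auto
  define a where "a = arg_min_on e A"
  have a: "a \<in> A" "\<And>x. x \<in> A \<Longrightarrow> e a \<le> e x"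
    using arg_min_if_finite[OF Suc.prems(2) ne, of e] unfolding a_def by (auto simp: not_less)
  have lt: "e a < e x" if "x \<in> A - {a}" for x
    using a(2)[of x] that Suc.prems(1) a(1) by (metis DiffE inj_onD insertI1 nless_le)
  have Bpos: "B > 0" using Suc.prems(3)[OF a(1)] by simp
  have split: "(\<Sum>i\<in>A. f i * B ^ e i) = B ^ e a * (f a + B * (\<Sum>i\<in>A-{a}. f i * B ^ (e i - e a - 1)))" for f
  proof -
    have "(\<Sum>i\<in>A. f i * B ^ e i) = f a * B ^ e a + (\<Sum>i\<in>A-{a}. f i * B ^ e i)"
      using Suc.prems(2) a(1) by (simp add: sum.remove)
    also have "(\<Sum>i\<in>A-{a}. f i * B ^ e i) = (\<Sum>i\<in>A-{a}. B ^ e a * (B * (f i * B ^ (e i - e a - 1))))"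
    proof (rule sum.cong[OF refl])
      fix i assume "i \<in> A - {a}"
      then have "e i = e a + 1 + (e i - e a - 1)" using lt by force
      then have "B ^ e i = B ^ e a * B * B ^ (e i - e a - 1)" by (metis power_add power_one_right)
      then show "f i * B ^ e i = B ^ e a * (B * (f i * B ^ (e i - e a - 1)))" by simp
    qed
    finally show ?thesis by (simp add: sum_distrib_left algebra_simps)
  qed
  have eq: "k a + B * (\<Sum>i\<in>A-{a}. k i * B ^ (e i - e a - 1)) = l a + B * (\<Sum>i\<in>A-{a}. l i * B ^ (e i - e a - 1))"
    using Suc.prems(5) Bpos unfolding split by simp
  then have "(k a + B * (\<Sum>i\<in>A-{a}. k i * B ^ (e i - e a - 1))) mod B
     = (l a + B * (\<Sum>i\<in>A-{a}. l i * B ^ (e i - e a - 1))) mod B" by simp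
  then have ka: "k a = l a" using Suc.prems(3,4)[OF a(1)] by simp
  have "(\<Sum>i\<in>A-{a}. k i * B ^ e i) = (\<Sum>i\<in>A-{a}. l i * B ^ e i)"
    using Suc.prems(5) Suc.prems(2) a(1) ka by (simp add: sum.remove)
  then have "\<forall>i\<in>A-{a}. k i = l i"
    using Suc.hyps(2) a(1) Suc.prems by (intro Suc.hyps(1)) (auto intro: inj_on_subset)
  then show ?case using ka by auto
qed simp

text \<open>
  Among the lowest-degree terms of each factor take the one of least weight, where the weights
  are the values in base \<open>B\<close> of the exponent vectors and so separate the finitely many
  exponents concerned.
\<close>

lemma mfps_mult_eq_0:
  fixes f g :: "('a :: idom, 'n :: finite) mfps"
  assumes "f * g = 0" shows "f = 0 \<or> g = 0"
proof (rule ccontr)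
  assume "\<not> ?thesis"
  then have fg: "f \<noteq> 0" "g \<noteq> 0" by auto
  define p where "p h = (LEAST d. \<exists>k. mdeg k = d \<and> mcoeff h k \<noteq> 0)" for h :: "('a, 'n) mfps"
  \<comment> \<open>\<open>p h\<close> is the lowest degree in \<open>h\<close>, so \<open>B\<close>
    exceeds every component of an exponent of degree \<open>p f\<close> or \<open>p g\<close>, as
    uniqueness of digits requires.\<close>
  define B where "B = p f + p g + 1"
  obtain e :: "'n \<Rightarrow> nat" where e: "inj e"
    using ex_bij_betw_finite_nat[of "UNIV :: 'n set"] by (auto simp: bij_betw_def)
  define w where "w k = (\<Sum>i\<in>UNIV. k $ i * B ^ e i)" for k :: "nat ^ 'n"
  have w_add: "w (k + l) = w k + w l" for k l by (simp add: w_def algebra_simps sum.distrib)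
  have w_inj: "k = l" if "mdeg k < B" "mdeg l < B" "w k = w l" for k l
  proof -
    have "m $ i < B" if "mdeg m < B" for m :: "nat ^ 'n" and i
    proof -
      have "m $ i \<le> mdeg m" unfolding mdeg_def by (rule member_le_sum) auto
      then show ?thesis using that by simp
    qed
    then have "\<forall>i\<in>UNIV. k $ i = l $ i"
      using that e by (intro weight_inj[of e]) (auto simp: w_def)
    then show ?thesis by (simp add: vec_eq_iff)
  qed
  have lead: "\<exists>k. mcoeff h k \<noteq> 0 \<and> mdeg k = p h \<and> (\<forall>l. mcoeff h l \<noteq> 0 \<longrightarrow> p h \<le> mdeg l)
     \<and> (\<forall>l. mcoeff h l \<noteq> 0 \<and> mdeg l = p h \<longrightarrow> w k \<le> w l)" if "h \<noteq> 0" for h :: "('a, 'n) mfps"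
  proof -
    have "\<exists>k. mcoeff h k \<noteq> 0" using that mfps_eqI[of h 0] by auto
    then have "\<exists>d k. mdeg k = d \<and> mcoeff h k \<noteq> 0" by blast
    then have ex: "\<exists>k. mdeg k = p h \<and> mcoeff h k \<noteq> 0" unfolding p_def by (rule LeastI_ex)
    have le: "\<forall>l. mcoeff h l \<noteq> 0 \<longrightarrow> p h \<le> mdeg l"
      unfolding p_def by (auto intro: Least_le)
    obtain k where "mdeg k = p h \<and> mcoeff h k \<noteq> 0"
       "\<And>l. mdeg l = p h \<and> mcoeff h l \<noteq> 0 \<Longrightarrow> w k \<le> w l"
      using exists_least_iff[of "\<lambda>d. \<exists>k. (mdeg k = p h \<and> mcoeff h k \<noteq> 0) \<and> w k = d"] ex
      by (metis linorder_not_less)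
    then show ?thesis using le by blast
  qed
  obtain k where k: "mcoeff f k \<noteq> 0" "mdeg k = p f" "\<And>l. mcoeff f l \<noteq> 0 \<Longrightarrow> p f \<le> mdeg l"
    "\<And>l. mcoeff f l \<noteq> 0 \<Longrightarrow> mdeg l = p f \<Longrightarrow> w k \<le> w l" using lead[OF fg(1)] by blast
  obtain l where l: "mcoeff g l \<noteq> 0" "mdeg l = p g" "\<And>k. mcoeff g k \<noteq> 0 \<Longrightarrow> p g \<le> mdeg k"
    "\<And>k. mcoeff g k \<noteq> 0 \<Longrightarrow> mdeg k = p g \<Longrightarrow> w l \<le> w k" using lead[OF fg(2)] by blast
  have "mcoeff f a * mcoeff g b = 0" if "(a, b) \<in> splits (k + l)" "(a, b) \<noteq> (k, l)" for a b
  proof (rule ccontr)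
    assume "mcoeff f a * mcoeff g b \<noteq> 0"
    then have nz: "mcoeff f a \<noteq> 0" "mcoeff g b \<noteq> 0" by auto
    have s: "a + b = k + l" using that by (simp add: splits_def)
    then have "mdeg a + mdeg b = p f + p g" using k(2) l(2) by (metis mdeg_add)
    with k(3)[OF nz(1)] l(3)[OF nz(2)] have d: "mdeg a = p f" "mdeg b = p g" by auto
    have "w a + w b = w k + w l" using s by (metis w_add)
    with k(4)[OF nz(1) d(1)] l(4)[OF nz(2) d(2)] have "w a = w k" by simp
    then have "a = k" using w_inj[of a k] d k(2) by (simp add: B_def)
    with s have "b = l" by simp
    with \<open>a = k\<close> that show False by simp
  qed
  then have "\<forall>p\<in>splits (k + l) - {(k, l)}. (case p of (a, b) \<Rightarrow> mcoeff f a * mcoeff g b) = 0"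
    by (metis (mono_tags, lifting) DiffE case_prodI2 case_prod_conv singletonI surj_pair)
  then have "mcoeff (f * g) (k + l) = (\<Sum>(a, b)\<in>{(k, l)}. mcoeff f a * mcoeff g b)"
    unfolding mcoeff_mult by (intro sum.mono_neutral_right finite_splits) (auto simp: splits_def)
  then show False using assms k(1) l(1) by simp
qed

text \<open>Linear systems with series as coefficients occur below, and their nonzero minors have to
  be cancelled.\<close>

instance mfps :: (idom, finite) idom
  by standard (use mfps_mult_eq_0 in blast)

section \<open>Sequences annihilated by a polynomial in the shift\<close>

definition shift_minus :: "complex \<Rightarrow> (nat \<Rightarrow> complex) \<Rightarrow> nat \<Rightarrow> complex" where
  "shift_minus \<rho> a = (\<lambda>k. a (Suc k) - \<rho> * a k)"

text \<open>For nonzero \<open>\<rho>\<close> these are the sequences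
  \<open>p k * \<rho> ^ k\<close> with a polynomial \<open>p\<close>; for \<open>\<rho> = 0\<close>,
  those with finitely many nonzero terms.\<close>

definition gen_eig :: "complex \<Rightarrow> (nat \<Rightarrow> complex) set" where
  "gen_eig \<rho> = {a. \<exists>K. (shift_minus \<rho> ^^ K) a = (\<lambda>_. 0)}"

lemma shift_minus_0: "shift_minus \<rho> (\<lambda>_. 0) = (\<lambda>_. 0)"
  by (simp add: shift_minus_def)

lemma shift_minus_pow_0: "(shift_minus \<rho> ^^ K) (\<lambda>_. 0) = (\<lambda>_. 0)"
  by (induction K) (simp_all add: shift_minus_0)

lemma shift_minus_add: "shift_minus \<rho> (\<lambda>k. a k + b k) = (\<lambda>k. shift_minus \<rho> a k + shift_minus \<rho> b k)"
  and shift_minus_cmult: "shift_minus \<rho> (\<lambda>k. c * a k) = (\<lambda>k. c * shift_minus \<rho> a k)"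
  by (simp_all add: shift_minus_def algebra_simps)

lemma shift_minus_pow_add:
  "(shift_minus \<rho> ^^ K) (\<lambda>k. a k + b k) = (\<lambda>k. (shift_minus \<rho> ^^ K) a k + (shift_minus \<rho> ^^ K) b k)"
  by (induction K) (simp_all add: shift_minus_add)

lemma shift_minus_pow_cmult:
  "(shift_minus \<rho> ^^ K) (\<lambda>k. c * a k) = (\<lambda>k. c * (shift_minus \<rho> ^^ K) a k)"
  by (induction K) (simp_all add: shift_minus_cmult)

lemma shift_minus_sum:
  "finite F \<Longrightarrow> shift_minus \<rho> (\<lambda>k. \<Sum>x\<in>F. a x k) = (\<lambda>k. \<Sum>x\<in>F. shift_minus \<rho> (a x) k)"
  by (simp add: shift_minus_def sum_subtractf sum_distrib_left)

lemma shift_minus_pow_sum: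
  "finite F \<Longrightarrow> (shift_minus \<rho> ^^ K) (\<lambda>k. \<Sum>x\<in>F. a x k) = (\<lambda>k. \<Sum>x\<in>F. (shift_minus \<rho> ^^ K) (a x) k)"
  by (induction K) (simp_all add: shift_minus_sum)

lemma shift_minus_commute: "shift_minus \<rho> (shift_minus \<tau> a) = shift_minus \<tau> (shift_minus \<rho> a)"
  by (simp add: shift_minus_def algebra_simps)

lemma shift_minus_pow_commute1:
  "(shift_minus \<rho> ^^ K) (shift_minus \<tau> a) = shift_minus \<tau> ((shift_minus \<rho> ^^ K) a)"
  by (induction K) (simp_all add: shift_minus_commute)

lemma shift_minus_pow_commute:
  "(shift_minus \<rho> ^^ K) ((shift_minus \<tau> ^^ L) a) = (shift_minus \<tau> ^^ L) ((shift_minus \<rho> ^^ K) a)"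
  by (induction L) (simp_all add: shift_minus_pow_commute1)

lemma shift_minus_pow_le:
  assumes "(shift_minus \<rho> ^^ K) a = (\<lambda>_. 0)" "K \<le> L"
  shows "(shift_minus \<rho> ^^ L) a = (\<lambda>_. 0)"
proof -
  have "(shift_minus \<rho> ^^ L) a = (shift_minus \<rho> ^^ (L - K)) ((shift_minus \<rho> ^^ K) a)"
    using assms(2) by (metis comp_apply funpow_add le_add_diff_inverse2)
  then show ?thesis using assms(1) by (simp add: shift_minus_pow_0)
qed

lemma gen_eig_0: "(\<lambda>_. 0) \<in> gen_eig \<rho>"
  by (auto simp: gen_eig_def intro: exI[of _ 0])

lemma gen_eig_add: "a \<in> gen_eig \<rho> \<Longrightarrow> b \<in> gen_eig \<rho> \<Longrightarrow> (\<lambda>k. a k + b k) \<in> gen_eig \<rho>"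
proof -
  assume "a \<in> gen_eig \<rho>" "b \<in> gen_eig \<rho>"
  then obtain K L where *: "(shift_minus \<rho> ^^ K) a = (\<lambda>_. 0)" "(shift_minus \<rho> ^^ L) b = (\<lambda>_. 0)"
    by (auto simp: gen_eig_def)
  have "(shift_minus \<rho> ^^ (max K L)) (\<lambda>k. a k + b k) = (\<lambda>_. 0)"
    unfolding shift_minus_pow_add
    using shift_minus_pow_le[OF *(1), of "max K L"] shift_minus_pow_le[OF *(2), of "max K L"] by simp
  then show ?thesis by (auto simp: gen_eig_def)
qed

lemma gen_eig_cmult: "a \<in> gen_eig \<rho> \<Longrightarrow> (\<lambda>k. c * a k) \<in> gen_eig \<rho>"
proof -
  assume "a \<in> gen_eig \<rho>"
  then obtain K where K: "(shift_minus \<rho> ^^ K) a = (\<lambda>_. 0)" by (auto simp: gen_eig_def)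
  then have "(shift_minus \<rho> ^^ K) (\<lambda>k. c * a k) = (\<lambda>_. 0)"
    by (simp only: shift_minus_pow_cmult mult_zero_right)
  then show ?thesis unfolding gen_eig_def mem_Collect_eq by (rule exI)
qed

lemma gen_eig_shift: "a \<in> gen_eig \<rho> \<Longrightarrow> (shift_minus \<tau> ^^ L) a \<in> gen_eig \<rho>"
proof -
  assume "a \<in> gen_eig \<rho>"
  then obtain K where K: "(shift_minus \<rho> ^^ K) a = (\<lambda>_. 0)" by (auto simp: gen_eig_def)
  then have "(shift_minus \<rho> ^^ K) ((shift_minus \<tau> ^^ L) a) = (\<lambda>_. 0)"
    by (subst shift_minus_pow_commute) (simp add: shift_minus_pow_0)
  then show ?thesis unfolding gen_eig_def mem_Collect_eq by (rule exI)
qed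

lemma gen_eig_Suc: "shift_minus \<rho> a \<in> gen_eig \<rho> \<Longrightarrow> a \<in> gen_eig \<rho>"
proof -
  assume "shift_minus \<rho> a \<in> gen_eig \<rho>"
  then obtain K where "(shift_minus \<rho> ^^ K) (shift_minus \<rho> a) = (\<lambda>_. 0)" by (auto simp: gen_eig_def)
  then have "(shift_minus \<rho> ^^ Suc K) a = (\<lambda>_. 0)" by (simp only: funpow_Suc_right comp_apply)
  then show ?thesis unfolding gen_eig_def mem_Collect_eq by (rule exI)
qed

lemma gen_eig_power: "(\<lambda>k. c * \<rho> ^ k) \<in> gen_eig \<rho>"
  by (rule gen_eig_Suc) (simp add: shift_minus_def gen_eig_0)

text \<open>Induction on the sum of the two nilpotency orders: applied to a product, the shift minus
  \<open>\<rho> * \<tau>\<close> gives three products, in each of which at least one factor has a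
  smaller order.\<close>

lemma gen_eig_mult: "a \<in> gen_eig \<rho> \<Longrightarrow> b \<in> gen_eig \<tau> \<Longrightarrow> (\<lambda>k. a k * b k) \<in> gen_eig (\<rho> * \<tau>)"
proof -
  have main: "(shift_minus \<rho> ^^ K) a = (\<lambda>_. 0) \<Longrightarrow> (shift_minus \<tau> ^^ L) b = (\<lambda>_. 0)
     \<Longrightarrow> (\<lambda>k. a k * b k) \<in> gen_eig (\<rho> * \<tau>)" for K L a b
  proof (induction "K + L" arbitrary: K L a b)
    case 0
    then show ?case by (simp add: gen_eig_0)
  next
    case (Suc N)
    show ?case
    proof (cases "K = 0 \<or> L = 0")
      case True
      then have "a = (\<lambda>_. 0) \<or> b = (\<lambda>_. 0)" using Suc.prems by auto
      then show ?thesis by (auto simp: gen_eig_0)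
    next
      case False
      then obtain K' L' where KL: "K = Suc K'" "L = Suc L'" by (metis not0_implies_Suc)
      have a': "(shift_minus \<rho> ^^ K') (shift_minus \<rho> a) = (\<lambda>_. 0)"
        using Suc.prems(1) unfolding KL by (simp only: funpow_Suc_right comp_apply)
      have b': "(shift_minus \<tau> ^^ L') (shift_minus \<tau> b) = (\<lambda>_. 0)"
        using Suc.prems(2) unfolding KL by (simp only: funpow_Suc_right comp_apply)
      have 1: "(\<lambda>k. shift_minus \<rho> a k * b k) \<in> gen_eig (\<rho> * \<tau>)"
        using Suc.hyps(2) KL by (intro Suc.hyps(1)[OF _ a' Suc.prems(2)]) simp
      have 2: "(\<lambda>k. a k * shift_minus \<tau> b k) \<in> gen_eig (\<rho> * \<tau>)"
        using Suc.hyps(2) KL by (intro Suc.hyps(1)[OF _ Suc.prems(1) b']) simp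
      have 3: "(\<lambda>k. shift_minus \<rho> a k * shift_minus \<tau> b k) \<in> gen_eig (\<rho> * \<tau>)"
      proof -
        \<comment> \<open>The induction hypothesis is for sums equal to the predecessor of
          \<open>K + L\<close>. Both factors have dropped here, so one order is raised
          again.\<close>
        have b'': "(shift_minus \<tau> ^^ L) (shift_minus \<tau> b) = (\<lambda>_. 0)"
          by (rule shift_minus_pow_le[OF b']) (simp add: KL)
        show ?thesis using Suc.hyps(2) KL by (intro Suc.hyps(1)[OF _ a' b'']) simp
      qed
      have eq: "shift_minus (\<rho> * \<tau>) (\<lambda>k. a k * b k)
        = (\<lambda>k. shift_minus \<rho> a k * shift_minus \<tau> b k
             + (\<tau> * (shift_minus \<rho> a k * b k) + \<rho> * (a k * shift_minus \<tau> b k)))"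
        by (rule ext) (simp add: shift_minus_def algebra_simps)
      show ?thesis
        by (rule gen_eig_Suc, unfold eq)
          (rule gen_eig_add[OF 3 gen_eig_add[OF gen_eig_cmult[OF 1] gen_eig_cmult[OF 2]]])
    qed
  qed
  assume "a \<in> gen_eig \<rho>" "b \<in> gen_eig \<tau>"
  then show ?thesis using main by (auto simp: gen_eig_def)
qed

text \<open>Induction on the order at \<open>\<rho>\<close> reduces to a true eigensequence, on
  which the shift minus \<open>\<tau>\<close> is multiplication by the nonzero number
  \<open>\<rho> - \<tau>\<close>.\<close>

lemma gen_eig_disjoint:
  assumes "\<rho> \<noteq> \<tau>" "a \<in> gen_eig \<rho>" "(shift_minus \<tau> ^^ L) a = (\<lambda>_. 0)"
  shows "a = (\<lambda>_. 0)"
proof -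
  have main: "(shift_minus \<rho> ^^ K) a = (\<lambda>_. 0) \<Longrightarrow> (shift_minus \<tau> ^^ L) a = (\<lambda>_. 0) \<Longrightarrow> a = (\<lambda>_. 0)" for K a
  proof (induction K arbitrary: a)
    case (Suc K)
    have "(shift_minus \<rho> ^^ K) (shift_minus \<rho> a) = (\<lambda>_. 0)"
      using Suc.prems(1) by (simp only: funpow_Suc_right comp_apply)
    moreover have "(shift_minus \<tau> ^^ L) (shift_minus \<rho> a) = (\<lambda>_. 0)"
      using Suc.prems(2) by (simp add: shift_minus_pow_commute1 shift_minus_0)
    ultimately have "shift_minus \<rho> a = (\<lambda>_. 0)" by (rule Suc.IH)
    then have "a (Suc k) = \<rho> * a k" for k by (metis eq_iff_diff_eq_0 shift_minus_def)
    then have step: "shift_minus \<tau> a = (\<lambda>k. (\<rho> - \<tau>) * a k)"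
      by (simp add: shift_minus_def algebra_simps)
    have "(shift_minus \<tau> ^^ j) a = (\<lambda>k. (\<rho> - \<tau>) ^ j * a k)" for j
      by (induction j) (simp_all add: shift_minus_cmult step mult.assoc mult.left_commute)
    then have "(\<rho> - \<tau>) ^ L * a k = 0" for k using Suc.prems(2) by metis
    then show ?case using assms(1) by auto
  qed simp
  show ?thesis using assms main by (auto simp: gen_eig_def)
qed

text \<open>A power of the shift minus \<open>\<tau>\<close> removes the summand at
  \<open>\<tau>\<close>; it maps every other space into itself and, by
  \<open>gen_eig_disjoint\<close>, injectively.\<close>

lemma gen_eig_independent:
  assumes "finite F" "\<And>\<rho>. \<rho> \<in> F \<Longrightarrow> b \<rho> \<in> gen_eig \<rho>" "(\<lambda>k. \<Sum>\<rho>\<in>F. b \<rho> k) = (\<lambda>_. 0)" "\<rho> \<in> F"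
  shows "b \<rho> = (\<lambda>_. 0)"
  using assms
proof (induction F arbitrary: b \<rho> rule: finite_induct)
  case (insert \<tau> F)
  obtain K where K: "(shift_minus \<tau> ^^ K) (b \<tau>) = (\<lambda>_. 0)"
    using insert.prems(1)[of \<tau>] by (auto simp: gen_eig_def)
  have "(\<lambda>k. \<Sum>\<rho>\<in>F. (shift_minus \<tau> ^^ K) (b \<rho>) k)
     = (shift_minus \<tau> ^^ K) (\<lambda>k. \<Sum>\<rho>\<in>insert \<tau> F. b \<rho> k)"
    using insert.hyps by (subst shift_minus_pow_sum) (simp_all add: K)
  also have "\<dots> = (\<lambda>_. 0)" using insert.prems(2) by (simp add: shift_minus_pow_0)
  finally have "(shift_minus \<tau> ^^ K) (b \<rho>) = (\<lambda>_. 0)" if "\<rho> \<in> F" for \<rho>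
    using insert.IH[of "\<lambda>\<rho>. (shift_minus \<tau> ^^ K) (b \<rho>)" \<rho>] insert.prems(1) gen_eig_shift that by simp
  then have z: "b \<rho> = (\<lambda>_. 0)" if "\<rho> \<in> F" for \<rho>
    using gen_eig_disjoint[of \<rho> \<tau> "b \<rho>" K] insert.prems(1) insert.hyps that by auto
  have "b \<tau> k = 0" for k
    using fun_cong[OF insert.prems(2), of k] insert.hyps z by simp
  then show ?case using z insert.prems(3) by auto
qed simp

text \<open>The parts are indexed by all complex numbers, so that two decompositions compare without
  matching index sets. The part at 0 is excluded because a character is additive on nonzero numbers
  only.\<close>

definition decomp :: "(nat \<Rightarrow> complex) \<Rightarrow> (complex \<Rightarrow> nat \<Rightarrow> complex) \<Rightarrow> bool" where
  "decomp a b \<longleftrightarrow> finite {\<rho>. b \<rho> \<noteq> (\<lambda>_. 0)} \<and> b 0 = (\<lambda>_. 0) \<and> (\<forall>\<rho>. b \<rho> \<in> gen_eig \<rho>) \<and>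
     a = (\<lambda>k. \<Sum>\<rho> | b \<rho> \<noteq> (\<lambda>_. 0). b \<rho> k)"

lemma decomp_sum: 
  assumes "decomp a b" "finite F" "{\<rho>. b \<rho> \<noteq> (\<lambda>_. 0)} \<subseteq> F"
  shows "a k = (\<Sum>\<rho>\<in>F. b \<rho> k)"
proof -
  have "(\<Sum>\<rho> | b \<rho> \<noteq> (\<lambda>_. 0). b \<rho> k) = (\<Sum>\<rho>\<in>F. b \<rho> k)"
    by (rule sum.mono_neutral_left) (use assms in auto)
  then show ?thesis using assms(1) by (simp add: decomp_def)
qed

lemma decompI:
  assumes "finite F" "\<And>\<rho>. \<rho> \<notin> F \<Longrightarrow> b \<rho> = (\<lambda>_. 0)" "b 0 = (\<lambda>_. 0)" "\<And>\<rho>. b \<rho> \<in> gen_eig \<rho>"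
    "\<And>k. a k = (\<Sum>\<rho>\<in>F. b \<rho> k)"
  shows "decomp a b"
proof -
  have sub: "{\<rho>. b \<rho> \<noteq> (\<lambda>_. 0)} \<subseteq> F" using assms(2) by blast
  have "(\<Sum>\<rho> | b \<rho> \<noteq> (\<lambda>_. 0). b \<rho> k) = (\<Sum>\<rho>\<in>F. b \<rho> k)" for k
    by (rule sum.mono_neutral_left) (use assms sub in auto)
  then show ?thesis using assms finite_subset[OF sub] by (auto simp: decomp_def)
qed

lemma decomp_unique:
  assumes "decomp a b" "decomp a c" shows "b = c"
proof
  fix \<rho>
  define F where "F = insert \<rho> ({\<rho>. b \<rho> \<noteq> (\<lambda>_. 0)} \<union> {\<rho>. c \<rho> \<noteq> (\<lambda>_. 0)})"
  have F: "finite F" "{\<rho>. b \<rho> \<noteq> (\<lambda>_. 0)} \<subseteq> F" "{\<rho>. c \<rho> \<noteq> (\<lambda>_. 0)} \<subseteq> F"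
    using assms by (auto simp: F_def decomp_def)
  have "(\<Sum>\<rho>\<in>F. b \<rho> k + (-1) * c \<rho> k) = 0" for k
    using decomp_sum[OF assms(1) F(1,2), of k] decomp_sum[OF assms(2) F(1,3), of k]
    by (simp add: sum_subtractf)
  then have "(\<lambda>k. b \<rho> k + (-1) * c \<rho> k) = (\<lambda>_. 0)"
    using F assms
    by (intro gen_eig_independent[of F "\<lambda>\<rho> k. b \<rho> k + (-1) * c \<rho> k"] gen_eig_add gen_eig_cmult)
      (auto simp: decomp_def F_def)
  then show "b \<rho> = c \<rho>" by (auto simp: fun_eq_iff)
qed

section \<open>Exponential polynomials and the functional defined by a character\<close>

definition quasi_poly :: "(nat \<Rightarrow> complex) \<Rightarrow> bool" where "quasi_poly a \<longleftrightarrow> (\<exists>b. decomp a b)"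

text \<open>For \<open>a k = (\<Sum>\<rho>. p \<rho> k * \<rho> ^ k)\<close> with polynomials \<open>p \<rho>\<close> this is \<open>\<Sum>\<rho>. \<kappa> \<rho> * p \<rho> 0\<close>.\<close>

definition dfun :: "(complex \<Rightarrow> complex) \<Rightarrow> (nat \<Rightarrow> complex) \<Rightarrow> complex" where
  "dfun \<kappa> a = (let b = (THE b. decomp a b) in (\<Sum>\<rho> | b \<rho> \<noteq> (\<lambda>_. 0). \<kappa> \<rho> * b \<rho> 0))"

lemma dfun_eq:
  assumes "decomp a b" "finite F" "{\<rho>. b \<rho> \<noteq> (\<lambda>_. 0)} \<subseteq> F"
  shows "dfun \<kappa> a = (\<Sum>\<rho>\<in>F. \<kappa> \<rho> * b \<rho> 0)"
proof -
  have "(THE b. decomp a b) = b" using assms(1) decomp_unique by blast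
  then have "dfun \<kappa> a = (\<Sum>\<rho> | b \<rho> \<noteq> (\<lambda>_. 0). \<kappa> \<rho> * b \<rho> 0)" by (simp add: dfun_def Let_def)
  also have "\<dots> = (\<Sum>\<rho>\<in>F. \<kappa> \<rho> * b \<rho> 0)"
    by (rule sum.mono_neutral_left) (use assms in auto)
  finally show ?thesis .
qed

lemma decomp_single:
  assumes "a \<in> gen_eig \<rho>" "\<rho> \<noteq> 0"
  shows "decomp a (\<lambda>\<tau>. if \<tau> = \<rho> then a else (\<lambda>_. 0))"
  by (rule decompI[of "{\<rho>}"]) (use assms in \<open>auto simp: gen_eig_0\<close>)

lemma dfun_single:
  assumes "a \<in> gen_eig \<rho>" "\<rho> \<noteq> 0" shows "quasi_poly a" "dfun \<kappa> a = \<kappa> \<rho> * a 0"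
proof -
  have "{\<tau>. (if \<tau> = \<rho> then a else (\<lambda>_. 0)) \<noteq> (\<lambda>_. 0)} \<subseteq> {\<rho>}" by auto
  then show "dfun \<kappa> a = \<kappa> \<rho> * a 0"
    using dfun_eq[OF decomp_single[OF assms], of "{\<rho>}" \<kappa>] by simp
qed (use decomp_single[OF assms] in \<open>auto simp: quasi_poly_def\<close>)

lemma dfun_power: "\<rho> \<noteq> 0 \<Longrightarrow> quasi_poly (\<lambda>k. c * \<rho> ^ k)" "\<rho> \<noteq> 0 \<Longrightarrow> dfun \<kappa> (\<lambda>k. c * \<rho> ^ k) = \<kappa> \<rho> * c"
  using dfun_single[OF gen_eig_power[of c \<rho>]] by auto

lemma dfun_add:
  assumes "quasi_poly a" "quasi_poly b"
  shows "quasi_poly (\<lambda>k. a k + b k)" "dfun \<kappa> (\<lambda>k. a k + b k) = dfun \<kappa> a + dfun \<kappa> b"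
proof -
  obtain a' b' where d: "decomp a a'" "decomp b b'" using assms by (auto simp: quasi_poly_def)
  define F where "F = {\<rho>. a' \<rho> \<noteq> (\<lambda>_. 0)} \<union> {\<rho>. b' \<rho> \<noteq> (\<lambda>_. 0)}"
  have F: "finite F" "{\<rho>. a' \<rho> \<noteq> (\<lambda>_. 0)} \<subseteq> F" "{\<rho>. b' \<rho> \<noteq> (\<lambda>_. 0)} \<subseteq> F"
    using d by (auto simp: F_def decomp_def)
  have *: "decomp (\<lambda>k. a k + b k) (\<lambda>\<rho> k. a' \<rho> k + b' \<rho> k)"
  proof (rule decompI[OF F(1)])
    show "a k + b k = (\<Sum>\<rho>\<in>F. a' \<rho> k + b' \<rho> k)" for k
      by (simp add: decomp_sum[OF d(1) F(1,2)] decomp_sum[OF d(2) F(1,3)] sum.distrib)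
  qed (use d in \<open>auto simp: decomp_def F_def intro!: gen_eig_add\<close>)
  then show "quasi_poly (\<lambda>k. a k + b k)" by (auto simp: quasi_poly_def)
  have "dfun \<kappa> (\<lambda>k. a k + b k) = (\<Sum>\<rho>\<in>F. \<kappa> \<rho> * (a' \<rho> 0 + b' \<rho> 0))"
    by (rule dfun_eq[OF * F(1)]) (auto simp: F_def)
  then show "dfun \<kappa> (\<lambda>k. a k + b k) = dfun \<kappa> a + dfun \<kappa> b"
    by (simp add: dfun_eq[OF d(1) F(1,2)] dfun_eq[OF d(2) F(1,3)] sum.distrib algebra_simps)
qed

lemma dfun_0 [simp]: "quasi_poly (\<lambda>_. 0)" "dfun \<kappa> (\<lambda>_. 0) = 0"
  using dfun_single[OF gen_eig_0[of 1]] by auto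

lemma dfun_sum:
  assumes "\<And>x. x \<in> F \<Longrightarrow> quasi_poly (a x)"
  shows "quasi_poly (\<lambda>k. \<Sum>x\<in>F. a x k)" "dfun \<kappa> (\<lambda>k. \<Sum>x\<in>F. a x k) = (\<Sum>x\<in>F. dfun \<kappa> (a x))"
proof -
  have "quasi_poly (\<lambda>k. \<Sum>x\<in>F. a x k) \<and> dfun \<kappa> (\<lambda>k. \<Sum>x\<in>F. a x k) = (\<Sum>x\<in>F. dfun \<kappa> (a x))"
    using assms by (induction F rule: infinite_finite_induct) (auto simp: dfun_add)
  then show "quasi_poly (\<lambda>k. \<Sum>x\<in>F. a x k)" "dfun \<kappa> (\<lambda>k. \<Sum>x\<in>F. a x k) = (\<Sum>x\<in>F. dfun \<kappa> (a x))"
    by auto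
qed

lemma quasi_poly_decomp_sum:
  assumes "quasi_poly a"
  shows "\<exists>F b. finite F \<and> 0 \<notin> F \<and> (\<forall>\<rho>\<in>F. b \<rho> \<in> gen_eig \<rho>) \<and> a = (\<lambda>k. \<Sum>\<rho>\<in>F. b \<rho> k)"
proof -
  obtain b where "decomp a b" using assms by (auto simp: quasi_poly_def)
  then show ?thesis
    by (intro exI[of _ "{\<rho>. b \<rho> \<noteq> (\<lambda>_. 0)}"] exI[of _ b]) (auto simp: decomp_def)
qed

text \<open>A product of components at \<open>\<rho>\<close> and \<open>\<tau>\<close> is a
  component at \<open>\<rho> * \<tau>\<close>, where \<open>\<kappa>\<close> has the value
  \<open>\<kappa> \<rho> + \<kappa> \<tau>\<close>. Additivity of the character thus becomes a
  product rule at \<open>k = 0\<close>.\<close>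

lemma dfun_mult:
  assumes \<kappa>: "\<And>x y. x \<noteq> 0 \<Longrightarrow> y \<noteq> 0 \<Longrightarrow> \<kappa> (x * y) = \<kappa> x + \<kappa> y"
    and a: "quasi_poly a" and b: "quasi_poly b"
  shows "quasi_poly (\<lambda>k. a k * b k)" "dfun \<kappa> (\<lambda>k. a k * b k) = a 0 * dfun \<kappa> b + dfun \<kappa> a * b 0"
proof -
  obtain F a' where F: "finite F" "0 \<notin> F" "\<And>\<rho>. \<rho> \<in> F \<Longrightarrow> a' \<rho> \<in> gen_eig \<rho>" "a = (\<lambda>k. \<Sum>\<rho>\<in>F. a' \<rho> k)"
    using quasi_poly_decomp_sum[OF a] by blast
  obtain G b' where G: "finite G" "0 \<notin> G" "\<And>\<rho>. \<rho> \<in> G \<Longrightarrow> b' \<rho> \<in> gen_eig \<rho>" "b = (\<lambda>k. \<Sum>\<rho>\<in>G. b' \<rho> k)"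
    using quasi_poly_decomp_sum[OF b] by blast
  have prod: "(\<lambda>k. a k * b k) = (\<lambda>k. \<Sum>(\<rho>, \<tau>)\<in>F \<times> G. a' \<rho> k * b' \<tau> k)"
    by (simp add: F(4) G(4) sum_product sum.cartesian_product)
  have one: "quasi_poly (\<lambda>k. a' \<rho> k * b' \<tau> k)"
    "dfun \<kappa> (\<lambda>k. a' \<rho> k * b' \<tau> k) = (\<kappa> \<rho> + \<kappa> \<tau>) * (a' \<rho> 0 * b' \<tau> 0)" if "(\<rho>, \<tau>) \<in> F \<times> G" for \<rho> \<tau>
  proof -
    have nz: "\<rho> \<noteq> 0" "\<tau> \<noteq> 0" "\<rho> * \<tau> \<noteq> 0" using that F(2) G(2) by auto
    have "(\<lambda>k. a' \<rho> k * b' \<tau> k) \<in> gen_eig (\<rho> * \<tau>)" using that F(3) G(3) by (auto intro!: gen_eig_mult)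
    from dfun_single[OF this nz(3)] \<kappa>[OF nz(1,2)]
    show "quasi_poly (\<lambda>k. a' \<rho> k * b' \<tau> k)"
      "dfun \<kappa> (\<lambda>k. a' \<rho> k * b' \<tau> k) = (\<kappa> \<rho> + \<kappa> \<tau>) * (a' \<rho> 0 * b' \<tau> 0)" by auto
  qed
  have da: "dfun \<kappa> a = (\<Sum>\<rho>\<in>F. \<kappa> \<rho> * a' \<rho> 0)"
  proof -
    have "quasi_poly (a' \<rho>) \<and> dfun \<kappa> (a' \<rho>) = \<kappa> \<rho> * a' \<rho> 0" if "\<rho> \<in> F" for \<rho>
      using dfun_single[OF F(3)[OF that]] that F(2) by auto
    then show ?thesis unfolding F(4) by (subst dfun_sum) auto
  qed
  have db: "dfun \<kappa> b = (\<Sum>\<rho>\<in>G. \<kappa> \<rho> * b' \<rho> 0)"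
  proof -
    have "quasi_poly (b' \<rho>) \<and> dfun \<kappa> (b' \<rho>) = \<kappa> \<rho> * b' \<rho> 0" if "\<rho> \<in> G" for \<rho>
      using dfun_single[OF G(3)[OF that]] that G(2) by auto
    then show ?thesis unfolding G(4) by (subst dfun_sum) auto
  qed
  have qp: "\<And>x. x \<in> F \<times> G \<Longrightarrow> quasi_poly (\<lambda>k. case x of (\<rho>, \<tau>) \<Rightarrow> a' \<rho> k * b' \<tau> k)"
    using one(1) by auto
  show "quasi_poly (\<lambda>k. a k * b k)" unfolding prod by (rule dfun_sum(1)[OF qp])
  have "dfun \<kappa> (\<lambda>k. a k * b k) = (\<Sum>x\<in>F \<times> G. dfun \<kappa> (\<lambda>k. case x of (\<rho>, \<tau>) \<Rightarrow> a' \<rho> k * b' \<tau> k))"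
    unfolding prod by (rule dfun_sum(2)[OF qp])
  also have "\<dots> = (\<Sum>(\<rho>, \<tau>)\<in>F \<times> G. a' \<rho> 0 * (\<kappa> \<tau> * b' \<tau> 0) + (\<kappa> \<rho> * a' \<rho> 0) * b' \<tau> 0)"
    by (rule sum.cong) (auto simp: one(2) algebra_simps)
  also have "\<dots> = (\<Sum>(\<rho>, \<tau>)\<in>F \<times> G. a' \<rho> 0 * (\<kappa> \<tau> * b' \<tau> 0)) + (\<Sum>(\<rho>, \<tau>)\<in>F \<times> G. (\<kappa> \<rho> * a' \<rho> 0) * b' \<tau> 0)"
    by (simp add: case_prod_unfold sum.distrib)
  also have "\<dots> = a 0 * dfun \<kappa> b + dfun \<kappa> a * b 0"
    by (simp only: da db) (simp add: F(4) G(4) sum_product sum.cartesian_product)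
  finally show "dfun \<kappa> (\<lambda>k. a k * b k) = a 0 * dfun \<kappa> b + dfun \<kappa> a * b 0" .
qed

text \<open>In the resonant case \<open>r = \<rho>\<close> the recursion itself gives a solution,
  one order higher in the same space. Otherwise the shift minus \<open>\<rho>\<close> is a nilpotent
  operator plus the nonzero scalar \<open>r - \<rho>\<close> and is inverted by induction on the
  nilpotency order.\<close>

lemma first_order_solution:
  assumes "b \<in> gen_eig r" "r \<noteq> 0" "\<rho> \<noteq> 0"
  shows "\<exists>a. quasi_poly a \<and> shift_minus \<rho> a = b"
proof (cases "r = \<rho>")
  case True
  define a where "a = rec_nat 0 (\<lambda>k x. \<rho> * x + b k)"
  have "shift_minus \<rho> a = b" by (rule ext) (simp add: shift_minus_def a_def)
  with assms True gen_eig_Suc[of \<rho> a] dfun_single(1)[of a \<rho>] show ?thesis by auto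
next
  case False
  have main: "(shift_minus r ^^ K) b = (\<lambda>_. 0) \<Longrightarrow> \<exists>a\<in>gen_eig r. shift_minus \<rho> a = b" for K b
  proof (induction K arbitrary: b)
    case 0
    then show ?case using shift_minus_0 gen_eig_0 by auto
  next
    case (Suc K)
    have "(shift_minus r ^^ K) (shift_minus r b) = (\<lambda>_. 0)"
      using Suc.prems by (simp only: funpow_Suc_right comp_apply)
    from Suc.IH[OF this] obtain a where a: "a \<in> gen_eig r" "shift_minus \<rho> a = shift_minus r b" by blast
    have b: "b \<in> gen_eig r" unfolding gen_eig_def mem_Collect_eq using Suc.prems by (rule exI)
    have eq: "shift_minus \<rho> b k = shift_minus r b k + (r - \<rho>) * b k" for k
      by (simp add: shift_minus_def algebra_simps)
    have "shift_minus \<rho> (\<lambda>k. inverse (r - \<rho>) * (b k + (-1) * a k)) k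
        = inverse (r - \<rho>) * (shift_minus \<rho> b k - shift_minus \<rho> a k)" for k
      by (simp add: shift_minus_def algebra_simps)
    then have "shift_minus \<rho> (\<lambda>k. inverse (r - \<rho>) * (b k + (-1) * a k)) = b"
      using False by (simp add: a(2) eq fun_eq_iff)
    then show ?case using gen_eig_cmult[OF gen_eig_add[OF b gen_eig_cmult[OF a(1), of "-1"]]] by blast
  qed
  obtain K where "(shift_minus r ^^ K) b = (\<lambda>_. 0)" using assms(1) by (auto simp: gen_eig_def)
  from main[OF this] obtain a where "a \<in> gen_eig r" "shift_minus \<rho> a = b" by blast
  then show ?thesis using dfun_single(1)[of a r] assms(2) by blast
qed

text \<open>A particular solution is found component by component; it differs from \<open>a\<close>
  by a solution of the homogeneous equation, a multiple of \<open>\<rho> ^ k\<close>.\<close>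

lemma quasi_poly_shift_minus:
  assumes "quasi_poly (shift_minus \<rho> a)" "\<rho> \<noteq> 0" shows "quasi_poly a"
proof -
  obtain F b where F: "finite F" "0 \<notin> F" "\<And>r. r \<in> F \<Longrightarrow> b r \<in> gen_eig r"
    "shift_minus \<rho> a = (\<lambda>k. \<Sum>r\<in>F. b r k)"
    using quasi_poly_decomp_sum[OF assms(1)] by blast
  have "\<forall>r\<in>F. \<exists>a. quasi_poly a \<and> shift_minus \<rho> a = b r"
  proof
    fix r assume "r \<in> F"
    then have "b r \<in> gen_eig r" "r \<noteq> 0" using F(2,3) by auto
    then show "\<exists>a. quasi_poly a \<and> shift_minus \<rho> a = b r" using assms(2) by (rule first_order_solution)
  qed
  from bchoice[OF this] obtain c where c: "\<And>r. r \<in> F \<Longrightarrow> quasi_poly (c r) \<and> shift_minus \<rho> (c r) = b r"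
    by blast
  define s where "s = (\<lambda>k. \<Sum>r\<in>F. c r k)"
  have s: "quasi_poly s" unfolding s_def using c by (intro dfun_sum) auto
  have "shift_minus \<rho> s = shift_minus \<rho> a"
    using F(1) c by (simp add: s_def shift_minus_sum F(4))
  then have "shift_minus \<rho> a k = shift_minus \<rho> s k" for k by simp
  then have "shift_minus \<rho> (\<lambda>k. a k + (-1) * s k) = (\<lambda>_. 0)"
    by (simp add: shift_minus_def fun_eq_iff algebra_simps)
  then have "(\<lambda>k. a k + (-1) * s k) \<in> gen_eig \<rho>" using gen_eig_Suc[of \<rho> "\<lambda>k. a k + (-1) * s k"] gen_eig_0[of \<rho>] by argo
  from dfun_add(1)[OF dfun_single(1)[OF this assms(2)] s]
  have "quasi_poly (\<lambda>k. (a k + (-1) * s k) + s k)" .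
  then show ?thesis by simp
qed

section \<open>Characters of the multiplicative group of complex numbers\<close>

definition rat_scale :: "rat \<Rightarrow> complex \<Rightarrow> complex" where "rat_scale q z = of_rat q * z"

interpretation rat_vs: vector_space rat_scale
  by standard (simp_all add: rat_scale_def of_rat_add of_rat_mult ring_distribs)

interpretation rat_vs_pair: vector_space_pair rat_scale rat_scale ..

text \<open>A \<open>\<rat>\<close>-linear functional vanishing at \<open>2\<pi>\<i>\<close> factors through the complex exponential.\<close>

lemma exists_character:
  assumes "\<nexists>q. z0 = of_rat q * (2 * of_real pi * \<i>)"
  shows "\<exists>\<kappa> :: complex \<Rightarrow> complex. (\<forall>x y. x \<noteq> 0 \<longrightarrow> y \<noteq> 0 \<longrightarrow> \<kappa> (x * y) = \<kappa> x + \<kappa> y) \<and> \<kappa> (exp z0) \<noteq> 0"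
proof -
  define p where "p = 2 * of_real pi * \<i>"
  have z0: "\<And>q. z0 \<noteq> rat_scale q p" using assms by (auto simp: p_def rat_scale_def)
  have p0: "p \<noteq> 0" by (simp add: p_def)
  have ne: "z0 \<noteq> p" using z0[of 1] by (simp add: rat_scale_def)
  have "rat_vs.independent {p}" unfolding rat_vs.dependent_single using p0 by simp
  moreover have "z0 \<notin> rat_vs.span {p}" unfolding rat_vs.span_singleton using z0 by blast
  ultimately have "rat_vs.independent {z0, p}" using ne by (simp add: rat_vs.independent_insert)
  \<comment> \<open>Irrationality of \<open>z0\<close> relative to \<open>p\<close> enters here: on
    independent vectors the values 1 and 0 may be prescribed, and a Hamel basis extends
    them.\<close>
  from rat_vs_pair.linear_independent_extend[OF this, of "\<lambda>z. if z = z0 then 1 else 0"]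
  obtain g where g: "Vector_Spaces.linear rat_scale rat_scale g" "g z0 = 1" "g p = 0"
    using ne by auto
  interpret g: Vector_Spaces.linear rat_scale rat_scale g by fact
  have g_period: "g (x + of_int n * p) = g x" for x n
    using g.add[of x "of_int n * p"] g.scale[of "of_int n" p] g(3) by (simp add: rat_scale_def)
  have g_exp: "g x = g y" if e: "exp x = exp y" for x y
  proof -
    obtain n :: int where "x = y + (of_int (2 * n) * pi) * \<i>" using exp_eq[THEN iffD1, OF e] by blast
    then have "x = y + of_int n * p" by (simp add: p_def)
    then show ?thesis using g_period by simp
  qed
  \<comment> \<open>Any choice of logarithm will do: two logarithms of a number differ by an integer
    multiple of \<open>p\<close>, which \<open>g\<close> does not see.\<close>
  define L where "L x = (SOME z. exp z = (x :: complex))" for x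
  have L: "exp (L x) = x" if "x \<noteq> 0" for x
    unfolding L_def by (rule someI[of _ "Ln x"]) (use that in simp)
  show ?thesis
  proof (intro exI[of _ "\<lambda>x. g (L x)"] conjI allI impI)
    fix x y :: complex assume "x \<noteq> 0" "y \<noteq> 0"
    then have "exp (L (x * y)) = exp (L x + L y)" by (simp add: L exp_add)
    then have "g (L (x * y)) = g (L x + L y)" by (rule g_exp)
    then show "g (L (x * y)) = g (L x) + g (L y)" by (simp add: g.add)
  next
    have "g (L (exp z0)) = g z0" by (rule g_exp) (simp add: L)
    then show "g (L (exp z0)) \<noteq> 0" using g(2) by simp
  qed
qed

section \<open>Ordinary differential equations\<close>

text \<open>The weight \<open>exp (- K (t - a))\<close> makes the Picard operator a contraction on the whole interval.\<close>

lemma picard_lindelof: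
  fixes f :: "real \<Rightarrow> 'a :: banach \<Rightarrow> 'a"
  assumes ab: "a \<le> b"
    and lip: "\<And>t x y. t \<in> {a..b} \<Longrightarrow> norm (f t x - f t y) \<le> L * norm (x - y)"
    and cont: "\<And>u. continuous_on {a..b} u \<Longrightarrow> continuous_on {a..b} (\<lambda>t. f t (u t))"
  shows "\<exists>u. u a = x0 \<and> (\<forall>t\<in>{a..b}. (u has_vector_derivative f t (u t)) (at t within {a..b}))"
proof -
  \<comment> \<open>The contraction factor is bounded by \<open>\<bar>L\<bar> / K\<close>, hence the
    2; the summand 1 keeps \<open>K\<close> positive when \<open>L = 0\<close>.\<close>
  define K where "K = 2 * (\<bar>L\<bar> + 1)"
  have K: "K > 0" "\<bar>L\<bar> \<le> K / 2" by (auto simp: K_def)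
  define g where "g y r = f r (exp (K * (r - a)) *\<^sub>R y r)" for y :: "real \<Rightarrow> 'a" and r
  define \<psi> where "\<psi> y s = exp (- (K * (s - a))) *\<^sub>R (x0 + integral {a..s} (g y))" for y :: "real \<Rightarrow> 'a" and s
  have g_cont: "continuous_on {a..b} (g y)" if "continuous_on {a..b} y" for y
    unfolding g_def by (intro cont continuous_intros that)
  have g_int: "g y integrable_on {a..s}" if "continuous_on {a..b} y" "s \<in> {a..b}" for y s
    using g_cont[OF that(1)] that(2) by (intro integrable_continuous_interval) (auto elim: continuous_on_subset)
  have \<psi>_cont: "continuous_on {a..b} (\<psi> y)" if "continuous_on {a..b} y" for y
    unfolding \<psi>_def using g_int[OF that, of b] ab
    by (intro continuous_intros indefinite_integral_continuous_1) auto
  have y_cont: "continuous_on S (apply_bcontfun y)" for S and y :: "real \<Rightarrow>\<^sub>C 'a"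
    by (rule continuous_on_subset[OF _ subset_UNIV]) (use apply_bcontfun[of y] in \<open>simp add: bcontfun_def\<close>)
  \<comment> \<open>Freezing the value outside \<open>{a..b}\<close> by \<open>clamp\<close> turns
    the weighted operator into a self-map of the bounded continuous functions on the whole line, a
    complete space.\<close>
  define \<Phi> where "\<Phi> y = Bcontfun (\<lambda>t. \<psi> (apply_bcontfun y) (clamp a b t))" for y :: "real \<Rightarrow>\<^sub>C 'a"
  have \<Phi>_app: "apply_bcontfun (\<Phi> y) t = \<psi> (apply_bcontfun y) (clamp a b t)" for y t
  proof -
    have c: "continuous_on (cbox a b) (\<psi> (apply_bcontfun y))" using \<psi>_cont[OF y_cont] by simp
    have "(\<lambda>t. \<psi> (apply_bcontfun y) (clamp a b t)) \<in> bcontfun"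
      unfolding bcontfun_def
      using clamp_continuous_on[OF c] clamp_bounded[OF compact_imp_bounded[OF compact_continuous_image[OF c]]]
      by (auto simp: compact_cbox)
    then show ?thesis by (simp add: \<Phi>_def Bcontfun_inverse)
  qed
  have est: "norm (\<psi> (apply_bcontfun y) s - \<psi> (apply_bcontfun z) s) \<le> 1 / 2 * dist y z"
    if s: "s \<in> {a..b}" for s y z
  proof -
    let ?y = "apply_bcontfun y" and ?z = "apply_bcontfun z"
    have iy: "g ?y integrable_on {a..s}" and iz: "g ?z integrable_on {a..s}"
      using g_int[OF y_cont s] by auto
    have "((\<lambda>r. exp (K * (r - a))) has_integral exp (K * (s - a)) / K - exp (K * (a - a)) / K) {a..s}"
      using s K by (intro fundamental_theorem_of_calculus)
        (auto intro!: derivative_eq_intros simp flip: has_real_derivative_iff_has_vector_derivative)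
    then have hi: "((\<lambda>r. (\<bar>L\<bar> * dist y z) * exp (K * (r - a))) has_integral
        (\<bar>L\<bar> * dist y z) * (exp (K * (s - a)) / K - 1 / K)) {a..s}"
      by (intro has_integral_mult_right) simp
    have "norm (integral {a..s} (g ?y) - integral {a..s} (g ?z)) = norm (integral {a..s} (\<lambda>r. g ?y r - g ?z r))"
      using iy iz by (simp add: integral_diff)
    also have "\<dots> \<le> integral {a..s} (\<lambda>r. (\<bar>L\<bar> * dist y z) * exp (K * (r - a)))"
    proof (rule integral_norm_bound_integral)
      show "(\<lambda>r. g ?y r - g ?z r) integrable_on {a..s}" using iy iz by (rule integrable_diff)
      show "(\<lambda>r. (\<bar>L\<bar> * dist y z) * exp (K * (r - a))) integrable_on {a..s}" using hi by blast
      fix r assume "r \<in> {a..s}"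
      then have "norm (g ?y r - g ?z r) \<le> L * norm (exp (K * (r - a)) *\<^sub>R ?y r - exp (K * (r - a)) *\<^sub>R ?z r)"
        unfolding g_def using s by (intro lip) auto
      also have "\<dots> = L * exp (K * (r - a)) * dist (?y r) (?z r)"
        by (simp add: dist_norm flip: scaleR_diff_right)
      also have "\<dots> \<le> \<bar>L\<bar> * exp (K * (r - a)) * dist y z"
        by (intro mult_mono dist_bounded) auto
      finally show "norm (g ?y r - g ?z r) \<le> (\<bar>L\<bar> * dist y z) * exp (K * (r - a))"
        by (simp add: mult_ac)
    qed
    also have "\<dots> = (\<bar>L\<bar> * dist y z) * (exp (K * (s - a)) / K - 1 / K)"
      using hi by (rule integral_unique)
    also have "\<dots> \<le> (\<bar>L\<bar> * dist y z) * (exp (K * (s - a)) / K)"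
      using K by (intro mult_left_mono) auto
    also have "\<dots> \<le> (K / 2 * dist y z) * (exp (K * (s - a)) / K)"
      using K by (intro mult_right_mono) auto
    also have "\<dots> = 1 / 2 * dist y z * exp (K * (s - a))" using K by simp
    finally have "norm (integral {a..s} (g ?y) - integral {a..s} (g ?z)) \<le> 1 / 2 * dist y z * exp (K * (s - a))" .
    then have "exp (- (K * (s - a))) * norm (integral {a..s} (g ?y) - integral {a..s} (g ?z))
      \<le> exp (- (K * (s - a))) * (1 / 2 * dist y z * exp (K * (s - a)))"
      by (rule mult_left_mono) simp
    also have "\<dots> = 1 / 2 * dist y z" by (simp add: exp_minus)
    finally show ?thesis by (simp add: \<psi>_def flip: scaleR_diff_right)
  qed
  have "\<exists>!y. \<Phi> y = y"
  proof (rule banach_fix_type)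
    show "\<forall>y z. dist (\<Phi> y) (\<Phi> z) \<le> 1 / 2 * dist y z"
    proof (intro allI dist_bound)
      fix y z t
      have "clamp a b t \<in> {a..b}" using clamp_in_interval[of a b t] ab by simp
      then show "dist (apply_bcontfun (\<Phi> y) t) (apply_bcontfun (\<Phi> z) t) \<le> 1 / 2 * dist y z"
        unfolding \<Phi>_app dist_norm[of "\<psi> _ _"] by (rule est)
    qed
  qed auto
  then obtain y where y: "\<Phi> y = y" by blast
  define u where "u t = exp (K * (t - a)) *\<^sub>R apply_bcontfun y t" for t
  have u: "u t = x0 + integral {a..t} (\<lambda>r. f r (u r))" if "t \<in> {a..b}" for t
  proof -
    have "clamp a b t = t" using that by simp
    then have "apply_bcontfun y t = \<psi> (apply_bcontfun y) t" using \<Phi>_app[of y t] y by simp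
    then have "u t = x0 + integral {a..t} (g (apply_bcontfun y))"
      by (simp add: u_def \<psi>_def flip: exp_add)
    moreover have "g (apply_bcontfun y) = (\<lambda>r. f r (u r))" by (rule ext) (simp add: g_def u_def)
    ultimately show ?thesis by simp
  qed
  have "continuous_on {a..b} u" unfolding u_def by (intro continuous_intros y_cont)
  then have c: "continuous_on {a..b} (\<lambda>r. f r (u r))" by (rule cont)
  show ?thesis
  proof (intro exI[of _ u] conjI ballI)
    show "u a = x0" using u[of a] ab by simp
    fix t assume t: "t \<in> {a..b}"
    have "((\<lambda>s. x0 + integral {a..s} (\<lambda>r. f r (u r))) has_vector_derivative f t (u t)) (at t within {a..b})"
      using integral_has_vector_derivative[OF c t] by (auto intro!: derivative_eq_intros)
    then show "(u has_vector_derivative f t (u t)) (at t within {a..b})"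
      by (rule has_vector_derivative_transform[rotated 2]) (use u t in auto)
  qed
qed

text \<open>The systems below have one unknown for each exponent up to a given degree, so their size
  varies inside proofs. A single Banach space that contains all finite sequences serves as state
  space for all of them.\<close>

instance bcontfun :: (metric_space, banach) banach ..

text \<open>
  Sequences are embedded into the Banach space of bounded continuous functions on the reals as
  piecewise linear functions with nodes at the integers.
\<close>

definition tent :: "nat \<Rightarrow> complex \<Rightarrow> real \<Rightarrow>\<^sub>C complex" where
  "tent i c = Bcontfun (\<lambda>x. of_real (max 0 (1 - \<bar>x - real i\<bar>)) * c)"

lemma tent_app: "apply_bcontfun (tent i c) x = of_real (max 0 (1 - \<bar>x - real i\<bar>)) * c"
proof -
  have "bounded (range (\<lambda>x. of_real (max 0 (1 - \<bar>x - real i\<bar>)) * c))"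
    by (rule boundedI[of _ "norm c"]) (auto simp: norm_mult intro!: mult_left_le_one_le)
  moreover have "continuous_on UNIV (\<lambda>x. of_real (max 0 (1 - \<bar>x - real i\<bar>)) * c)"
    by (intro continuous_intros)
  ultimately have "(\<lambda>x. of_real (max 0 (1 - \<bar>x - real i\<bar>)) * c) \<in> bcontfun"
    by (simp add: bcontfun_def)
  then show ?thesis by (simp add: tent_def Bcontfun_inverse)
qed

lemma tent_app_nat: "apply_bcontfun (tent i c) (real k) = (if k = i then c else 0)"
proof (cases "k = i")
  case False
  then have "1 \<le> \<bar>real k - real i\<bar>" by (cases k i rule: linorder_cases) auto
  then show ?thesis using False by (simp add: tent_app max_def)
qed (simp add: tent_app)

lemma norm_tent_le: "norm (tent i c) \<le> norm c"
  by (rule norm_bound) (auto simp: tent_app norm_mult intro!: mult_left_le_one_le)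

lemma bounded_linear_tent: "bounded_linear (tent i)"
  by (rule bounded_linear_intro[where K = 1])
    (auto intro!: bcontfun_eqI simp: tent_app norm_tent_le algebra_simps scaleR_conv_of_real)

lemma bounded_linear_apply_bcontfun: "bounded_linear (\<lambda>x :: 'a :: topological_space \<Rightarrow>\<^sub>C 'b :: real_normed_vector. apply_bcontfun x k)"
  by (rule bounded_linear_intro[where K = 1]) (simp_all add: norm_bounded)

text \<open>Continuous coefficients are bounded on the compact interval, so the vector field
  \<open>f\<close> is globally Lipschitz. It reads a state at the nodes below \<open>N\<close> and
  returns a combination of tents, so the node values satisfy the given system.\<close>

lemma linear_system_exists_nat:
  fixes B :: "nat \<Rightarrow> nat \<Rightarrow> real \<Rightarrow> complex"
  assumes ab: "a \<le> b" and B: "\<And>i j. i < N \<Longrightarrow> j < N \<Longrightarrow> continuous_on {a..b} (B i j)"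
  shows "\<exists>u. (\<forall>i<N. u i a = c i) \<and>
    (\<forall>i<N. \<forall>t\<in>{a..b}. (u i has_vector_derivative (\<Sum>j<N. B i j t * u j t)) (at t within {a..b}))"
proof -
  have "\<exists>M. \<forall>t\<in>{a..b}. norm (B i j t) \<le> M" if "i < N" "j < N" for i j
  proof -
    have "bounded (B i j ` {a..b})"
      by (intro compact_imp_bounded compact_continuous_image B that) auto
    then show ?thesis by (auto simp: bounded_iff)
  qed
  then obtain M where M: "\<And>i j t. i < N \<Longrightarrow> j < N \<Longrightarrow> t \<in> {a..b} \<Longrightarrow> norm (B i j t) \<le> M i j"
    by metis
  define f where "f t x = (\<Sum>i<N. tent i (\<Sum>j<N. B i j t * apply_bcontfun x (real j)))" for t x
  have f_app: "apply_bcontfun (f t x) (real i) = (\<Sum>j<N. B i j t * apply_bcontfun x (real j))" if "i < N" for t x i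
  proof -
    interpret bounded_linear "\<lambda>x :: real \<Rightarrow>\<^sub>C complex. apply_bcontfun x (real i)" by (rule bounded_linear_apply_bcontfun)
    show ?thesis using that by (simp add: f_def sum tent_app_nat)
  qed
  have lip: "norm (f t x - f t y) \<le> (\<Sum>i<N. \<Sum>j<N. M i j) * norm (x - y)" if t: "t \<in> {a..b}" for t x y
  proof -
    have "f t x - f t y = (\<Sum>i<N. tent i (\<Sum>j<N. B i j t * apply_bcontfun (x - y) (real j)))"
      by (simp add: f_def algebra_simps sum_subtractf
        bounded_linear.linear[OF bounded_linear_tent, THEN linear_diff])
    also have "norm \<dots> \<le> (\<Sum>i<N. \<Sum>j<N. M i j * norm (x - y))"
    proof (rule sum_norm_le)
      fix i assume i: "i \<in> {..<N}"
      have "norm (tent i (\<Sum>j<N. B i j t * apply_bcontfun (x - y) (real j)))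
         \<le> norm (\<Sum>j<N. B i j t * apply_bcontfun (x - y) (real j))"
        by (rule norm_tent_le)
      also have "\<dots> \<le> (\<Sum>j<N. M i j * norm (x - y))"
      proof (rule sum_norm_le)
        fix j assume "j \<in> {..<N}"
        then show "norm (B i j t * apply_bcontfun (x - y) (real j)) \<le> M i j * norm (x - y)"
          unfolding norm_mult using i t
          by (intro mult_mono M norm_bounded order_trans[OF norm_ge_zero M]) auto
      qed
      finally show "norm (tent i (\<Sum>j<N. B i j t * apply_bcontfun (x - y) (real j))) \<le> (\<Sum>j<N. M i j * norm (x - y))" .
    qed
    finally show ?thesis by (simp add: sum_distrib_right)
  qed
  have cont: "continuous_on {a..b} (\<lambda>t. f t (u t))" if "continuous_on {a..b} u" for u
    unfolding f_def
    by (intro continuous_on_sum bounded_linear.continuous_on[OF bounded_linear_tent]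
        continuous_on_mult bounded_linear.continuous_on[OF bounded_linear_apply_bcontfun] B that) auto
  from picard_lindelof[where f = f and ?x0.0 = "\<Sum>i<N. tent i (c i)", OF ab lip cont]
  obtain u where u: "u a = (\<Sum>i<N. tent i (c i))"
    "\<And>t. t \<in> {a..b} \<Longrightarrow> (u has_vector_derivative f t (u t)) (at t within {a..b})" by blast
  show ?thesis
  proof (intro exI[of _ "\<lambda>i t. apply_bcontfun (u t) (real i)"] conjI allI impI ballI)
    fix i assume i: "i < N"
    interpret bounded_linear "\<lambda>x :: real \<Rightarrow>\<^sub>C complex. apply_bcontfun x (real i)" by (rule bounded_linear_apply_bcontfun)
    show "apply_bcontfun (u a) (real i) = c i" using i by (simp add: u(1) sum tent_app_nat)
    fix t assume "t \<in> {a..b}"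
    from has_vector_derivative[OF u(2)[OF this]] i
    show "((\<lambda>t. apply_bcontfun (u t) (real i)) has_vector_derivative (\<Sum>j<N. B i j t * apply_bcontfun (u t) (real j))) (at t within {a..b})"
      by (simp add: f_app)
  qed
qed

lemma linear_system_exists:
  fixes B :: "'i \<Rightarrow> 'i \<Rightarrow> real \<Rightarrow> complex"
  assumes ab: "a \<le> b" and I: "finite I" and B: "\<And>i j. i \<in> I \<Longrightarrow> j \<in> I \<Longrightarrow> continuous_on {a..b} (B i j)"
  shows "\<exists>u. (\<forall>i\<in>I. u i a = c i) \<and>
    (\<forall>i\<in>I. \<forall>t\<in>{a..b}. (u i has_vector_derivative (\<Sum>j\<in>I. B i j t * u j t)) (at t within {a..b}))"
proof -
  obtain h where h: "bij_betw h {..<card I} I"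
    using ex_bij_betw_nat_finite[OF I] by (auto simp: atLeast0LessThan)
  define h' where "h' = the_inv_into {..<card I} h"
  have h': "h' i < card I" "h (h' i) = i" if "i \<in> I" for i
    using that h bij_betw_the_inv_into[OF h] f_the_inv_into_f_bij_betw[OF h]
    by (auto simp: h'_def bij_betw_def)
  have hI: "h k \<in> I" if "k < card I" for k using h that by (auto simp: bij_betw_def)
  obtain u where u: "\<forall>i<card I. u i a = c (h i)"
    "\<forall>i<card I. \<forall>t\<in>{a..b}. (u i has_vector_derivative (\<Sum>j<card I. B (h i) (h j) t * u j t)) (at t within {a..b})"
    using linear_system_exists_nat[OF ab, of "card I" "\<lambda>i j. B (h i) (h j)" "\<lambda>i. c (h i)"] B hI by blast
  have "(\<Sum>j\<in>I. B i j t * u (h' j) t) = (\<Sum>j<card I. B i (h j) t * u j t)" for i t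
  proof (rule sum.reindex_bij_betw[OF h, symmetric, THEN trans], rule sum.cong[OF refl])
    fix j assume "j \<in> {..<card I}"
    then have "h' (h j) = j" using h by (simp add: h'_def the_inv_into_f_f bij_betw_def)
    then show "B i (h j) t * u (h' (h j)) t = B i (h j) t * u j t" by simp
  qed
  note eq = this
  show ?thesis
  proof (intro exI[of _ "\<lambda>i. u (h' i)"] conjI ballI)
    fix i assume i: "i \<in> I"
    show "u (h' i) a = c i" using u(1) h'[OF i] by simp
    fix t assume t: "t \<in> {a..b}"
    show "(u (h' i) has_vector_derivative (\<Sum>j\<in>I. B i j t * u (h' j) t)) (at t within {a..b})"
      unfolding eq using u(2)[rule_format, OF h'(1)[OF i] t] unfolding h'(2)[OF i] .
  qed
qed

text \<open>Gronwall's argument for the sum of squares \<open>g\<close>: from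
  \<open>\<bar>g' t\<bar> \<le> C * g t\<close> it follows that \<open>exp (- C * t) * g t\<close>
  decreases and \<open>exp (C * t) * g t\<close> increases, which settles the times after and before
  \<open>t0\<close>.\<close>

lemma linear_system_unique:
  fixes B :: "'i \<Rightarrow> 'i \<Rightarrow> real \<Rightarrow> complex"
  assumes I: "finite I" and B: "\<And>i j. i \<in> I \<Longrightarrow> j \<in> I \<Longrightarrow> continuous_on {a..b} (B i j)"
    and u: "\<And>i t. i \<in> I \<Longrightarrow> t \<in> {a..b} \<Longrightarrow> (u i has_vector_derivative (\<Sum>j\<in>I. B i j t * u j t)) (at t within {a..b})"
    and t0: "t0 \<in> {a..b}" "\<And>i. i \<in> I \<Longrightarrow> u i t0 = 0"
    and i: "i \<in> I" and t: "t \<in> {a..b}"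
  shows "u i t = 0"
proof -
  have "\<exists>M. \<forall>t\<in>{a..b}. norm (B i j t) \<le> M" if "i \<in> I" "j \<in> I" for i j
  proof -
    have "bounded (B i j ` {a..b})"
      by (intro compact_imp_bounded compact_continuous_image B that) auto
    then show ?thesis by (auto simp: bounded_iff)
  qed
  then obtain M where M: "\<And>i j t. i \<in> I \<Longrightarrow> j \<in> I \<Longrightarrow> t \<in> {a..b} \<Longrightarrow> norm (B i j t) \<le> M i j"
    by metis
  define C where "C = 2 * (\<Sum>i\<in>I. \<Sum>j\<in>I. M i j)"
  define g where "g t = (\<Sum>i\<in>I. u i t \<bullet> u i t)" for t
  define g' where "g' t = (\<Sum>i\<in>I. 2 * (u i t \<bullet> (\<Sum>j\<in>I. B i j t * u j t)))" for t
  have g_nonneg: "g t \<ge> 0" for t by (auto simp: g_def intro: sum_nonneg)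
  have g_deriv: "(g has_real_derivative g' t) (at t within {a..b})" if "t \<in> {a..b}" for t
    unfolding g_def g'_def has_real_derivative_iff_has_vector_derivative
  proof (rule has_vector_derivative_sum)
    fix i assume "i \<in> I"
    from bounded_bilinear.has_vector_derivative[OF bounded_bilinear_inner u[OF this that] u[OF this that]]
    show "((\<lambda>x. u i x \<bullet> u i x) has_vector_derivative 2 * (u i t \<bullet> (\<Sum>j\<in>I. B i j t * u j t))) (at t within {a..b})"
      by (simp add: inner_commute)
  qed
  have g_cont: "continuous_on {a..b} g"
    using g_deriv by (meson DERIV_continuous continuous_on_eq_continuous_within)
  have bound: "\<bar>g' t\<bar> \<le> C * g t" if t: "t \<in> {a..b}" for t
  proof -
    have le: "norm (u i t) * norm (u j t) \<le> g t" if "i \<in> I" "j \<in> I" for i j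
    proof -
      have *: "(norm (u i t))\<^sup>2 \<le> g t" if "i \<in> I" for i
      proof -
        have "u i t \<bullet> u i t \<le> g t" unfolding g_def using that I by (intro member_le_sum) auto
        then show ?thesis by (simp add: power2_norm_eq_inner)
      qed
      have "2 * (norm (u i t) * norm (u j t)) \<le> (norm (u i t))\<^sup>2 + (norm (u j t))\<^sup>2"
        using sum_squares_bound[of "norm (u i t)" "norm (u j t)"] by simp
      then show ?thesis using *[OF that(1)] *[OF that(2)] by linarith
    qed
    have "\<bar>g' t\<bar> \<le> (\<Sum>i\<in>I. \<Sum>j\<in>I. 2 * M i j * g t)"
      unfolding g'_def real_norm_def[symmetric]
    proof (rule sum_norm_le)
      fix i assume i: "i \<in> I"
      have "norm (2 * (u i t \<bullet> (\<Sum>j\<in>I. B i j t * u j t))) \<le> 2 * (norm (u i t) * norm (\<Sum>j\<in>I. B i j t * u j t))"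
        using Cauchy_Schwarz_ineq2[of "u i t" "\<Sum>j\<in>I. B i j t * u j t"] by simp
      also have "\<dots> \<le> 2 * (norm (u i t) * (\<Sum>j\<in>I. M i j * norm (u j t)))"
      proof -
        have "norm (\<Sum>j\<in>I. B i j t * u j t) \<le> (\<Sum>j\<in>I. M i j * norm (u j t))"
        proof (rule sum_norm_le)
          show "norm (B i j t * u j t) \<le> M i j * norm (u j t)" if "j \<in> I" for j
            unfolding norm_mult by (intro mult_right_mono M i t that norm_ge_zero)
        qed
        then show ?thesis by (simp add: mult_left_mono)
      qed
      also have "\<dots> = (\<Sum>j\<in>I. 2 * M i j * (norm (u i t) * norm (u j t)))"
        by (simp add: sum_distrib_left mult_ac)
      also have "\<dots> \<le> (\<Sum>j\<in>I. 2 * M i j * g t)"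
        using i t order_trans[OF norm_ge_zero M] by (intro sum_mono mult_left_mono le) auto
      finally show "norm (2 * (u i t \<bullet> (\<Sum>j\<in>I. B i j t * u j t))) \<le> (\<Sum>j\<in>I. 2 * M i j * g t)" .
    qed
    then show ?thesis by (simp add: C_def sum_distrib_left sum_distrib_right)
  qed
  have g0: "g t0 = 0" using t0(2) by (simp add: g_def)
  have "g t \<le> 0"
  proof (cases "t0 \<le> t")
    case True
    have "exp (- C * t) * g t \<le> exp (- C * t0) * g t0"
    proof (rule DERIV_nonpos_imp_decreasing_open[OF True])
      show "continuous_on {t0..t} (\<lambda>t. exp (- C * t) * g t)"
        using g_cont t t0 by (intro continuous_intros) (auto elim: continuous_on_subset)
      fix x assume x: "t0 < x" "x < t"
      then have xab: "x \<in> {a..b}" "a < x" "x < b" using t t0 by auto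
      have "(g has_real_derivative g' x) (at x)"
        using g_deriv[OF xab(1)] xab by (simp add: at_within_Icc_at)
      then have "((\<lambda>t. exp (- C * t) * g t) has_real_derivative exp (- C * x) * (g' x - C * g x)) (at x)"
        by (auto intro!: derivative_eq_intros simp: algebra_simps)
      moreover have "exp (- C * x) * (g' x - C * g x) \<le> 0"
        using bound[OF xab(1)] by (intro mult_nonneg_nonpos) auto
      ultimately show "\<exists>y. ((\<lambda>t. exp (- C * t) * g t) has_real_derivative y) (at x) \<and> y \<le> 0" by blast
    qed
    then show ?thesis using g0 by (simp add: mult_le_0_iff)
  next
    case False
    then have le: "t \<le> t0" by simp
    have "exp (C * t) * g t \<le> exp (C * t0) * g t0"
    proof (rule DERIV_nonneg_imp_increasing_open[OF le])
      show "continuous_on {t..t0} (\<lambda>t. exp (C * t) * g t)"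
        using g_cont t t0 by (intro continuous_intros) (auto elim: continuous_on_subset)
      fix x assume x: "t < x" "x < t0"
      then have xab: "x \<in> {a..b}" "a < x" "x < b" using t t0 by auto
      have "(g has_real_derivative g' x) (at x)"
        using g_deriv[OF xab(1)] xab by (simp add: at_within_Icc_at)
      then have "((\<lambda>t. exp (C * t) * g t) has_real_derivative exp (C * x) * (g' x + C * g x)) (at x)"
        by (auto intro!: derivative_eq_intros simp: algebra_simps)
      moreover have "exp (C * x) * (g' x + C * g x) \<ge> 0"
        using bound[OF xab(1)] by (intro mult_nonneg_nonneg) auto
      ultimately show "\<exists>y. ((\<lambda>t. exp (C * t) * g t) has_real_derivative y) (at x) \<and> y \<ge> 0" by blast
    qed
    then show ?thesis using g0 by (simp add: mult_le_0_iff)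
  qed
  then have "(\<Sum>i\<in>I. u i t \<bullet> u i t) = 0" using g_nonneg[of t] unfolding g_def by linarith
  then show ?thesis using I i by (simp add: sum_nonneg_eq_0_iff)
qed

section \<open>The derivation attached to an automorphism\<close>

text \<open>Gaussian elimination: a vector that is nonzero at the coordinate \<open>x\<close> clears
  this coordinate from all the others. It will supply annihilating polynomials of an automorphism on
  truncated series.\<close>

lemma linear_dependence:
  fixes v :: "'j \<Rightarrow> 'i \<Rightarrow> 'a :: field"
  assumes "finite I" "finite J" "card I < card J"
  shows "\<exists>c. (\<exists>j\<in>J. c j \<noteq> 0) \<and> (\<forall>i\<in>I. (\<Sum>j\<in>J. c j * v j i) = 0)"
  using assms
proof (induction I arbitrary: J v rule: finite_induct)
  case empty
  then obtain j where "j \<in> J" by fastforce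
  then show ?case by (intro exI[of _ "\<lambda>_. 1"]) auto
next
  case (insert x I)
  show ?case
  proof (cases "\<forall>j\<in>J. v j x = 0")
    case True
    have "card I < card J" using insert by simp
    from insert.IH[OF insert.prems(1) this] obtain c
      where "\<exists>j\<in>J. c j \<noteq> 0" "\<forall>i\<in>I. (\<Sum>j\<in>J. c j * v j i) = 0" by blast
    then show ?thesis using True by (intro exI[of _ c]) auto
  next
    case False
    then obtain p where p: "p \<in> J" "v p x \<noteq> 0" by blast
    define w where "w j i = v j i - v j x / v p x * v p i" for j i
    have "card I < card (J - {p})" using insert p by simp
    from insert.IH[OF _ this, of w] insert.prems(1) obtain c
      where c: "\<exists>j\<in>J-{p}. c j \<noteq> 0" "\<forall>i\<in>I. (\<Sum>j\<in>J-{p}. c j * w j i) = 0" by blast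
    define s where "s = (\<Sum>j\<in>J-{p}. c j * (v j x / v p x))"
    have eq: "(\<Sum>j\<in>J. (c(p := - s)) j * v j i) = (\<Sum>j\<in>J-{p}. c j * w j i)" for i
    proof -
      have "(\<Sum>j\<in>J. (c(p := - s)) j * v j i) = - s * v p i + (\<Sum>j\<in>J-{p}. c j * v j i)"
        using insert.prems(1) p(1) by (simp add: sum.remove)
      moreover have "s * v p i = (\<Sum>j\<in>J-{p}. c j * (v j x / v p x * v p i))"
        unfolding s_def sum_distrib_right by (simp add: mult.assoc)
      ultimately show ?thesis by (simp add: w_def right_diff_distrib sum_subtractf)
    qed
    have "w j x = 0" for j using p by (simp add: w_def)
    then have "\<forall>i\<in>insert x I. (\<Sum>j\<in>J. (c(p := - s)) j * v j i) = 0"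
      unfolding eq using c(2) by simp
    then show ?thesis using c(1) by (intro exI[of _ "c(p := - s)"]) auto
  qed
qed

text \<open>The order of vanishing is kept in both directions, so on each truncation
  \<open>\<sigma>\<close> is an injective linear map of a finite-dimensional space and 0 is not an
  eigenvalue.\<close>

locale formal_automorphism =
  fixes \<sigma> :: "(complex, 'n :: finite) mfps \<Rightarrow> (complex, 'n) mfps"
  assumes \<sigma>_add: "\<sigma> (f + g) = \<sigma> f + \<sigma> g"
    and \<sigma>_mult: "\<sigma> (f * g) = \<sigma> f * \<sigma> g"
    and \<sigma>_mconst: "\<sigma> (mconst c) = mconst c"
    and \<sigma>_vanish: "vanish N (\<sigma> h) \<longleftrightarrow> vanish N h"
begin

lemma \<sigma>_cmult: "\<sigma> (mconst c * h) = mconst c * \<sigma> h"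
  by (simp add: \<sigma>_mult \<sigma>_mconst)

lemma \<sigma>_diff: "\<sigma> (f - g) = \<sigma> f - \<sigma> g"
  using \<sigma>_add[of "f - g" g] by (simp add: algebra_simps)

lemma \<sigma>_0 [simp]: "\<sigma> 0 = 0" using \<sigma>_diff[of 0 0] by simp

lemma \<sigma>_sum: "\<sigma> (sum f A) = (\<Sum>a\<in>A. \<sigma> (f a))"
  by (induction A rule: infinite_finite_induct) (simp_all add: \<sigma>_add)

lemma \<sigma>_pow_add: "(\<sigma> ^^ k) (f + g) = (\<sigma> ^^ k) f + (\<sigma> ^^ k) g"
  and \<sigma>_pow_mult: "(\<sigma> ^^ k) (f * g) = (\<sigma> ^^ k) f * (\<sigma> ^^ k) g"
  and \<sigma>_pow_mconst: "(\<sigma> ^^ k) (mconst c) = mconst c"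
  and \<sigma>_pow_vanish: "vanish N ((\<sigma> ^^ k) h) \<longleftrightarrow> vanish N h"
  and \<sigma>_pow_diff: "(\<sigma> ^^ k) (f - g) = (\<sigma> ^^ k) f - (\<sigma> ^^ k) g"
  by (induction k) (simp_all add: \<sigma>_add \<sigma>_mult \<sigma>_mconst \<sigma>_vanish \<sigma>_diff)

lemma \<sigma>_pow_cmult: "(\<sigma> ^^ k) (mconst c * h) = mconst c * (\<sigma> ^^ k) h"
  by (simp add: \<sigma>_pow_mult \<sigma>_pow_mconst)

definition poly_apply :: "complex poly \<Rightarrow> (complex, 'n) mfps \<Rightarrow> (complex, 'n) mfps" where
  "poly_apply p h = (\<Sum>j\<le>degree p. mconst (coeff p j) * (\<sigma> ^^ j) h)"

lemma poly_apply_eq: "degree p \<le> D \<Longrightarrow> poly_apply p h = (\<Sum>j\<le>D. mconst (coeff p j) * (\<sigma> ^^ j) h)"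
  unfolding poly_apply_def by (rule sum.mono_neutral_left) (auto simp: coeff_eq_0)

lemma poly_apply_add_left: "poly_apply (p + q) h = poly_apply p h + poly_apply q h"
  using poly_apply_eq[of p "max (degree p) (degree q)" h] poly_apply_eq[of q "max (degree p) (degree q)" h]
    poly_apply_eq[of "p + q" "max (degree p) (degree q)" h]
  by (simp add: degree_add_le_max mconst_add ring_distribs sum.distrib)

lemma poly_apply_smult: "poly_apply (Polynomial.smult c p) h = mconst c * poly_apply p h"
  using poly_apply_eq[of "Polynomial.smult c p" "degree p" h]
  by (simp add: degree_smult_le poly_apply_def mconst_mult sum_distrib_left mult.assoc)

lemma poly_apply_pCons_0: "poly_apply (pCons 0 p) h = poly_apply p (\<sigma> h)"
proof -
  have "poly_apply (pCons 0 p) h = (\<Sum>j\<le>Suc (degree p). mconst (coeff (pCons 0 p) j) * (\<sigma> ^^ j) h)"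
    by (rule poly_apply_eq) (rule degree_pCons_le)
  also have "\<dots> = (\<Sum>j\<le>degree p. mconst (coeff p j) * (\<sigma> ^^ Suc j) h)"
    by (subst sum.atMost_Suc_shift) simp
  finally show ?thesis by (simp add: poly_apply_def funpow_Suc_right del: funpow.simps)
qed

lemma poly_apply_\<sigma>: "poly_apply p (\<sigma> h) = \<sigma> (poly_apply p h)"
  by (simp add: poly_apply_def \<sigma>_sum \<sigma>_cmult funpow_swap1)

lemma poly_apply_diff_right: "poly_apply p (f - g) = poly_apply p f - poly_apply p g"
  by (simp add: poly_apply_def \<sigma>_pow_diff right_diff_distrib sum_subtractf)

lemma poly_apply_cmult_right: "poly_apply p (mconst c * f) = mconst c * poly_apply p f"
  by (simp only: poly_apply_def \<sigma>_pow_cmult sum_distrib_left mult.left_commute)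

lemma poly_apply_root: "poly_apply ([:- \<rho>, 1:] * q) h = poly_apply q (\<sigma> h - mconst \<rho> * h)"
proof -
  have "[:- \<rho>, 1:] * q = Polynomial.smult (- \<rho>) q + pCons 0 q" by simp
  then show ?thesis
    by (simp only: poly_apply_add_left poly_apply_smult poly_apply_pCons_0 poly_apply_diff_right poly_apply_cmult_right)
      (simp add: mconst_uminus)
qed

text \<open>A root \<open>\<rho>\<close> of \<open>p\<close> is split off: the cofactor annihilates
  \<open>\<sigma> h - mconst \<rho> * h\<close>, and passing from \<open>h\<close> to this series
  applies the shift minus \<open>\<rho>\<close> to the coefficient sequence. That first-order
  recursion is then solved.\<close>

lemma quasi_poly_annihilated:
  assumes "p \<noteq> 0" "vanish (Suc N) (poly_apply p h)" "mdeg m \<le> N"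
  shows "quasi_poly (\<lambda>k. mcoeff ((\<sigma> ^^ k) h) m)"
  using assms(1,2)
proof (induction "degree p" arbitrary: p h rule: less_induct)
  case (less p h)
  show ?case
  proof (cases "degree p = 0")
    case True
    then have "poly_apply p h = mconst (coeff p 0) * h" by (simp add: poly_apply_def)
    moreover have "coeff p 0 \<noteq> 0" using True less.prems(1) leading_coeff_0_iff by fastforce
    ultimately have "vanish (Suc N) h" using less.prems(2) by (auto simp: vanish_def)
    then have "vanish (Suc N) ((\<sigma> ^^ k) h)" for k by (simp add: \<sigma>_pow_vanish)
    then have "mcoeff ((\<sigma> ^^ k) h) m = 0" for k using assms(3) by (auto simp: vanish_def)
    then show ?thesis by simp
  next
    case False
    then obtain \<rho> where "poly p \<rho> = 0"
      using fundamental_theorem_of_algebra[of p] constant_degree[of p] by auto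
    then obtain q where q: "p = [:- \<rho>, 1:] * q" using poly_eq_0_iff_dvd by (metis dvdE)
    then have q0: "q \<noteq> 0" using less.prems(1) by auto
    have deg: "degree q < degree p" using q0 by (simp add: q degree_mult_eq del: mult_pCons_left)
    have van: "vanish (Suc N) (poly_apply q (\<sigma> h - mconst \<rho> * h))"
      using less.prems(2) unfolding q poly_apply_root .
    show ?thesis
    proof (cases "\<rho> = 0")
      case True
      then have "vanish (Suc N) (poly_apply q h)" using van by (simp add: poly_apply_\<sigma> \<sigma>_vanish)
      then show ?thesis using less.hyps[OF deg q0] by blast
    next
      case False
      have "quasi_poly (\<lambda>k. mcoeff ((\<sigma> ^^ k) (\<sigma> h - mconst \<rho> * h)) m)"
        by (rule less.hyps[OF deg q0 van])
      also have "(\<lambda>k. mcoeff ((\<sigma> ^^ k) (\<sigma> h - mconst \<rho> * h)) m) = shift_minus \<rho> (\<lambda>k. mcoeff ((\<sigma> ^^ k) h) m)"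
        by (rule ext) (simp add: \<sigma>_pow_diff \<sigma>_pow_cmult shift_minus_def funpow_swap1)
      finally show ?thesis using False by (rule quasi_poly_shift_minus)
    qed
  qed
qed

lemma quasi_poly_orbit: "quasi_poly (\<lambda>k. mcoeff ((\<sigma> ^^ k) h) m)"
proof -
  define I where "I = {l :: nat ^ 'n. mdeg l \<le> mdeg m}"
  have "finite I" unfolding I_def by (rule finite_mdeg_le)
  \<comment> \<open>The iterates with index 0 to \<open>card I\<close> are one more than the
    coefficients up to the degree of \<open>m\<close>.\<close>
  then obtain c where c: "\<exists>j\<in>{..card I}. c j \<noteq> 0"
    "\<forall>l\<in>I. (\<Sum>j\<le>card I. c j * mcoeff ((\<sigma> ^^ j) h) l) = 0"
    using linear_dependence[of I "{..card I}" "\<lambda>j l. mcoeff ((\<sigma> ^^ j) h) l"] by auto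
  define p where "p = (\<Sum>j\<le>card I. monom (c j) j)"
  have coeff_p: "coeff p j = (if j \<le> card I then c j else 0)" for j
    by (simp add: p_def coeff_sum)
  have "p \<noteq> 0" using c(1) coeff_p by (metis atMost_iff coeff_0)
  moreover have "degree p \<le> card I" by (rule degree_le) (simp add: coeff_p)
  then have "poly_apply p h = (\<Sum>j\<le>card I. mconst (c j) * (\<sigma> ^^ j) h)"
    by (simp add: poly_apply_eq coeff_p)
  then have "vanish (Suc (mdeg m)) (poly_apply p h)"
    using c(2) by (auto simp: vanish_def I_def less_Suc_eq_le)
  ultimately show ?thesis by (rule quasi_poly_annihilated) simp
qed

end

locale formal_automorphism_character = formal_automorphism \<sigma>
  for \<sigma> :: "(complex, 'n :: finite) mfps \<Rightarrow> (complex, 'n) mfps" +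
  fixes \<kappa> :: "complex \<Rightarrow> complex"
  assumes \<kappa>_mult: "x \<noteq> 0 \<Longrightarrow> y \<noteq> 0 \<Longrightarrow> \<kappa> (x * y) = \<kappa> x + \<kappa> y"
begin

text \<open>The derivation with eigenvalue \<open>\<kappa> \<rho>\<close> on the generalized \<open>\<rho>\<close>-eigenspace of \<open>\<sigma>\<close>.\<close>

definition D :: "(complex, 'n) mfps \<Rightarrow> (complex, 'n) mfps" where
  "D h = Abs_mfps (\<lambda>m. dfun \<kappa> (\<lambda>k. mcoeff ((\<sigma> ^^ k) h) m))"

lemma D_add: "D (f + g) = D f + D g"
  by (rule mfps_eqI) (simp add: D_def \<sigma>_pow_add dfun_add(2)[OF quasi_poly_orbit quasi_poly_orbit])

lemma D_mult: "D (f * g) = D f * g + f * D g"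
proof (rule mfps_eqI)
  fix m :: "nat ^ 'n"
  have "mcoeff (D (f * g)) m = dfun \<kappa> (\<lambda>k. \<Sum>p\<in>splits m. mcoeff ((\<sigma> ^^ k) f) (fst p) * mcoeff ((\<sigma> ^^ k) g) (snd p))"
    by (simp add: D_def \<sigma>_pow_mult mcoeff_mult case_prod_unfold)
  also have "\<dots> = (\<Sum>p\<in>splits m. dfun \<kappa> (\<lambda>k. mcoeff ((\<sigma> ^^ k) f) (fst p) * mcoeff ((\<sigma> ^^ k) g) (snd p)))"
    by (rule dfun_sum(2)) (rule dfun_mult(1)[OF \<kappa>_mult quasi_poly_orbit quasi_poly_orbit])
  also have "\<dots> = (\<Sum>p\<in>splits m. mcoeff f (fst p) * mcoeff (D g) (snd p) + mcoeff (D f) (fst p) * mcoeff g (snd p))"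
    by (rule sum.cong[OF refl], subst dfun_mult(2)[OF \<kappa>_mult quasi_poly_orbit quasi_poly_orbit])
      (simp_all add: D_def)
  also have "\<dots> = mcoeff (D f * g + f * D g) m"
    by (simp add: mcoeff_mult case_prod_unfold sum.distrib)
  finally show "mcoeff (D (f * g)) m = mcoeff (D f * g + f * D g) m" .
qed

text \<open>The coefficient sequences are constant, so they belong to the eigenvalue 1, where a
  character vanishes.\<close>

lemma D_fixed: assumes "\<sigma> h = h" shows "D h = 0"
proof (rule mfps_eqI)
  fix m :: "nat ^ 'n"
  have "(\<sigma> ^^ k) h = h" for k by (induction k) (simp_all add: assms)
  moreover have "\<kappa> 1 = 0" using \<kappa>_mult[of 1 1] by simp
  ultimately show "mcoeff (D h) m = mcoeff 0 m"
    using dfun_power(2)[of 1 \<kappa> "mcoeff h m"] by (simp add: D_def)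
qed

lemma D_vanish: "vanish N h \<Longrightarrow> vanish N (D h)"
proof -
  assume "vanish N h"
  then have "vanish N ((\<sigma> ^^ k) h)" for k by (simp add: \<sigma>_pow_vanish)
  then show ?thesis by (simp add: vanish_def D_def)
qed

lemma D_mconst: "D (mconst c) = 0" by (rule D_fixed) (rule \<sigma>_mconst)

text \<open>A derivation is the vector field with components \<open>D (mvar i)\<close>: both sides
  obey the product rule and agree on variables, hence on monomials, and control of the order of
  vanishing extends this to all series.\<close>

lemma D_eq: "D h = (\<Sum>i\<in>UNIV. D (mvar i) * mpartial i h)"
proof (rule additive_eqI[where \<Phi> = D and \<Psi> = "\<lambda>h. \<Sum>i\<in>UNIV. D (mvar i) * mpartial i h"])
  fix N h assume van: "vanish (Suc N) (h :: (complex, 'n) mfps)"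
  show "vanish N (D h)" using D_vanish[OF van] by (rule vanish_mono) simp
  show "vanish N (\<Sum>i\<in>UNIV. D (mvar i) * mpartial i h)"
    by (intro vanish_sum vanish_mult2 vanish_mpartial van)
next
  fix c and k :: "nat ^ 'n"
  show "D (mconst c * mmono k) = (\<Sum>i\<in>UNIV. D (mvar i) * mpartial i (mconst c * mmono k))"
  proof (induction k rule: nat_vec_induct)
    case 0
    then show ?case by (simp add: D_mconst)
  next
    case (step k j)
    have "(\<Sum>i\<in>UNIV. D (mvar i) * mpartial i (mconst c * mmono k * mvar j))
       = (\<Sum>i\<in>UNIV. D (mvar i) * mpartial i (mconst c * mmono k)) * mvar j
         + (\<Sum>i\<in>UNIV. D (mvar i) * (mconst c * mmono k * mpartial i (mvar j)))"
      by (subst mpartial_mult) (simp add: ring_distribs sum.distrib sum_distrib_left mult_ac)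
    also have "(\<Sum>i\<in>UNIV. D (mvar i) * (mconst c * mmono k * mpartial i (mvar j)))
       = mconst c * mmono k * D (mvar j)"
      by (simp add: mpartial_mvar if_distrib[of "(*) _"] mult.commute cong: if_cong)
    finally show ?case
      using D_mult[of "mconst c * mmono k" "mvar j"] step by (simp only: mmono_axis mult.assoc[symmetric])
  qed
qed (simp_all add: D_add mpartial_add ring_distribs sum.distrib)

text \<open>For an eigenvector modulo degree 2 the linear coefficients of the iterates are pure
  powers of \<open>\<rho>\<close>, where \<open>dfun\<close> is explicit.\<close>

lemma D_linear_part:
  assumes "vanish 1 h" "vanish 2 (\<sigma> h - mconst \<rho> * h)" "\<rho> \<noteq> 0"
  shows "mcoeff (D h) (axis p 1) = \<kappa> \<rho> * mcoeff h (axis p 1)"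
proof -
  have van: "vanish 2 ((\<sigma> ^^ k) h - mconst (\<rho> ^ k) * h)" for k
  proof (induction k)
    case (Suc k)
    have "(\<sigma> ^^ Suc k) h - mconst (\<rho> ^ Suc k) * h
       = \<sigma> ((\<sigma> ^^ k) h - mconst (\<rho> ^ k) * h) + mconst (\<rho> ^ k) * (\<sigma> h - mconst \<rho> * h)"
      by (simp add: \<sigma>_diff \<sigma>_mult \<sigma>_mconst mconst_mult algebra_simps)
    then show ?case using Suc assms(2) by (simp add: vanish_add vanish_mult2 \<sigma>_vanish)
  qed simp
  have "mcoeff ((\<sigma> ^^ k) h) (axis p 1) = mcoeff h (axis p 1) * \<rho> ^ k" for k
    using van[of k] by (simp add: vanish_def mult.commute[of "mcoeff h _"])
  then show ?thesis using assms(3) by (simp add: D_def dfun_power)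
qed

text \<open>The hypothesis \<open>rank\<close> says that the vector fields killing all
  \<open>K a\<close> are pairwise proportional. For \<open>D\<close> and \<open>W\<close> this is
  compared in degree 1 only, where just the constant terms of \<open>W\<close> enter; pairing with
  \<open>l\<close>, which kills these and is an eigenvector of the linear part of \<open>D\<close>,
  leaves \<open>\<kappa> \<rho> = 0\<close>.\<close>

theorem character_trivial:
  fixes K :: "'k \<Rightarrow> (complex, 'n) mfps" and W :: "'n \<Rightarrow> (complex, 'n) mfps"
  assumes fixed: "\<And>a. a \<in> S \<Longrightarrow> \<sigma> (K a) = K a"
    and W: "\<And>a. a \<in> S \<Longrightarrow> (\<Sum>i\<in>UNIV. W i * mpartial i (K a)) = 0"
    and rank: "\<And>Z Z' i j. (\<And>a. a \<in> S \<Longrightarrow> (\<Sum>i\<in>UNIV. Z i * mpartial i (K a)) = 0) \<Longrightarrow>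
        (\<And>a. a \<in> S \<Longrightarrow> (\<Sum>i\<in>UNIV. Z' i * mpartial i (K a)) = 0) \<Longrightarrow> Z i * Z' j = Z j * Z' i"
    and W0: "mcoeff (W q) 0 \<noteq> 0"
    and l: "l \<noteq> 0" "vanish 2 (\<sigma> (linear_form l) - mconst \<rho> * linear_form l)"
      "(\<Sum>i\<in>UNIV. l $ i * mcoeff (W i) 0) = 0"
    and \<rho>: "\<rho> \<noteq> 0"
  shows "\<kappa> \<rho> = 0"
proof -
  define d where "d i p = mcoeff (D (mvar i)) (axis p 1)" for i p
  define w where "w i = mcoeff (W i) 0" for i
  obtain p where p: "l $ p \<noteq> 0" using l(1) by (auto simp: vec_eq_iff)
  have v1: "vanish 1 (mvar i :: (complex, 'n) mfps)" for i
    by (simp add: vanish_1_iff mvar_def mcoeff_mmono)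
  have D0: "mcoeff (D (mvar i)) 0 = 0" for i using D_vanish[OF v1] by (simp add: vanish_1_iff)
  have DK: "(\<Sum>i\<in>UNIV. D (mvar i) * mpartial i (K a)) = 0" if "a \<in> S" for a
    using D_eq[of "K a"] D_fixed[OF fixed[OF that]] by simp
  have "D (mvar i) * W j = D (mvar j) * W i" for i j
    by (rule rank[OF DK W]) auto
  moreover have lin: "mcoeff (D (mvar i) * W j) (axis p 1) = d i p * w j" for i j
  proof -
    have "splits (axis p 1 :: nat ^ 'n) = {(0, axis p 1), (axis p 1, 0)}" 
    proof -
      have "(k, m) \<in> {(0, axis p 1), (axis p 1, 0)}" if "k + m = axis p 1" for k m :: "nat ^ 'n"
      proof -
        have "mdeg k + mdeg m = 1" using that by (metis mdeg_add mdeg_axis)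
        then have "mdeg k = 0 \<or> mdeg m = 0" by linarith
        then show ?thesis using that by auto
      qed
      then show ?thesis by (auto simp: splits_def)
    qed
    then show ?thesis by (simp add: mcoeff_mult D0 d_def w_def)
  qed
  \<comment> \<open>For fixed \<open>p\<close> the vector with entries \<open>d i p\<close> is a
    multiple of \<open>w\<close>.\<close>
  ultimately have dw: "d i p * w j = d j p * w i" for i j by metis
  have "\<kappa> \<rho> * l $ p = mcoeff (D (linear_form l)) (axis p 1)"
    using D_linear_part[OF _ l(2) \<rho>, of p] by (simp add: vanish_1_iff mcoeff_linear_form)
  also have "\<dots> = (\<Sum>i\<in>UNIV. l $ i * d i p)"
    by (subst D_eq) (simp add: mpartial_linear_form d_def mult.commute)
  finally have "\<kappa> \<rho> * l $ p * w q = (\<Sum>i\<in>UNIV. l $ i * (d i p * w q))"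
    by (simp only: sum_distrib_right mult.assoc)
  also have "\<dots> = d q p * (\<Sum>i\<in>UNIV. l $ i * w i)"
    by (simp only: dw sum_distrib_left mult.left_commute)
  also have "\<dots> = 0" using l(3) by (simp add: w_def)
  finally show ?thesis using p W0 by (simp add: w_def)
qed

end

section \<open>Formal linear flows\<close>

text \<open>\<open>G\<close> is the right-hand side of X' = G(t, X) around the equilibrium 0. Series
  are not composed with its flow; the action of the flow on series is obtained from linear
  differential equations for their coefficients.\<close>

locale formal_flow =
  fixes a b :: real and G :: "real \<Rightarrow> 'n :: finite \<Rightarrow> (complex, 'n) mfps"
  assumes ab: "a \<le> b"
    and G0: "t \<in> {a..b} \<Longrightarrow> mcoeff (G t i) 0 = 0"
    and G_cont: "continuous_on {a..b} (\<lambda>t. mcoeff (G t i) m)"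
begin

definition Lop :: "real \<Rightarrow> (complex, 'n) mfps \<Rightarrow> (complex, 'n) mfps" where
  "Lop t h = (\<Sum>i\<in>UNIV. mpartial i h * G t i)"

lemma Lop_add: "Lop t (f + g) = Lop t f + Lop t g"
  by (simp add: Lop_def mpartial_add ring_distribs sum.distrib)
lemma Lop_diff: "Lop t (f - g) = Lop t f - Lop t g"
  by (simp add: Lop_def mpartial_diff left_diff_distrib sum_subtractf)
lemma Lop_mconst [simp]: "Lop t (mconst c) = 0" by (simp add: Lop_def)
lemma Lop_mult: "Lop t (f * g) = Lop t f * g + f * Lop t g"
  by (simp add: Lop_def mpartial_mult ring_distribs sum.distrib sum_distrib_left sum_distrib_right mult_ac)
lemma Lop_cmult: "Lop t (mconst c * f) = mconst c * Lop t f" by (simp add: Lop_mult)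
lemma Lop_sum: "Lop t (sum f A) = (\<Sum>x\<in>A. Lop t (f x))"
  by (induction A rule: infinite_finite_induct) (simp_all add: Lop_add, simp_all add: Lop_def)

text \<open>Differentiation loses one degree, and the factor \<open>G t i\<close>, having no
  constant term, restores it.\<close>

lemma Lop_vanish:
  assumes "t \<in> {a..b}" "vanish N h" shows "vanish N (Lop t h)"
proof (cases N)
  case (Suc M)
  have "vanish (M + 1) (mpartial i h * G t i)" for i
    using assms Suc G0[OF assms(1), of i] by (intro vanish_mult vanish_mpartial) (simp_all add: vanish_1_iff)
  then show ?thesis unfolding Lop_def Suc by (intro vanish_sum) (simp only: Suc_eq_plus1)
qed simp

text \<open>The matrix of \<open>- Lop t\<close> in monomials. By \<open>Lop_vanish\<close> it is
  block triangular with respect to the degree, so each truncation is a finite linear system.\<close>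

definition beta :: "nat ^ 'n \<Rightarrow> nat ^ 'n \<Rightarrow> real \<Rightarrow> complex" where
  "beta m k t = - mcoeff (Lop t (mmono k)) m"

lemma beta_cont: "continuous_on {a..b} (beta m k)"
  unfolding beta_def Lop_def mcoeff_sum mcoeff_mult case_prod_unfold
  by (intro continuous_intros G_cont)

lemma Lop_coeff:
  assumes t: "t \<in> {a..b}" and m: "mdeg m \<le> N"
  shows "- mcoeff (Lop t h) m = (\<Sum>k | mdeg k \<le> N. beta m k t * mcoeff h k)"
proof -
  have "Lop t h = Lop t (mtrunc (Suc N) h) + Lop t (h - mtrunc (Suc N) h)" by (simp flip: Lop_add)
  moreover have "mcoeff (Lop t (h - mtrunc (Suc N) h)) m = 0"
    using Lop_vanish[OF t vanish_mtrunc] m by (auto simp: vanish_def)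
  moreover have "mcoeff (Lop t (mtrunc (Suc N) h)) m = (\<Sum>k | mdeg k \<le> N. mcoeff h k * mcoeff (Lop t (mmono k)) m)"
    by (simp add: mtrunc_def Lop_sum Lop_cmult less_Suc_eq_le)
  ultimately show ?thesis
    by (simp add: beta_def sum_negf mult.commute)
qed

text \<open>The transport equation \<partial>_t u + <\<partial>_X u, G> = 0 up to degree
  \<open>N\<close>, whose solutions are constant along X' = G(t, X). The bound \<open>N\<close> is
  part of the notion because linear forms will be transported modulo degree 2 only.\<close>

definition sol :: "nat \<Rightarrow> (real \<Rightarrow> (complex, 'n) mfps) \<Rightarrow> bool" where
  "sol N u \<longleftrightarrow> (\<forall>m. mdeg m \<le> N \<longrightarrow> (\<forall>t\<in>{a..b}.
     ((\<lambda>s. mcoeff (u s) m) has_vector_derivative - mcoeff (Lop t (u t)) m) (at t within {a..b})))"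

lemma sol_mono: "sol N u \<Longrightarrow> M \<le> N \<Longrightarrow> sol M u" by (auto simp: sol_def)

lemma sol_diff: "sol N u \<Longrightarrow> sol N v \<Longrightarrow> sol N (\<lambda>t. u t - v t)"
  by (auto simp: sol_def Lop_diff intro!: derivative_eq_intros)

lemma sol_add: "sol N u \<Longrightarrow> sol N v \<Longrightarrow> sol N (\<lambda>t. u t + v t)"
  by (auto simp: sol_def Lop_add intro!: derivative_eq_intros)

lemma sol_mconst: "sol N (\<lambda>_. mconst c)" by (simp add: sol_def)

text \<open>\<open>Lop t\<close> is a derivation, so solutions are closed under products; this makes
  the flow act by ring homomorphisms.\<close>

lemma sol_mult:
  assumes "sol N u" "sol N v" shows "sol N (\<lambda>t. u t * v t)"
  unfolding sol_def
proof (intro allI impI ballI)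
  fix m t assume m: "mdeg (m :: nat ^ 'n) \<le> N" and t: "t \<in> {a..b}"
  have "((\<lambda>s. \<Sum>p\<in>splits m. mcoeff (u s) (fst p) * mcoeff (v s) (snd p)) has_vector_derivative
      (\<Sum>p\<in>splits m. mcoeff (u t) (fst p) * (- mcoeff (Lop t (v t)) (snd p)) + (- mcoeff (Lop t (u t)) (fst p)) * mcoeff (v t) (snd p)))
      (at t within {a..b})"
  proof (intro has_vector_derivative_sum has_vector_derivative_mult)
    fix p assume "p \<in> splits m"
    then have "mdeg (fst p) + mdeg (snd p) = mdeg m" by (auto simp: splits_def)
    then have "mdeg (fst p) \<le> N" "mdeg (snd p) \<le> N" using m by auto
    then show "((\<lambda>s. mcoeff (u s) (fst p)) has_vector_derivative - mcoeff (Lop t (u t)) (fst p)) (at t within {a..b})"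
      "((\<lambda>s. mcoeff (v s) (snd p)) has_vector_derivative - mcoeff (Lop t (v t)) (snd p)) (at t within {a..b})"
      using assms t by (auto simp: sol_def)
  qed
  also have "(\<Sum>p\<in>splits m. mcoeff (u t) (fst p) * (- mcoeff (Lop t (v t)) (snd p)) + (- mcoeff (Lop t (u t)) (fst p)) * mcoeff (v t) (snd p))
     = - mcoeff (Lop t (u t * v t)) m"
    by (simp add: Lop_mult mcoeff_mult case_prod_unfold sum.distrib sum_negf sum_subtractf)
  finally show "((\<lambda>s. mcoeff (u s * v s) m) has_vector_derivative - mcoeff (Lop t (u t * v t)) m) (at t within {a..b})"
    by (simp add: mcoeff_mult case_prod_unfold)
qed

text \<open>Uniqueness for the truncated system, forward and backward in time; both directions are
  used to see that the flow preserves and reflects the order of vanishing.\<close>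

lemma sol_vanish:
  assumes u: "sol N u" and t0: "t0 \<in> {a..b}" "vanish (Suc N) (u t0)" and t: "t \<in> {a..b}"
  shows "vanish (Suc N) (u t)"
  unfolding vanish_def
proof (intro allI impI)
  fix m :: "nat ^ 'n" assume "mdeg m < Suc N"
  then have m: "m \<in> {m. mdeg m \<le> N}" by simp
  show "mcoeff (u t) m = 0"
  proof (rule linear_system_unique[OF finite_mdeg_le beta_cont _ t0(1) _ m t, where u = "\<lambda>m t. mcoeff (u t) m"])
    fix i s assume "i \<in> {m :: nat ^ 'n. mdeg m \<le> N}" and s: "s \<in> {a..b}"
    then have "mdeg i \<le> N" by simp
    then show "((\<lambda>t. mcoeff (u t) i) has_vector_derivative (\<Sum>j | mdeg j \<le> N. beta i j s * mcoeff (u s) j)) (at s within {a..b})"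
      using u s unfolding sol_def by (simp add: Lop_coeff)
  next
    show "mcoeff (u t0) i = 0" if "i \<in> {m. mdeg m \<le> N}" for i
      using t0(2) that by (simp add: vanish_def)
  qed
qed

text \<open>Each truncation has a solution, and uniqueness makes these agree in common degrees, so
  the coefficient at \<open>m\<close> may be taken from the system of degree
  \<open>mdeg m\<close>.\<close>

lemma sol_exists: "\<exists>u. (\<forall>N. sol N u) \<and> u a = h"
proof -
  have "\<forall>N. \<exists>v. (\<forall>m\<in>{m. mdeg m \<le> N}. v m a = mcoeff h m) \<and> (\<forall>m\<in>{m. mdeg m \<le> N}. \<forall>t\<in>{a..b}.
     (v m has_vector_derivative (\<Sum>k\<in>{m. mdeg m \<le> N}. beta m k t * v k t)) (at t within {a..b}))"
    by (intro allI linear_system_exists[OF ab finite_mdeg_le beta_cont])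
  from choice[OF this] obtain v where "\<forall>N. (\<forall>m\<in>{m. mdeg m \<le> N}. v N m a = mcoeff h m) \<and>
     (\<forall>m\<in>{m. mdeg m \<le> N}. \<forall>t\<in>{a..b}.
       (v N m has_vector_derivative (\<Sum>k\<in>{m. mdeg m \<le> N}. beta m k t * v N k t)) (at t within {a..b}))" ..
  then have v: "\<And>N m. mdeg m \<le> N \<Longrightarrow> v N m a = mcoeff h m"
    "\<And>N m t. mdeg m \<le> N \<Longrightarrow> t \<in> {a..b} \<Longrightarrow>
      (v N m has_vector_derivative (\<Sum>k | mdeg k \<le> N. beta m k t * v N k t)) (at t within {a..b})"
    by auto
  define V where "V N t = Abs_mfps (\<lambda>m. v N m t)" for N t
  have V_sol: "sol N (V N)" for N
    unfolding sol_def by (auto simp: Lop_coeff[of _ _ N] V_def v(2))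
  have V_a: "vanish (Suc N) (V N a - h)" for N
    by (simp add: vanish_def V_def v(1) less_Suc_eq_le)
  have consistent: "mcoeff (V N t) m = mcoeff (V M t) m" if "mdeg m \<le> M" "M \<le> N" "t \<in> {a..b}" for N M m t
  proof -
    have 1: "sol M (\<lambda>t. V N t - V M t)" by (rule sol_diff[OF sol_mono[OF V_sol that(2)] V_sol])
    have 2: "vanish (Suc M) (V N a - V M a)"
      using vanish_diff[OF vanish_mono[OF V_a[of N]] V_a[of M]] that(2) by simp
    have "vanish (Suc M) (V N t - V M t)" using sol_vanish[OF 1 _ 2 that(3)] ab by simp
    then show ?thesis using that(1) by (simp add: vanish_def)
  qed
  \<comment> \<open>At \<open>t = a\<close> the truncated solutions already have the coefficients of
    \<open>h\<close>; the case distinction gives \<open>u a = h\<close> outright.\<close>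
  define u where "u t = (if t = a then h else Abs_mfps (\<lambda>m. mcoeff (V (mdeg m) t) m))" for t
  have u: "mcoeff (u t) m = mcoeff (V N t) m" if "mdeg m \<le> N" "t \<in> {a..b}" for t m N
    using consistent[of m "mdeg m" N t] that v(1)[of m N] by (auto simp: u_def V_def)
  have "sol N u" for N
    unfolding sol_def
  proof (intro allI impI ballI)
    fix m t assume m: "mdeg (m :: nat ^ 'n) \<le> N" and t: "t \<in> {a..b}"
    have "((\<lambda>s. mcoeff (V N s) m) has_vector_derivative - mcoeff (Lop t (V N t)) m) (at t within {a..b})"
      using V_sol m t by (simp add: sol_def)
    moreover have "- mcoeff (Lop t (V N t)) m = - mcoeff (Lop t (u t)) m"
      unfolding Lop_coeff[OF t m] by (intro sum.cong refl) (use u[OF _ t, of _ N] in simp)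
    ultimately show "((\<lambda>s. mcoeff (u s) m) has_vector_derivative - mcoeff (Lop t (u t)) m) (at t within {a..b})"
      using has_vector_derivative_transform[OF t, of "\<lambda>s. mcoeff (u s) m" "\<lambda>s. mcoeff (V N s) m"] m u by simp
  qed
  then show ?thesis by (intro exI[of _ u]) (simp add: u_def)
qed

text \<open>As \<open>u\<close> is constant along X' = G(t, X), this is the pull-back of
  \<open>h\<close> under the flow from time \<open>b\<close> back to time \<open>a\<close>. By
  uniqueness the chosen solution does not matter.\<close>

definition flow_map :: "(complex, 'n) mfps \<Rightarrow> (complex, 'n) mfps" where
  "flow_map h = (SOME u. (\<forall>N. sol N u) \<and> u a = h) b"

lemma flow_map_vanish:
  assumes "sol N u" shows "vanish (Suc N) (flow_map (u a) - u b)"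
proof -
  define w where "w = (SOME w. (\<forall>N. sol N w) \<and> w a = u a)"
  have w: "sol N w" "w a = u a"
    using someI_ex[OF sol_exists[of "u a"]] unfolding w_def by auto
  have "vanish (Suc N) (w b - u b)"
    using sol_vanish[OF sol_diff[OF w(1) assms], of a b] w(2) ab by simp
  then show ?thesis by (simp add: flow_map_def w_def)
qed

lemma flow_map_eq: assumes "\<And>N. sol N u" shows "flow_map (u a) = u b"
proof -
  have "vanish N (flow_map (u a) - u b)" for N
    using flow_map_vanish[OF assms, of N] by (rule vanish_mono) simp
  then show ?thesis using vanish_eq_0 by fastforce
qed

lemma flow_map_formal_automorphism: "formal_automorphism flow_map"
proof
  fix f g :: "(complex, 'n) mfps" and c N
  obtain u v where u: "\<forall>N. sol N u" "u a = f" and v: "\<forall>N. sol N v" "v a = g"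
    using sol_exists by metis
  have f: "flow_map f = u b" and g: "flow_map g = v b"
    using flow_map_eq[of u] flow_map_eq[of v] u v by auto
  show "flow_map (f + g) = flow_map f + flow_map g"
    using flow_map_eq[of "\<lambda>t. u t + v t"] u v f g by (simp add: sol_add)
  show "flow_map (f * g) = flow_map f * flow_map g"
    using flow_map_eq[of "\<lambda>t. u t * v t"] u v f g by (simp add: sol_mult)
  show "flow_map (mconst c) = mconst c"
    using flow_map_eq[OF sol_mconst] by simp
  show "vanish N (flow_map f) \<longleftrightarrow> vanish N f"
  proof (cases N)
    case (Suc M)
    then show ?thesis
      using sol_vanish[of M u a b] sol_vanish[of M u b a] u f ab by auto
  qed simp
qed

end

text \<open>Periodic solutions \<open>K\<close> of the transport equation are fixed by
  \<open>flow_map\<close>, while \<open>linear_form (l t)\<close> solves it to first order and so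
  gives an eigenvector modulo degree 2 with eigenvalue \<open>exp z0\<close>. Every character kills
  this eigenvalue, which leaves only rational multiples of 2\<pi>\<i> for \<open>z0\<close>.\<close>

theorem formal_core:
  fixes G :: "real \<Rightarrow> 'n :: finite \<Rightarrow> (complex, 'n) mfps" and K :: "'k \<Rightarrow> real \<Rightarrow> (complex, 'n) mfps"
  assumes ab: "a \<le> b"
    and G0: "\<And>t i. t \<in> {a..b} \<Longrightarrow> mcoeff (G t i) 0 = 0"
    and G_cont: "\<And>i m. continuous_on {a..b} (\<lambda>t. mcoeff (G t i) m)"
    and K_deriv: "\<And>x m t. x \<in> S \<Longrightarrow> t \<in> {a..b} \<Longrightarrow>
        ((\<lambda>s. mcoeff (K x s) m) has_vector_derivative - mcoeff (\<Sum>i\<in>UNIV. mpartial i (K x t) * G t i) m) (at t within {a..b})"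
    and K_per: "\<And>x. x \<in> S \<Longrightarrow> K x b = K x a"
    and W: "\<And>x. x \<in> S \<Longrightarrow> (\<Sum>i\<in>UNIV. W i * mpartial i (K x a)) = 0"
    and rank: "\<And>Z Z' i j. (\<And>x. x \<in> S \<Longrightarrow> (\<Sum>i\<in>UNIV. Z i * mpartial i (K x a)) = 0) \<Longrightarrow>
        (\<And>x. x \<in> S \<Longrightarrow> (\<Sum>i\<in>UNIV. Z' i * mpartial i (K x a)) = 0) \<Longrightarrow> Z i * Z' j = Z j * Z' i"
    and W0: "mcoeff (W q) 0 \<noteq> 0"
    and l_deriv: "\<And>p t. t \<in> {a..b} \<Longrightarrow> ((\<lambda>s. l s $ p) has_vector_derivative
        - (\<Sum>i\<in>UNIV. l t $ i * mcoeff (G t i) (axis p 1))) (at t within {a..b})"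
    and l_b: "l b = exp z0 *s l a" and l_a: "l a \<noteq> 0"
    and lW: "(\<Sum>i\<in>UNIV. l a $ i * mcoeff (W i) 0) = 0"
  shows "\<exists>q. z0 = of_rat q * (2 * of_real pi * \<i>)"
proof (rule ccontr)
  assume nex: "\<not> ?thesis"
  from exists_character[OF nex] obtain \<kappa> :: "complex \<Rightarrow> complex" where
    "(\<forall>x y. x \<noteq> 0 \<longrightarrow> y \<noteq> 0 \<longrightarrow> \<kappa> (x * y) = \<kappa> x + \<kappa> y) \<and> \<kappa> (exp z0) \<noteq> 0" ..
  then have \<kappa>: "\<And>x y. x \<noteq> 0 \<Longrightarrow> y \<noteq> 0 \<Longrightarrow> \<kappa> (x * y) = \<kappa> x + \<kappa> y" "\<kappa> (exp z0) \<noteq> 0"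
    by simp_all
  interpret formal_flow a b G by standard (use ab G0 G_cont in auto)
  interpret formal_automorphism flow_map by (rule flow_map_formal_automorphism)
  interpret formal_automorphism_character flow_map \<kappa> by standard (rule \<kappa>(1))
  have lin: "mcoeff (linear_form r) m = 0" if "mdeg m \<noteq> 1" for r :: "complex ^ 'n" and m
    using that by (auto simp: mcoeff_linear_form intro!: sum.neutral)
  have Lop_lin: "Lop t (linear_form r) = (\<Sum>i\<in>UNIV. mconst (r $ i) * G t i)" for t r
    by (simp add: Lop_def mpartial_linear_form)
  \<comment> \<open>Only up to degree 1, since the quadratic terms of \<open>G\<close> send linear
    forms into higher degree.\<close>
  have "sol 1 (\<lambda>t. linear_form (l t))"
    unfolding sol_def
  proof (intro allI impI ballI)
    fix m t assume m: "mdeg (m :: nat ^ 'n) \<le> 1" and t: "t \<in> {a..b}"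
    show "((\<lambda>s. mcoeff (linear_form (l s)) m) has_vector_derivative - mcoeff (Lop t (linear_form (l t))) m) (at t within {a..b})"
    proof (cases "mdeg m = 1")
      case True
      then obtain p where "m = axis p 1" by (rule mdeg_eq_1_cases)
      then show ?thesis using l_deriv[OF t, of p] by (simp add: Lop_lin)
    next
      case False
      then have "mdeg m = 0" using m by linarith
      then have "m = 0" by simp
      then show ?thesis using G0[OF t] False by (simp add: Lop_lin lin)
    qed
  qed
  from flow_map_vanish[OF this]
  have "vanish 2 (flow_map (linear_form (l a)) - linear_form (l b))" by (simp add: numeral_2_eq_2 One_nat_def)
  moreover have "linear_form (l b) = mconst (exp z0) * linear_form (l a)"
    by (rule mfps_eqI) (simp add: l_b mcoeff_linear_form sum_distrib_left if_distrib[of "(*) _"] cong: if_cong)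
  ultimately have l2: "vanish 2 (flow_map (linear_form (l a)) - mconst (exp z0) * linear_form (l a))" by simp
  have "flow_map (K x a) = K x a" if "x \<in> S" for x
    using flow_map_eq[of "K x"] K_deriv[OF that] K_per[OF that] by (simp add: sol_def Lop_def)
  then have "\<kappa> (exp z0) = 0"
  proof (rule character_trivial[where S = S and K = "\<lambda>x. K x a" and W = W and l = "l a" and q = q])
    show "(\<Sum>i\<in>UNIV. W i * mpartial i (K x a)) = 0" if "x \<in> S" for x using that by (rule W)
    show "mcoeff (W q) 0 \<noteq> 0" by (rule W0)
    show "l a \<noteq> 0" by (rule l_a)
    show "vanish 2 (flow_map (linear_form (l a)) - mconst (exp z0) * linear_form (l a))" by (rule l2)
    show "(\<Sum>i\<in>UNIV. l a $ i * mcoeff (W i) 0) = 0" by (rule lW)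
    show "exp z0 \<noteq> 0" by simp
    fix Z Z' :: "'n \<Rightarrow> (complex, 'n) mfps" and i j
    assume "\<And>x. x \<in> S \<Longrightarrow> (\<Sum>i\<in>UNIV. Z i * mpartial i (K x a)) = 0"
      "\<And>x. x \<in> S \<Longrightarrow> (\<Sum>i\<in>UNIV. Z' i * mpartial i (K x a)) = 0"
    then show "Z i * Z' j = Z j * Z' i" by (rule rank)
  qed
  then show False using \<kappa>(2) by simp
qed

section \<open>Taylor series of real analytic functions\<close>

definition monom_at :: "nat ^ 'n :: finite \<Rightarrow> real ^ 'n \<Rightarrow> real" where
  "monom_at k y = (\<Prod>i\<in>UNIV. (y $ i) ^ (k $ i))"

text \<open>The partial derivative of \<open>monom_at k\<close>. The truncated subtraction in the
  exponent is harmless: the factor \<open>k $ i\<close> is 0 in that case.\<close>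

definition dmonom_at :: "nat ^ 'n :: finite \<Rightarrow> 'n \<Rightarrow> real ^ 'n \<Rightarrow> real" where
  "dmonom_at k i y = real (k $ i) * (y $ i) ^ (k $ i - 1) * (\<Prod>j\<in>UNIV - {i}. (y $ j) ^ (k $ j))"

definition box_at :: "real ^ 'n :: finite \<Rightarrow> real \<Rightarrow> (real ^ 'n) set" where
  "box_at a r = {x. \<forall>i. \<bar>x $ i - a $ i\<bar> < r}"

definition PS :: "(real ^ 'n :: finite \<Rightarrow> real) \<Rightarrow> real ^ 'n \<Rightarrow> (real, 'n) mfps \<Rightarrow> bool" where
  "PS h a F \<longleftrightarrow> has_power_series_at h a (mcoeff F)"

lemma PS_iff: "PS h a F \<longleftrightarrow>
    (\<exists>r>0. \<forall>x\<in>box_at a r. ((\<lambda>k. mcoeff F k * monom_at k (x - a)) has_sum h x) UNIV)"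
  by (simp add: PS_def has_power_series_at_def box_at_def monom_at_def)

lemma box_at_mono: "r \<le> s \<Longrightarrow> box_at a r \<subseteq> box_at a s"
  by (auto simp: box_at_def intro: less_le_trans)

lemma center_in_box_at [simp]: "0 < r \<Longrightarrow> a \<in> box_at a r" by (simp add: box_at_def)

lemma box_at_eq: "box_at a r = (\<Inter>i. {x. \<bar>x $ i - a $ i\<bar> < r})" by (auto simp: box_at_def)

lemma open_box_at: "open (box_at a r)"
  unfolding box_at_eq by (intro open_INT ballI open_Collect_less continuous_intros) auto

lemma convex_box_at: "convex (box_at (a :: real ^ 'n :: finite) r)"
proof -
  have "{x :: real ^ 'n. \<bar>x $ i - a $ i\<bar> < r} = {x. axis i 1 \<bullet> x < a $ i + r} \<inter> {x. axis i 1 \<bullet> x > a $ i - r}" for i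
    by (auto simp: inner_axis' abs_less_iff)
  then show ?thesis unfolding box_at_eq by (auto intro!: convex_INT convex_Int convex_halfspace_lt convex_halfspace_gt)
qed

section \<open>Monomials as functions, with estimates\<close>

lemma monom_at_0 [simp]: "monom_at 0 y = 1" by (simp add: monom_at_def)
lemma monom_at_add: "monom_at (k + l) y = monom_at k y * monom_at l y"
  by (simp add: monom_at_def power_add prod.distrib)

lemma monom_at_zero: "monom_at k 0 = (if k = 0 then 1 else 0)"
proof (cases "k = 0")
  case False
  then obtain i where "k $ i \<noteq> 0" by (auto simp: vec_eq_iff)
  then show ?thesis using False by (auto simp: monom_at_def intro!: bexI[of _ i] prod_zero)
qed simp

lemma monom_at_bound:
  assumes "\<And>i. \<bar>y $ i\<bar> \<le> \<rho>" shows "\<bar>monom_at k y\<bar> \<le> \<rho> ^ mdeg k"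
  unfolding monom_at_def mdeg_def power_sum abs_prod power_abs
  by (intro prod_mono conjI power_mono assms) auto

lemma monom_at_derivative:
  "(monom_at k has_derivative (\<lambda>v. \<Sum>i\<in>UNIV. v $ i * dmonom_at k i y)) (at y within S)"
proof -
  have "((\<lambda>y. \<Prod>i\<in>UNIV. (y $ i) ^ (k $ i)) has_derivative
     (\<lambda>v. \<Sum>i\<in>UNIV. (real (k $ i) * v $ i * (y $ i) ^ (k $ i - 1)) * (\<Prod>j\<in>UNIV - {i}. (y $ j) ^ (k $ j)))) (at y within S)"
    by (rule has_derivative_prod)
      (auto intro!: derivative_eq_intros bounded_linear_imp_has_derivative[OF bounded_linear_vec_nth] simp: mult_ac)
  then show ?thesis by (simp add: monom_at_def[abs_def] dmonom_at_def mult_ac)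
qed

lemma dmonom_at_add: "dmonom_at (k + axis i 1) i y = real (k $ i + 1) * monom_at k y"
proof -
  have "(\<Prod>j\<in>UNIV - {i}. (y $ j) ^ ((k + axis i 1) $ j)) = (\<Prod>j\<in>UNIV - {i}. (y $ j) ^ (k $ j))"
    by (rule prod.cong) (auto simp: axis_def)
  moreover have "monom_at k y = (y $ i) ^ (k $ i) * (\<Prod>j\<in>UNIV - {i}. (y $ j) ^ (k $ j))"
    unfolding monom_at_def by (rule prod.remove) auto
  ultimately show ?thesis by (simp add: dmonom_at_def)
qed

text \<open>Halving the radius pays for the factor \<open>k $ i\<close>, which is at most
  \<open>2 ^ mdeg k\<close>; the constant \<open>2 / \<rho>\<close> is the price of the degree lost
  by differentiation.\<close>

lemma dmonom_at_bound:
  assumes "\<And>i. \<bar>y $ i\<bar> \<le> \<rho> / 2" "0 < \<rho>"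
  shows "\<bar>dmonom_at k i y\<bar> \<le> \<rho> ^ mdeg k * (2 / \<rho>)"
proof (cases "k $ i = 0")
  case True
  then show ?thesis using assms(2) by (simp add: dmonom_at_def)
next
  case False
  then obtain l where l: "k = l + axis i 1" using axis_decomp by blast
  have "real (k $ i) \<le> 2 ^ mdeg k"
  proof -
    have "k $ i \<le> mdeg k" unfolding mdeg_def by (rule member_le_sum) auto
    also have "\<dots> \<le> 2 ^ mdeg k" by (rule less_imp_le) (rule less_exp)
    finally show ?thesis by (metis of_nat_le_iff of_nat_numeral of_nat_power)
  qed
  have "\<bar>dmonom_at k i y\<bar> = real (k $ i) * \<bar>monom_at l y\<bar>"
    unfolding l dmonom_at_add by (simp add: abs_mult)
  also have "\<dots> \<le> 2 ^ mdeg k * (\<rho> / 2) ^ mdeg l"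
    by (intro mult_mono monom_at_bound assms(1) \<open>real (k $ i) \<le> 2 ^ mdeg k\<close>) auto
  also have "\<dots> = \<rho> ^ mdeg k * (2 / \<rho>)"
    using assms(2) by (simp add: l power_divide power_add field_simps)
  finally show ?thesis .
qed

text \<open>Unordered convergence of real series is absolute, so the double series over pairs of
  exponents converges and may be grouped by the value of \<open>k + l\<close>.\<close>

lemma PS_mult:
  assumes "PS f a F" "PS g a G" shows "PS (\<lambda>x. f x * g x) a (F * G)"
proof -
  obtain r where r: "r > 0" "\<And>x. x \<in> box_at a r \<Longrightarrow> ((\<lambda>k. mcoeff F k * monom_at k (x - a)) has_sum f x) UNIV"
    using assms(1) by (auto simp: PS_iff)
  obtain s where s: "s > 0" "\<And>x. x \<in> box_at a s \<Longrightarrow> ((\<lambda>k. mcoeff G k * monom_at k (x - a)) has_sum g x) UNIV"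
    using assms(2) by (auto simp: PS_iff)
  show ?thesis unfolding PS_iff
  proof (intro exI[of _ "min r s"] conjI ballI)
    fix x assume x: "x \<in> box_at a (min r s)"
    define u v where "u k = mcoeff F k * monom_at k (x - a)" and "v k = mcoeff G k * monom_at k (x - a)" for k
    have u: "(u has_sum f x) UNIV" and v: "(v has_sum g x) UNIV"
      using r s x box_at_mono[of "min r s" r a] box_at_mono[of "min r s" s a] by (auto simp: u_def[abs_def] v_def[abs_def])
    have au: "(\<lambda>k. \<bar>u k\<bar>) summable_on UNIV" and av: "(\<lambda>k. \<bar>v k\<bar>) summable_on UNIV"
      using u v summable_on_iff_abs_summable_on_real[of u UNIV] summable_on_iff_abs_summable_on_real[of v UNIV]
      by (auto simp: summable_on_def)
    define w where "w = (\<lambda>(k, l). u k * v l)"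
    have "(\<lambda>p. \<bar>w p\<bar>) summable_on (SIGMA k:UNIV. UNIV)"
    proof (rule summable_on_SigmaI)
      fix k
      show "((\<lambda>l. \<bar>w (k, l)\<bar>) has_sum \<bar>u k\<bar> * infsum (\<lambda>l. \<bar>v l\<bar>) UNIV) UNIV"
        unfolding w_def by (simp add: abs_mult) (intro has_sum_cmult_right has_sum_infsum av)
      show "(\<lambda>k. \<bar>u k\<bar> * infsum (\<lambda>l. \<bar>v l\<bar>) UNIV) summable_on UNIV"
        by (intro summable_on_cmult_left au)
    qed simp
    then have "w summable_on (SIGMA k:UNIV. UNIV)"
      using summable_on_iff_abs_summable_on_real[of w] by simp
    then have "(w has_sum (f x * g x)) (SIGMA k:UNIV. UNIV)"
      by (intro has_sum_SigmaI[where g = "\<lambda>k. u k * g x"])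
        (auto simp: w_def intro!: has_sum_cmult_right has_sum_cmult_left u v)
    also have "?this \<longleftrightarrow> ((\<lambda>(m, p). w p) has_sum (f x * g x)) (SIGMA m:UNIV. splits m)"
      by (rule has_sum_reindex_bij_witness[where i = "\<lambda>(m, p). p" and j = "\<lambda>(k, l). (k + l, (k, l))"])
        (auto simp: splits_def)
    finally have "((\<lambda>m. \<Sum>p\<in>splits m. w p) has_sum (f x * g x)) UNIV"
      by (rule has_sum_SigmaD) (simp add: finite_splits)
    moreover have "(\<Sum>p\<in>splits m. w p) = mcoeff (F * G) m * monom_at m (x - a)" for m
    proof -
      have "(\<Sum>p\<in>splits m. w p) = (\<Sum>p\<in>splits m. (case p of (k, l) \<Rightarrow> mcoeff F k * mcoeff G l) * monom_at m (x - a))"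
        by (rule sum.cong) (auto simp: w_def u_def v_def splits_def monom_at_add)
      then show ?thesis by (simp add: mcoeff_mult sum_distrib_right)
    qed
    ultimately show "((\<lambda>k. mcoeff (F * G) k * monom_at k (x - a)) has_sum f x * g x) UNIV" by simp
  qed (use r s in simp)
qed

lemma PS_add:
  assumes "PS f a F" "PS g a G" shows "PS (\<lambda>x. f x + g x) a (F + G)"
proof -
  obtain r where r: "r > 0" "\<And>x. x \<in> box_at a r \<Longrightarrow> ((\<lambda>k. mcoeff F k * monom_at k (x - a)) has_sum f x) UNIV"
    using assms(1) by (auto simp: PS_iff)
  obtain s where s: "s > 0" "\<And>x. x \<in> box_at a s \<Longrightarrow> ((\<lambda>k. mcoeff G k * monom_at k (x - a)) has_sum g x) UNIV"
    using assms(2) by (auto simp: PS_iff)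
  show ?thesis unfolding PS_iff
  proof (intro exI[of _ "min r s"] conjI ballI)
    fix x assume x: "x \<in> box_at a (min r s)"
    then have "x \<in> box_at a r" "x \<in> box_at a s" by (auto simp: box_at_def)
    from has_sum_add[OF r(2)[OF this(1)] s(2)[OF this(2)]]
    show "((\<lambda>k. mcoeff (F + G) k * monom_at k (x - a)) has_sum f x + g x) UNIV"
      by (simp add: distrib_right)
  qed (use r s in simp)
qed

lemma PS_const: "PS (\<lambda>_. c) (a :: real ^ 'n :: finite) (mconst c)"
  unfolding PS_iff
proof (intro exI[of _ 1] conjI ballI)
  fix x
  have "((\<lambda>k. mcoeff (mconst c) k * monom_at k (x - a)) has_sum c) {0 :: nat ^ 'n}"
    by (simp add: has_sum_finite_iff mcoeff_mconst)
  then show "((\<lambda>k. mcoeff (mconst c) k * monom_at k (x - a)) has_sum c) (UNIV :: (nat ^ 'n) set)"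
    by (rule has_sum_cong_neutral[THEN iffD1, rotated 3]) (auto simp: mcoeff_mconst)
qed simp

lemma PS_sum: "(\<And>x. x \<in> A \<Longrightarrow> PS (f x) a (F x)) \<Longrightarrow> PS (\<lambda>y. \<Sum>x\<in>A. f x y) a (\<Sum>x\<in>A. F x)"
proof (induction A rule: infinite_finite_induct)
  case (insert x A)
  then show ?case using PS_add[of "f x" a "F x" "\<lambda>y. \<Sum>x\<in>A. f x y" "\<Sum>x\<in>A. F x"] by simp
qed (use PS_const[of 0] in simp_all)

lemma PS_prod: "(\<And>x. x \<in> A \<Longrightarrow> PS (f x) a (F x)) \<Longrightarrow> PS (\<lambda>y. \<Prod>x\<in>A. f x y) a (\<Prod>x\<in>A. F x)"
proof (induction A rule: infinite_finite_induct)
  case (insert x A)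
  then show ?case using PS_mult[of "f x" a "F x" "\<lambda>y. \<Prod>x\<in>A. f x y" "\<Prod>x\<in>A. F x"] by simp
qed (use PS_const[of 1] in simp_all)

lemma PS_cong:
  fixes f g :: "real ^ 'n :: finite \<Rightarrow> real"
  assumes "PS f a F" "open U" "a \<in> U" "\<And>x. x \<in> U \<Longrightarrow> f x = g x" shows "PS g a F"
proof -
  obtain r where r: "r > 0" "\<And>x. x \<in> box_at a r \<Longrightarrow> ((\<lambda>k. mcoeff F k * monom_at k (x - a)) has_sum f x) UNIV"
    using assms(1) by (auto simp: PS_iff)
  obtain e where e: "e > 0" "ball a e \<subseteq> U" using assms(2,3) openE by blast
  define n where "n = real CARD('n)"
  have n: "n > 0" by (simp add: n_def)
  \<comment> \<open>The Euclidean norm is at most the sum of the \<open>n\<close> coordinate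
    distances, hence the radius \<open>e / n\<close>.\<close>
  have sub: "box_at a (e / n) \<subseteq> ball a e"
  proof
    fix x assume x: "x \<in> box_at a (e / n)"
    have "norm (x - a) \<le> (\<Sum>i\<in>UNIV. \<bar>(x - a) $ i\<bar>)" by (rule norm_le_l1_cart)
    also have "\<dots> < (\<Sum>i\<in>(UNIV :: 'n set). e / n)" using x by (intro sum_strict_mono) (auto simp: box_at_def)
    also have "\<dots> = e" using n by (simp add: n_def)
    finally show "x \<in> ball a e" by (simp add: dist_norm norm_minus_commute)
  qed
  show ?thesis unfolding PS_iff
  proof (intro exI[of _ "min r (e / n)"] conjI ballI)
    fix x assume x: "x \<in> box_at a (min r (e / n))"
    then have "x \<in> box_at a r" "x \<in> U" using sub e(2) by (auto simp: box_at_def)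
    then show "((\<lambda>k. mcoeff F k * monom_at k (x - a)) has_sum g x) UNIV" using r(2) assms(4) by metis
  qed (use r e n in simp)
qed

lemma PS_value: assumes "PS h a F" shows "h a = mcoeff F 0"
proof -
  obtain r where r: "r > 0" "\<And>x. x \<in> box_at a r \<Longrightarrow> ((\<lambda>k. mcoeff F k * monom_at k (x - a)) has_sum h x) UNIV"
    using assms by (auto simp: PS_iff)
  from r(2)[of a] r(1) have "((\<lambda>k. mcoeff F k * monom_at k 0) has_sum h a) UNIV" by simp
  moreover have "((\<lambda>k. mcoeff F k * monom_at k 0) has_sum mcoeff F 0) UNIV"
    by (rule has_sum_finite_neutralI[of "{0}"]) (auto simp: monom_at_zero)
  ultimately show ?thesis by (rule has_sum_unique)
qed

text \<open>Differentiation term by term: convergence at the corner \<open>a + vec \<rho>\<close>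
  makes the coefficients times \<open>\<rho> ^ mdeg k\<close> absolutely summable, and these
  dominate the differentiated series on the box of half that radius.\<close>

lemma PS_derivative_box:
  fixes h :: "real ^ 'n :: finite \<Rightarrow> real"
  assumes "PS h a F"
  shows "\<exists>r>0. \<exists>D. \<forall>x\<in>box_at a r. (h has_derivative (\<lambda>v. \<Sum>i\<in>UNIV. v $ i * D i x)) (at x) \<and>
     (\<forall>i. ((\<lambda>k. mcoeff (mpartial i F) k * monom_at k (x - a)) has_sum D i x) UNIV)"
proof -
  obtain r where r: "r > 0" "\<And>x. x \<in> box_at a r \<Longrightarrow> ((\<lambda>k. mcoeff F k * monom_at k (x - a)) has_sum h x) UNIV"
    using assms by (auto simp: PS_iff)
  \<comment> \<open>The corner \<open>a + vec \<rho>\<close> has to lie inside the open box of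
    convergence.\<close>
  define \<rho> where "\<rho> = r / 2"
  have \<rho>: "\<rho> > 0" "\<rho> < r" "\<rho> / 2 < r" using r(1) by (auto simp: \<rho>_def)
  define S where "S = box_at a (\<rho> / 2)"
  define B where "B k = \<bar>mcoeff F k\<bar> * \<rho> ^ mdeg k * (2 / \<rho>)" for k
  have "((\<lambda>k. mcoeff F k * monom_at k ((a + vec \<rho>) - a)) has_sum h (a + vec \<rho>)) UNIV"
    by (rule r(2)) (use \<rho> in \<open>simp add: box_at_def\<close>)
  then have "(\<lambda>k. mcoeff F k * monom_at k (vec \<rho>)) summable_on UNIV" by (auto simp: summable_on_def)
  then have "(\<lambda>k. \<bar>mcoeff F k * monom_at k (vec \<rho>)\<bar>) summable_on UNIV"
    by (subst (asm) summable_on_iff_abs_summable_on_real) simp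
  moreover have "monom_at k (vec \<rho>) = \<rho> ^ mdeg k" for k :: "nat ^ 'n"
    by (simp add: monom_at_def mdeg_def power_sum)
  ultimately have "(\<lambda>k. \<bar>mcoeff F k\<bar> * \<rho> ^ mdeg k) summable_on UNIV"
    using \<rho>(1) by (simp add: abs_mult)
  then have B_sum: "B summable_on UNIV" unfolding B_def[abs_def] by (rule summable_on_cmult_left)
  have S_le: "\<bar>(x - a) $ i\<bar> \<le> \<rho> / 2" if "x \<in> S" for x i using that by (simp add: S_def box_at_def less_imp_le)
  have term_bound: "\<bar>mcoeff F k * dmonom_at k i (x - a)\<bar> \<le> B k" if "x \<in> S" for x k i
  proof -
    have "\<bar>mcoeff F k * dmonom_at k i (x - a)\<bar> \<le> \<bar>mcoeff F k\<bar> * (\<rho> ^ mdeg k * (2 / \<rho>))"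
      unfolding abs_mult by (intro mult_left_mono dmonom_at_bound S_le that \<rho>) auto
    then show ?thesis by (simp add: B_def mult_ac)
  qed
  have D_summable: "(\<lambda>k. mcoeff F k * dmonom_at k i (x - a)) summable_on UNIV" if "x \<in> S" for x i
  proof (rule summable_on_iff_abs_summable_on_real[THEN iffD2])
    show "(\<lambda>k. norm (mcoeff F k * dmonom_at k i (x - a))) summable_on UNIV"
      by (rule summable_on_comparison_test[OF B_sum]) (use term_bound[OF that] in auto)
  qed
  define D where "D i x = infsum (\<lambda>k. mcoeff F k * dmonom_at k i (x - a)) UNIV" for i x
  have D: "((\<lambda>k. mcoeff F k * dmonom_at k i (x - a)) has_sum D i x) UNIV" if "x \<in> S" for x i
    unfolding D_def by (rule has_sum_infsum[OF D_summable[OF that]])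
  have inf: "infinite (UNIV :: (nat ^ 'n) set)"
  proof
    assume "finite (UNIV :: (nat ^ 'n) set)"
    then have "finite (range (\<lambda>n :: nat. vec n :: nat ^ 'n))" by (rule finite_subset[OF subset_UNIV])
    moreover have "inj (\<lambda>n :: nat. vec n :: nat ^ 'n)" by (auto simp: inj_on_def vec_eq_iff)
    ultimately have "finite (UNIV :: nat set)" by (rule finite_imageD)
    then show False by simp
  qed
  \<comment> \<open>An enumeration of the exponents turns unordered sums into series; any
    enumeration gives the same sums.\<close>
  define e where "e = from_nat_into (UNIV :: (nat ^ 'n) set)"
  have e: "bij e"
    unfolding e_def by (rule bij_betw_from_nat_into) (use inf in auto)
  have to_sums: "(f has_sum s) UNIV \<Longrightarrow> (\<lambda>j. f (e j)) sums s" for f :: "nat ^ 'n \<Rightarrow> real" and s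
  proof -
    assume "(f has_sum s) UNIV"
    then have "((\<lambda>j. f (e j)) has_sum s) UNIV" using has_sum_reindex_bij_betw[OF e, of f s] by simp
    then show ?thesis by (rule has_sum_imp_sums)
  qed
  have B_summable: "summable (\<lambda>j. B (e j))"
    using to_sums[OF has_sum_infsum[OF B_sum]] by (rule sums_summable)
  have unif: "uniform_limit S (\<lambda>n x. \<Sum>j<n. mcoeff F (e j) * dmonom_at (e j) i (x - a)) (D i) sequentially" for i
  proof -
    have "uniform_limit S (\<lambda>n x. \<Sum>j<n. mcoeff F (e j) * dmonom_at (e j) i (x - a))
        (\<lambda>x. suminf (\<lambda>j. mcoeff F (e j) * dmonom_at (e j) i (x - a))) sequentially"
      by (rule Weierstrass_m_test[OF _ B_summable]) (use term_bound in auto)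
    moreover have "suminf (\<lambda>j. mcoeff F (e j) * dmonom_at (e j) i (x - a)) = D i x" if "x \<in> S" for x
      using to_sums[OF D[OF that]] by (simp add: sums_iff)
    ultimately show ?thesis by (subst uniform_limit_cong'[rotated 2]) auto
  qed
  have aS: "a \<in> S" using \<rho> by (simp add: S_def)
  have "\<exists>g. \<forall>x\<in>S. (\<lambda>j. mcoeff F (e j) * monom_at (e j) (x - a)) sums g x \<and>
      (g has_derivative (\<lambda>v. \<Sum>i\<in>UNIV. v $ i * D i x)) (at x within S)"
  proof (rule has_derivative_series[where f' = "\<lambda>j x v. \<Sum>i\<in>UNIV. v $ i * (mcoeff F (e j) * dmonom_at (e j) i (x - a))"
        and x = a and l = "h a"])
    show "convex S" unfolding S_def by (rule convex_box_at)
    show "((\<lambda>x. mcoeff F (e n) * monom_at (e n) (x - a)) has_derivative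
        (\<lambda>v. \<Sum>i\<in>UNIV. v $ i * (mcoeff F (e n) * dmonom_at (e n) i (x - a)))) (at x within S)" for n x
    proof -
      have "((\<lambda>x. x - a) has_derivative (\<lambda>v. v)) (at x within S)" by (auto intro!: derivative_eq_intros)
      from has_derivative_compose[OF this monom_at_derivative[of "e n" "x - a" UNIV]]
      have "((\<lambda>x. monom_at (e n) (x - a)) has_derivative (\<lambda>v. \<Sum>i\<in>UNIV. v $ i * dmonom_at (e n) i (x - a))) (at x within S)" .
      from has_derivative_mult_right[OF this, of "mcoeff F (e n)"]
      show ?thesis by (simp add: sum_distrib_left mult_ac)
    qed
    show "(\<lambda>n. mcoeff F (e n) * monom_at (e n) (a - a)) sums h a"
      using to_sums[OF r(2)[of a]] r(1) by simp
    fix \<epsilon> :: real assume \<epsilon>: "\<epsilon> > 0"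
    define n0 where "n0 = real CARD('n)"
    have n0: "n0 > 0" by (simp add: n0_def)
    have "\<forall>\<^sub>F n in sequentially. \<forall>i\<in>UNIV. \<forall>x\<in>S. dist (\<Sum>j<n. mcoeff F (e j) * dmonom_at (e j) i (x - a)) (D i x) < \<epsilon> / n0"
      using unif \<epsilon> n0 by (intro eventually_ball_finite) (auto simp: uniform_limit_iff)
    then show "\<forall>\<^sub>F n in sequentially. \<forall>x\<in>S. \<forall>v. norm ((\<Sum>j<n. \<Sum>i\<in>UNIV. v $ i * (mcoeff F (e j) * dmonom_at (e j) i (x - a)))
        - (\<Sum>i\<in>UNIV. v $ i * D i x)) \<le> \<epsilon> * norm v"
    proof (rule eventually_mono, intro ballI allI)
      fix n x and v :: "real ^ 'n"
      assume *: "\<forall>i\<in>UNIV. \<forall>x\<in>S. dist (\<Sum>j<n. mcoeff F (e j) * dmonom_at (e j) i (x - a)) (D i x) < \<epsilon> / n0" and x: "x \<in> S"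
      have "(\<Sum>j<n. \<Sum>i\<in>UNIV. v $ i * (mcoeff F (e j) * dmonom_at (e j) i (x - a))) - (\<Sum>i\<in>UNIV. v $ i * D i x)
        = (\<Sum>i\<in>UNIV. v $ i * ((\<Sum>j<n. mcoeff F (e j) * dmonom_at (e j) i (x - a)) - D i x))"
        by (subst sum.swap) (simp add: sum_distrib_left right_diff_distrib sum_subtractf)
      also have "norm \<dots> \<le> (\<Sum>i\<in>(UNIV :: 'n set). norm v * (\<epsilon> / n0))"
      proof (rule sum_norm_le)
        fix i
        show "norm (v $ i * ((\<Sum>j<n. mcoeff F (e j) * dmonom_at (e j) i (x - a)) - D i x)) \<le> norm v * (\<epsilon> / n0)"
          unfolding norm_mult using * x
          by (intro mult_mono) (auto simp: component_le_norm_cart dist_norm intro: less_imp_le)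
      qed
      also have "\<dots> = \<epsilon> * norm v" using n0 by (simp add: n0_def)
      finally show "norm ((\<Sum>j<n. \<Sum>i\<in>UNIV. v $ i * (mcoeff F (e j) * dmonom_at (e j) i (x - a)))
        - (\<Sum>i\<in>UNIV. v $ i * D i x)) \<le> \<epsilon> * norm v" .
    qed
  qed (rule aS)
  then obtain g where g: "\<And>x. x \<in> S \<Longrightarrow> (\<lambda>j. mcoeff F (e j) * monom_at (e j) (x - a)) sums g x"
    "\<And>x. x \<in> S \<Longrightarrow> (g has_derivative (\<lambda>v. \<Sum>i\<in>UNIV. v $ i * D i x)) (at x within S)" by blast
  have gh: "g x = h x" if "x \<in> S" for x
  proof -
    have "x \<in> box_at a r" using that box_at_mono[of "\<rho> / 2" r a] \<rho> by (auto simp: S_def)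
    then show ?thesis using to_sums[OF r(2)] g(1)[OF that] sums_unique2 by blast
  qed
  show ?thesis
  proof (intro exI[of _ "\<rho> / 2"] conjI exI[of _ D] ballI allI)
    fix x assume "x \<in> box_at a (\<rho> / 2)"
    then have x: "x \<in> S" by (simp add: S_def)
    have op: "open S" unfolding S_def by (rule open_box_at)
    have "(g has_derivative (\<lambda>v. \<Sum>i\<in>UNIV. v $ i * D i x)) (at x)"
      using g(2)[OF x] at_within_open[OF x op] by simp
    then show "(h has_derivative (\<lambda>v. \<Sum>i\<in>UNIV. v $ i * D i x)) (at x)"
      by (rule has_derivative_transform_within_open[OF _ op x gh])
    fix i
    \<comment> \<open>Exponents without the \<open>i\<close>-th variable contribute 0; the others
      are shifted by \<open>axis i 1\<close> and yield the coefficients of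
      \<open>mpartial i F\<close>.\<close>
    have "((\<lambda>k. mcoeff F k * dmonom_at k i (x - a)) has_sum D i x) (range (\<lambda>k. k + axis i 1))"
    proof (rule has_sum_cong_neutral[THEN iffD1, OF _ _ _ D[OF x, of i]])
      fix k :: "nat ^ 'n" assume k: "k \<in> UNIV - range (\<lambda>k. k + axis i 1)"
      have "k $ i = 0"
      proof (rule ccontr)
        assume "k $ i \<noteq> 0"
        then obtain l where "k = l + axis i 1" using axis_decomp by blast
        then show False using k by simp
      qed
      then show "mcoeff F k * dmonom_at k i (x - a) = 0" by (simp add: dmonom_at_def)
    qed auto
    also have "?this \<longleftrightarrow> ((\<lambda>k. mcoeff F (k + axis i 1) * dmonom_at (k + axis i 1) i (x - a)) has_sum D i x) UNIV"
      by (subst has_sum_reindex) (auto simp: inj_on_def o_def)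
    finally show "((\<lambda>k. mcoeff (mpartial i F) k * monom_at k (x - a)) has_sum D i x) UNIV"
      by (simp only: dmonom_at_add mcoeff_mpartial of_nat_id) (simp add: mult_ac)
  qed (use \<rho> in simp)
qed

section \<open>Gradients and uniqueness of the coefficients\<close>

lemma grad_eq:
  assumes "(h has_derivative (\<lambda>v. \<Sum>i\<in>UNIV. v $ i * D i)) (at x)" shows "grad h x $ i = D i"
proof -
  have "frechet_derivative h (at x) = (\<lambda>v. \<Sum>i\<in>UNIV. v $ i * D i)"
    using frechet_derivative_at[OF assms] by simp
  then show ?thesis by (simp add: grad_def axis_def if_distrib[of "\<lambda>x. x * _"] cong: if_cong)
qed

lemma PS_derivative:
  assumes "PS h a F" shows "(h has_derivative (\<lambda>v. \<Sum>i\<in>UNIV. v $ i * mcoeff F (axis i 1))) (at a)"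
    and "PS (\<lambda>x. grad h x $ i) a (mpartial i F)"
proof -
  obtain r D where r: "r > 0" "\<And>x. x \<in> box_at a r \<Longrightarrow> (h has_derivative (\<lambda>v. \<Sum>i\<in>UNIV. v $ i * D i x)) (at x)"
    "\<And>x i. x \<in> box_at a r \<Longrightarrow> ((\<lambda>k. mcoeff (mpartial i F) k * monom_at k (x - a)) has_sum D i x) UNIV"
    using PS_derivative_box[OF assms] by blast
  have g: "grad h x $ i = D i x" if "x \<in> box_at a r" for x i by (rule grad_eq[OF r(2)[OF that]])
  show ps: "PS (\<lambda>x. grad h x $ i) a (mpartial i F)" for i
    unfolding PS_iff using r g by (intro exI[of _ r]) auto
  have "D i a = mcoeff F (axis i 1)" for i
    using PS_value[OF ps[of i]] g[of a i] r(1) by (simp add: mcoeff_mpartial)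
  then show "(h has_derivative (\<lambda>v. \<Sum>i\<in>UNIV. v $ i * mcoeff F (axis i 1))) (at a)"
    using r(2)[of a] r(1) by simp
qed

text \<open>The constant coefficient is the value at \<open>a\<close>, and the coefficient at
  \<open>k + axis j 1\<close> is determined by the one at \<open>k\<close> of the
  \<open>j\<close>-th partial derivative; hence the induction runs over all functions at
  once.\<close>

lemma PS_unique:
  assumes "PS h a F" "PS h a F'" shows "F = F'"
proof (rule mfps_eqI)
  fix m
  show "mcoeff F m = mcoeff F' m" using assms
  proof (induction m arbitrary: h F F' rule: nat_vec_induct)
    case 0
    then show ?case using PS_value by metis
  next
    case (step k j)
    have "mcoeff (mpartial j F) k = mcoeff (mpartial j F') k"
      by (rule step.IH[OF PS_derivative(2)[OF step.prems(1)] PS_derivative(2)[OF step.prems(2)]])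
    then show ?case by (simp add: mcoeff_mpartial)
  qed
qed

text \<open>Convergence and uniqueness live over the reals. The embedding \<open>complexify\<close>
  respects ring operations and derivatives and carries identities over to
  \<open>taylor\<close>.\<close>

definition rtaylor :: "(real ^ 'n :: finite \<Rightarrow> real) \<Rightarrow> real ^ 'n \<Rightarrow> (real, 'n) mfps" where
  "rtaylor h a = (THE F. PS h a F)"

definition complexify :: "(real, 'n :: finite) mfps \<Rightarrow> (complex, 'n) mfps" where
  "complexify F = Abs_mfps (\<lambda>k. complex_of_real (mcoeff F k))"

lemma rtaylor_eq: "PS h a F \<Longrightarrow> rtaylor h a = F"
  unfolding rtaylor_def using PS_unique by blast

lemma taylor_eq: assumes "PS h a F" shows "taylor h a = complexify F"
proof -
  have "(THE c. has_power_series_at h a c) = mcoeff F"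
  proof (rule the_equality)
    show "has_power_series_at h a (mcoeff F)" using assms by (simp add: PS_def)
    fix c assume "has_power_series_at h a c"
    then have "PS h a (Abs_mfps c)" by (simp add: PS_def)
    then show "c = mcoeff F" using PS_unique[OF assms] mcoeff_Abs by metis
  qed
  then show ?thesis by (simp add: taylor_def complexify_def)
qed

lemma mcoeff_complexify [simp]: "mcoeff (complexify F) k = complex_of_real (mcoeff F k)"
  by (simp add: complexify_def)

lemma complexify_add: "complexify (F + G) = complexify F + complexify G"
  and complexify_mult: "complexify (F * G) = complexify F * complexify G"
  and complexify_0 [simp]: "complexify 0 = 0"
  and complexify_1 [simp]: "complexify 1 = 1"
  and complexify_uminus: "complexify (- F) = - complexify F"
  and complexify_mpartial: "complexify (mpartial i F) = mpartial i (complexify F)"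
  by (rule mfps_eqI; simp add: mcoeff_mult mcoeff_one case_prod_unfold mcoeff_mpartial)+

lemma complexify_sum: "complexify (sum f A) = (\<Sum>a\<in>A. complexify (f a))"
  by (induction A rule: infinite_finite_induct) (simp_all add: complexify_add)

lemma complexify_prod: "complexify (prod f A) = (\<Prod>a\<in>A. complexify (f a))"
  by (induction A rule: infinite_finite_induct) (simp_all add: complexify_mult)

lemma complexify_eq_0_iff: "complexify F = 0 \<longleftrightarrow> F = 0"
proof
  assume "complexify F = 0"
  then have "complex_of_real (mcoeff F k) = 0" for k by (metis mcoeff_complexify mcoeff_zero)
  then show "F = 0" by (intro mfps_eqI) simp
qed simp

lemma complexify_of_int: "complexify (of_int z) = of_int z"
proof -
  have "complexify (of_nat n) = of_nat n" for n :: nat by (induction n) (simp_all add: complexify_add)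
  then show ?thesis by (cases z) (simp_all add: complexify_uminus del: of_nat_Suc)
qed

lemma analytic_PS:
  assumes "real_analytic_on h S" "a \<in> S" shows "PS h a (rtaylor h a)"
proof -
  obtain c where "has_power_series_at h a c" using assms by (auto simp: real_analytic_on_def)
  then have "PS h a (Abs_mfps c)" by (simp add: PS_def)
  then show ?thesis using rtaylor_eq by metis
qed

lemma analytic_taylor: "real_analytic_on h S \<Longrightarrow> a \<in> S \<Longrightarrow> taylor h a = complexify (rtaylor h a)"
  by (rule taylor_eq[OF analytic_PS])

lemma analytic_grad:
  assumes "real_analytic_on h S" shows "real_analytic_on (\<lambda>x. grad h x $ i) S"
  unfolding real_analytic_on_def
proof
  fix a assume "a \<in> S"
  from PS_derivative(2)[OF analytic_PS[OF assms this], of i]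
  show "\<exists>c. has_power_series_at (\<lambda>x. grad h x $ i) a c" unfolding PS_def by blast
qed

lemma rtaylor_grad:
  assumes "real_analytic_on h S" "a \<in> S" shows "rtaylor (\<lambda>x. grad h x $ i) a = mpartial i (rtaylor h a)"
  by (rule rtaylor_eq[OF PS_derivative(2)[OF analytic_PS[OF assms]]])

lemma analytic_derivative:
  assumes "real_analytic_on h S" "a \<in> S"
  shows "(h has_derivative (\<lambda>v. \<Sum>i\<in>UNIV. v $ i * grad h a $ i)) (at a)"
proof -
  have "grad h a $ i = mcoeff (rtaylor h a) (axis i 1)" for i
    using PS_value[OF PS_derivative(2)[OF analytic_PS[OF assms]], of i] by (simp add: mcoeff_mpartial)
  then show ?thesis using PS_derivative(1)[OF analytic_PS[OF assms]] by simp
qed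

text \<open>Taylor coefficients are higher partial derivatives divided by factorials, so moving the
  base point differentiates them: induction on the exponent, with \<open>h\<close> replaced by a
  component of its gradient.\<close>

lemma rtaylor_coeff_derivative:
  assumes "real_analytic_on h S" "open S" "a \<in> S"
  shows "((\<lambda>x. mcoeff (rtaylor h x) m) has_derivative
    (\<lambda>v. \<Sum>i\<in>UNIV. v $ i * mcoeff (mpartial i (rtaylor h a)) m)) (at a)"
  using assms(1)
proof (induction m arbitrary: h rule: nat_vec_induct)
  case 0
  have "(h has_derivative (\<lambda>v. \<Sum>i\<in>UNIV. v $ i * mcoeff (mpartial i (rtaylor h a)) 0)) (at a)"
    using PS_derivative(1)[OF analytic_PS[OF 0 assms(3)]] by (simp add: mcoeff_mpartial)
  then show ?case
    by (rule has_derivative_transform_within_open[OF _ assms(2,3)]) (rule PS_value[OF analytic_PS[OF 0]])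
next
  case (step k j)
  have eq: "mcoeff (rtaylor h x) (k + axis j 1) = mcoeff (rtaylor (\<lambda>x. grad h x $ j) x) k / real (k $ j + 1)" if "x \<in> S" for x
    by (simp add: rtaylor_grad[OF step.prems that] mcoeff_mpartial del: of_nat_add)
  have "((\<lambda>x. mcoeff (rtaylor (\<lambda>x. grad h x $ j) x) k / real (k $ j + 1)) has_derivative
     (\<lambda>v. (\<Sum>i\<in>UNIV. v $ i * mcoeff (mpartial i (rtaylor (\<lambda>x. grad h x $ j) a)) k) / real (k $ j + 1))) (at a)"
    by (rule has_derivative_divide'[THEN has_derivative_eq_rhs, OF step.IH[OF analytic_grad[OF step.prems]] has_derivative_const])
      (auto simp del: of_nat_add)
  also have "(\<lambda>v. (\<Sum>i\<in>UNIV. v $ i * mcoeff (mpartial i (rtaylor (\<lambda>x. grad h x $ j) a)) k) / real (k $ j + 1))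
     = (\<lambda>v. \<Sum>i\<in>UNIV. v $ i * mcoeff (mpartial i (rtaylor h a)) (k + axis j 1))"
  proof
    fix v :: "real ^ 'a"
    have "mcoeff (mpartial i (rtaylor (\<lambda>x. grad h x $ j) a)) k = real (k $ j + 1) * mcoeff (mpartial i (rtaylor h a)) (k + axis j 1)" for i
      by (simp only: rtaylor_grad[OF step.prems assms(3)] mpartial_commute[of i j] mcoeff_mpartial[of j])
    then show "(\<Sum>i\<in>UNIV. v $ i * mcoeff (mpartial i (rtaylor (\<lambda>x. grad h x $ j) a)) k) / real (k $ j + 1)
       = (\<Sum>i\<in>UNIV. v $ i * mcoeff (mpartial i (rtaylor h a)) (k + axis j 1))"
      by (simp add: sum_divide_distrib del: of_nat_add)
  qed
  finally show ?case
    by (rule has_derivative_transform_within_open[OF _ assms(2,3)]) (rule eq[symmetric])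
qed

lemma mcoeff_mult_mconst [simp]: "mcoeff (f * mconst c) m = mcoeff f m * c"
  by (subst mult.commute) simp

text \<open>With K(X,t) = h(\<phi>(t) + X) this is \<partial>_t K = <\<partial>_X K, \<phi>'(t)>,
  the equation that formal integrals satisfy by \<open>time_independent\<close>.\<close>

lemma taylor_along_curve:
  fixes h :: "real ^ 'n :: finite \<Rightarrow> real"
  assumes h: "real_analytic_on h S" "open S" and \<phi>: "\<And>t. \<phi> t \<in> S"
    and d: "(\<phi> has_vector_derivative v) (at t)"
  shows "((\<lambda>s. mcoeff (taylor h (\<phi> s)) m) has_vector_derivative
    mcoeff (\<Sum>i\<in>UNIV. mpartial i (taylor h (\<phi> t)) * mconst (complex_of_real (v $ i))) m) (at t)"
proof -
  have "((\<lambda>x. mcoeff (rtaylor h x) m) has_derivative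
    (\<lambda>v. \<Sum>i\<in>UNIV. v $ i * mcoeff (mpartial i (rtaylor h (\<phi> t))) m)) (at (\<phi> t) within range \<phi>)"
    using rtaylor_coeff_derivative[OF h \<phi>] by (rule has_derivative_at_withinI)
  from vector_derivative_diff_chain_within[OF d this]
  have "((\<lambda>s. mcoeff (rtaylor h (\<phi> s)) m) has_vector_derivative
    (\<Sum>i\<in>UNIV. v $ i * mcoeff (mpartial i (rtaylor h (\<phi> t))) m)) (at t)" by (simp add: o_def)
  from has_vector_derivative_of_real[OF has_real_derivative_iff_has_vector_derivative[THEN iffD2, OF this]]
  have "((\<lambda>s. complex_of_real (mcoeff (rtaylor h (\<phi> s)) m)) has_vector_derivative
    complex_of_real (\<Sum>i\<in>UNIV. v $ i * mcoeff (mpartial i (rtaylor h (\<phi> t))) m)) (at t)" .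
  then show ?thesis
    by (simp add: analytic_taylor[OF h(1) \<phi>] mcoeff_mpartial mult_ac)
qed

section \<open>Integrable periodic orbits\<close>

lemma matrix_mult_uminus_left: "(- A) ** B = - (A ** (B :: 'a :: ring_1 ^ 'n ^ 'n))"
  and matrix_mult_diff_left: "(A - C) ** B = A ** B - C ** B"
  and matrix_mult_diff_right: "B ** (A - C) = B ** A - B ** C"
  by (simp_all add: matrix_matrix_mult_def vec_eq_iff sum_negf sum_subtractf algebra_simps)

lemma matrix_inv_inverse:
  assumes "invertible (M :: 'a :: semiring_1 ^ 'n ^ 'n)"
  shows "M ** matrix_inv M = mat 1" "matrix_inv M ** M = mat 1"
  using someI_ex[OF assms[unfolded invertible_def]] unfolding matrix_inv_def by auto

lemma has_vector_derivative_entry: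
  "(Q has_vector_derivative Q') F \<Longrightarrow> ((\<lambda>s. Q s $ i $ j) has_vector_derivative (Q' $ i $ j :: complex)) F"
  by (intro bounded_linear.has_vector_derivative[OF bounded_linear_vec_nth])

lemma differentiable_prod':
  fixes f :: "'i \<Rightarrow> real \<Rightarrow> complex"
  shows "(\<And>i. i \<in> A \<Longrightarrow> f i differentiable (at t)) \<Longrightarrow> (\<lambda>s. \<Prod>i\<in>A. f i s) differentiable (at t)"
  by (induction A rule: infinite_finite_induct) auto

lemma differentiable_det:
  fixes M :: "real \<Rightarrow> complex ^ 'n ^ 'n :: finite"
  assumes "\<And>i j. (\<lambda>s. M s $ i $ j) differentiable (at t)"
  shows "(\<lambda>s. det (M s)) differentiable (at t)"
  unfolding det_def
  by (intro differentiable_sum ballI differentiable_mult differentiable_prod' assms differentiable_const finite_permutations finite)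

text \<open>By Cramer's rule the entries of the inverse are quotients of determinants. Once they are
  differentiable, the value of the derivative follows by differentiating the product of the inverse
  with \<open>Q\<close>.\<close>

lemma differentiable_matrix_inv:
  fixes Q :: "real \<Rightarrow> complex ^ 'n ^ 'n :: finite"
  assumes "\<And>s. invertible (Q s)" "\<And>i j. (\<lambda>s. Q s $ i $ j) differentiable (at t)"
  shows "(\<lambda>s. matrix_inv (Q s) $ i $ j) differentiable (at t)"
proof -
  have det: "det (Q s) \<noteq> 0" for s using assms(1) invertible_det_nz by blast
  have "matrix_inv (Q s) $ i $ j = det (\<chi> p q. if q = i then axis j 1 $ p else Q s $ p $ q) / det (Q s)" for s
  proof -
    have "Q s *v (matrix_inv (Q s) *v axis j 1) = axis j 1"
      by (simp add: matrix_vector_mul_assoc matrix_inv_inverse assms(1))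
    then have "matrix_inv (Q s) *v axis j 1 =
        (\<chi> k. det (\<chi> p q. if q = k then axis j 1 $ p else Q s $ p $ q) / det (Q s))"
      using cramer[OF det] by blast
    moreover have "(matrix_inv (Q s) *v axis j 1) $ i = matrix_inv (Q s) $ i $ j"
      by (simp add: matrix_vector_mult_def axis_def if_distrib[of "(*) _"] cong: if_cong)
    ultimately show ?thesis by simp
  qed
  moreover have "(\<lambda>s. det (\<chi> p q. if q = i then axis j 1 $ p else Q s $ p $ q) / det (Q s)) differentiable (at t)"
  proof (intro differentiable_divide differentiable_det assms det)
    fix p q
    show "(\<lambda>s. (\<chi> p q. if q = i then axis j 1 $ p else Q s $ p $ q) $ p $ q) differentiable (at t)"
      by (cases "q = i") (use assms(2) in simp_all)
  qed
  ultimately show ?thesis by simp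
qed

lemma matrix_inv_derivative:
  fixes Q :: "real \<Rightarrow> complex ^ 'n ^ 'n :: finite"
  assumes inv: "\<And>s. invertible (Q s)" and Q': "(Q has_vector_derivative Q') (at t)"
  shows "((\<lambda>s. matrix_inv (Q s) $ i $ j) has_vector_derivative
    (- (matrix_inv (Q t) ** Q' ** matrix_inv (Q t))) $ i $ j) (at t)"
proof -
  define R where "R s = matrix_inv (Q s)" for s
  define D where "D = (\<chi> i j. vector_derivative (\<lambda>s. R s $ i $ j) (at t))"
  have D: "((\<lambda>s. R s $ i $ j) has_vector_derivative D $ i $ j) (at t)" for i j
  proof -
    have "(\<lambda>s. R s $ i $ j) differentiable (at t)"
      unfolding R_def
      by (intro differentiable_matrix_inv inv differentiableI_vector[OF has_vector_derivative_entry[OF Q']])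
    then show ?thesis by (simp add: D_def vector_derivative_works)
  qed
  have "(D ** Q t + R t ** Q') $ i $ j = 0" for i j
  proof -
    have "((\<lambda>s. \<Sum>k\<in>UNIV. R s $ i $ k * Q s $ k $ j) has_vector_derivative
       (\<Sum>k\<in>UNIV. R t $ i $ k * Q' $ k $ j + D $ i $ k * Q t $ k $ j)) (at t)"
      by (intro has_vector_derivative_sum has_vector_derivative_mult D has_vector_derivative_entry[OF Q'])
    also have "(\<lambda>s. \<Sum>k\<in>UNIV. R s $ i $ k * Q s $ k $ j) = (\<lambda>_. mat 1 $ i $ j)"
    proof
      fix s
      have "(R s ** Q s) $ i $ j = mat 1 $ i $ j" by (simp add: R_def matrix_inv_inverse inv)
      then show "(\<Sum>k\<in>UNIV. R s $ i $ k * Q s $ k $ j) = mat 1 $ i $ j" by (simp add: matrix_matrix_mult_def)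
    qed
    finally have "(\<Sum>k\<in>UNIV. R t $ i $ k * Q' $ k $ j + D $ i $ k * Q t $ k $ j) = 0"
      by (rule vector_derivative_unique_at) (rule has_vector_derivative_const)
    then show ?thesis by (simp add: matrix_matrix_mult_def sum.distrib add.commute)
  qed
  then have "D ** Q t + R t ** Q' = 0" by (simp add: vec_eq_iff)
  then have "D ** Q t = - (R t ** Q')" by (simp add: eq_neg_iff_add_eq_0)
  then have "D ** (Q t ** R t) = - (R t ** Q' ** R t)"
    by (simp add: matrix_mul_assoc matrix_mult_uminus_left)
  then have "D = - (R t ** Q' ** R t)" by (simp add: R_def matrix_inv_inverse inv)
  then show ?thesis using D[of i j] by (simp add: R_def)
qed

text \<open>The identity R' = A R - R J for the inverse R of Q expresses that Y = R X turns X' = J X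
  into Y' = A Y.\<close>

lemma floquet_inverse_derivative:
  assumes "floquet_reduction f \<phi> T Q A"
  shows "((\<lambda>s. matrix_inv (Q s) $ i $ j) has_vector_derivative
    (A ** matrix_inv (Q t) - matrix_inv (Q t) ** cmat (jacobian f (\<phi> t))) $ i $ j) (at t)"
proof -
  let ?R = "matrix_inv (Q t)" and ?J = "cmat (jacobian f (\<phi> t))"
  have inv: "\<And>t. invertible (Q t)"
    and Q': "(Q has_vector_derivative (?J ** Q t - Q t ** A)) (at t)"
    using assms by (auto simp: floquet_reduction_def)
  have "?R ** (?J ** Q t - Q t ** A) ** ?R = ?R ** ?J ** (Q t ** ?R) - (?R ** Q t) ** A ** ?R"
    by (simp add: matrix_mult_diff_left matrix_mult_diff_right matrix_mul_assoc)
  then have "- (?R ** (?J ** Q t - Q t ** A) ** ?R) = A ** ?R - ?R ** ?J"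
    by (simp add: matrix_inv_inverse inv)
  then show ?thesis using matrix_inv_derivative[OF inv Q', of i j] by simp
qed

lemma taylor_const_coeff:
  "real_analytic_on h S \<Longrightarrow> a \<in> S \<Longrightarrow> mcoeff (taylor h a) 0 = complex_of_real (h a)"
  by (simp add: analytic_taylor PS_value[OF analytic_PS, symmetric])

lemma taylor_linear_coeff:
  fixes f :: "real ^ 'n :: finite \<Rightarrow> real ^ 'n"
  assumes f: "\<And>i. real_analytic_on (\<lambda>x. f x $ i) S" and a: "a \<in> S"
  shows "mcoeff (taylor (\<lambda>x. f x $ i) a) (axis j 1) = cmat (jacobian f a) $ i $ j"
proof -
  define c where "c i j = mcoeff (rtaylor (\<lambda>x. f x $ i) a) (axis j 1)" for i j
  have d: "((\<lambda>x. f x $ i) has_derivative (\<lambda>v. \<Sum>j\<in>UNIV. v $ j * c i j)) (at a)" for i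
    unfolding c_def by (rule PS_derivative(1)[OF analytic_PS[OF f a]])
  have "(f has_derivative (\<lambda>v. \<chi> i. \<Sum>j\<in>UNIV. v $ j * c i j)) (at a)"
    unfolding has_derivative_componentwise_within[of f] Basis_vec_def
    using d by (auto simp: inner_axis)
  then have "frechet_derivative f (at a) = (\<lambda>v. \<chi> i. \<Sum>j\<in>UNIV. v $ j * c i j)"
    by (rule frechet_derivative_at[symmetric])
  then have "jacobian f a $ i $ j = c i j"
    by (simp add: jacobian_def matrix_def axis_def if_distrib[of "\<lambda>x. x * _"] cong: if_cong)
  then show ?thesis by (simp add: cmat_def c_def analytic_taylor[OF f a])
qed

text \<open>Left rather than right eigenvectors, because the linear parts of series are linear
  forms.\<close>

lemma left_eigenvector:
  fixes A :: "complex ^ 'n ^ 'n :: finite"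
  assumes "det (mat z - A) = 0"
  obtains l where "l \<noteq> 0" "l v* A = z *s l"
proof -
  have "det (transpose (mat z - A)) = 0" using assms by simp
  then have "\<not> (\<exists>B. B ** transpose (mat z - A) = mat 1)"
    unfolding invertible_left_inverse[symmetric] invertible_det_nz by simp
  then obtain l where l: "l \<noteq> 0" "transpose (mat z - A) *v l = 0"
    unfolding matrix_left_invertible_ker by blast
  have "l v* mat z = z *s l"
    by (simp add: vector_matrix_mult_def mat_def vec_eq_iff if_distrib[of "(*) _"] mult.commute cong: if_cong)
  then have "l v* A = z *s l" using l(2) by (simp add: vector_matrix_mult_diff_rdistrib)
  with l(1) that show ?thesis by blast
qed

text \<open>The common end of the analytic and the formal case. Subtracting \<open>K_deriv\<close>
  from \<open>K_int\<close> gives the transport equation for the field f(\<phi>(t) + X) -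
  f(\<phi>(t)), which has no constant term. The initial time \<open>t0\<close> is free because
  formal independence provides a nonzero minor only at some time.\<close>

theorem exponent_of_integrable_orbit:
  fixes f :: "real ^ 'n :: finite \<Rightarrow> real ^ 'n" and K :: "'k \<Rightarrow> real \<Rightarrow> (complex, 'n) mfps"
  assumes op: "open \<Omega>" and f: "\<And>i. real_analytic_on (\<lambda>x. f x $ i) \<Omega>"
    and orbit: "periodic_orbit \<Omega> f \<phi> T" and red: "floquet_reduction f \<phi> T Q A"
    and eig: "det (mat z - A) = 0"
    and K_deriv: "\<And>x m t. x \<in> S \<Longrightarrow> ((\<lambda>s. mcoeff (K x s) m) has_vector_derivative
        mcoeff (\<Sum>i\<in>UNIV. mpartial i (K x t) * mconst (complex_of_real (f (\<phi> t) $ i))) m) (at t)"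
    and K_int: "\<And>x t. x \<in> S \<Longrightarrow> (\<Sum>i\<in>UNIV. mpartial i (K x t) * taylor (\<lambda>x. f x $ i) (\<phi> t)) = 0"
    and K_per: "\<And>x. x \<in> S \<Longrightarrow> K x (t0 + T) = K x t0"
    and rank: "\<And>Z Z' i j. (\<And>x. x \<in> S \<Longrightarrow> (\<Sum>i\<in>UNIV. Z i * mpartial i (K x t0)) = 0) \<Longrightarrow>
        (\<And>x. x \<in> S \<Longrightarrow> (\<Sum>i\<in>UNIV. Z' i * mpartial i (K x t0)) = 0) \<Longrightarrow> Z i * Z' j = Z j * Z' i"
  shows "\<exists>q. z * of_real T = of_rat q * (2 * of_real pi * \<i>)"
proof (cases "z = 0")
  case True
  then show ?thesis by (intro exI[of _ 0]) simp
next
  \<comment> \<open>From here on \<open>z\<close> is nonzero, which will force the left eigenvector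
    to vanish on the tangent direction.\<close>
  case z: False
  have T: "T > 0" and \<phi>\<Omega>: "\<And>t. \<phi> t \<in> \<Omega>" and \<phi>': "\<And>t. (\<phi> has_vector_derivative f (\<phi> t)) (at t)"
    using orbit by (auto simp: periodic_orbit_def)
  have inv: "\<And>t. invertible (Q t)" and Qper: "\<And>t. Q (t + T) = Q t"
    using red by (auto simp: floquet_reduction_def)
  obtain v where v: "v \<noteq> 0" "A *v v = 0" "\<And>t. \<exists>c. Q t *v v = c *s cvec (f (\<phi> t))"
    using red by (auto simp: floquet_reduction_def)
  obtain l0 where l0: "l0 \<noteq> 0" "l0 v* A = z *s l0" using left_eigenvector[OF eig] by blast
  define R where "R t = matrix_inv (Q t)" for t
  define J where "J t = cmat (jacobian f (\<phi> t))" for t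
  define G where "G t i = taylor (\<lambda>x. f x $ i) (\<phi> t) - mconst (complex_of_real (f (\<phi> t) $ i))" for t i
  \<comment> \<open>Along Y' = A Y the form given by \<open>l0\<close> grows like exp(z t). With
    this factor divided out and Y replaced by R X, it is constant along the linearized system, that
    is, l' = - l J.\<close>
  define l where "l t = exp (- z * of_real (t - t0)) *s (l0 v* R t)" for t
  have QR: "Q t ** R t = mat 1" "R t ** Q t = mat 1" for t
    by (simp_all add: R_def matrix_inv_inverse inv)
  have R': "((\<lambda>s. R s $ i $ j) has_vector_derivative (A ** R t - R t ** J t) $ i $ j) (at t)" for i j t
    unfolding R_def J_def by (rule floquet_inverse_derivative[OF red])
  have f_ne: "f (\<phi> t) \<noteq> 0" for t
  proof
    assume "f (\<phi> t) = 0"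
    then have "Q t *v v = 0" using v(3)[of t] by (auto simp: cvec_def vec_eq_iff)
    then have "R t *v (Q t *v v) = 0" by simp
    then show False using v(1) by (simp add: matrix_vector_mul_assoc QR)
  qed
  obtain q where q: "f (\<phi> t0) $ q \<noteq> 0" using f_ne[of t0] by (auto simp: vec_eq_iff)
  have coeff_deriv: "\<exists>d. ((\<lambda>s. mcoeff (taylor (\<lambda>x. f x $ i) (\<phi> s)) m) has_vector_derivative d) (at t)" for i m t
    using taylor_along_curve[where h = "\<lambda>x. f x $ i", OF f op \<phi>\<Omega> \<phi>'[of t]] by blast
  \<comment> \<open>After one period \<open>R\<close> returns to its value and only the factor
    \<open>exp (- z * of_real T)\<close> of \<open>l\<close> remains, hence the sign.\<close>
  have "\<exists>r. - z * of_real T = of_rat r * (2 * of_real pi * \<i>)"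
  proof (rule formal_core[where G = G and K = K and S = S and a = t0 and b = "t0 + T" and l = l and q = q
        and W = "\<lambda>i. taylor (\<lambda>x. f x $ i) (\<phi> t0)"])
    show "t0 \<le> t0 + T" using T by simp
    show G0: "mcoeff (G t i) 0 = 0" for t i
      by (simp add: G_def taylor_const_coeff[OF f \<phi>\<Omega>] mcoeff_mconst)
    show "continuous_on {t0..t0 + T} (\<lambda>t. mcoeff (G t i) m)" for i m
    proof (rule continuous_at_imp_continuous_on, intro ballI)
      fix t
      have "isCont (\<lambda>t. mcoeff (taylor (\<lambda>x. f x $ i) (\<phi> t)) m) t" for m
        using coeff_deriv[of i m t] has_vector_derivative_continuous by blast
      from this[of m] this[of 0] show "isCont (\<lambda>t. mcoeff (G t i) m) t"
        unfolding G_def mcoeff_diff mcoeff_mconst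
        by (cases "m = 0") (simp_all add: taylor_const_coeff[OF f \<phi>\<Omega>])
    qed
    show "((\<lambda>s. mcoeff (K x s) m) has_vector_derivative
       - mcoeff (\<Sum>i\<in>UNIV. mpartial i (K x t) * G t i) m) (at t within {t0..t0 + T})" if "x \<in> S" for x m t
    proof -
      have "(\<Sum>i\<in>UNIV. mpartial i (K x t) * G t i)
        = 0 - (\<Sum>i\<in>UNIV. mpartial i (K x t) * mconst (complex_of_real (f (\<phi> t) $ i)))"
        using K_int[OF that, of t] by (simp add: G_def right_diff_distrib sum_subtractf)
      then have "- mcoeff (\<Sum>i\<in>UNIV. mpartial i (K x t) * G t i) m
        = mcoeff (\<Sum>i\<in>UNIV. mpartial i (K x t) * mconst (complex_of_real (f (\<phi> t) $ i))) m"
        by (simp only: mcoeff_diff mcoeff_zero) simp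
      then show ?thesis using K_deriv[OF that, of m t] has_vector_derivative_at_within by metis
    qed
    show "K x (t0 + T) = K x t0" if "x \<in> S" for x using that by (rule K_per)
    show "(\<Sum>i\<in>UNIV. taylor (\<lambda>x. f x $ i) (\<phi> t0) * mpartial i (K x t0)) = 0" if "x \<in> S" for x
      using K_int[OF that, of t0] by (simp add: mult.commute)
    show "mcoeff (taylor (\<lambda>x. f x $ q) (\<phi> t0)) 0 \<noteq> 0" using q by (simp add: taylor_const_coeff[OF f \<phi>\<Omega>])
    show "((\<lambda>s. l s $ p) has_vector_derivative - (\<Sum>i\<in>UNIV. l t $ i * mcoeff (G t i) (axis p 1))) (at t within {t0..t0 + T})" for p t
    proof -
      let ?e = "\<lambda>t. exp (- z * of_real (t - t0)) :: complex"
      have e': "(?e has_vector_derivative - z * ?e t) (at t)"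
      proof -
        have "((\<lambda>w. exp (- z * (w - of_real t0))) has_field_derivative - z * exp (- z * (of_real t - of_real t0))) (at (of_real t))"
          by (auto intro!: derivative_eq_intros)
        from has_vector_derivative_real_field[OF this] show ?thesis by simp
      qed
      have 1: "((\<lambda>s. ?e s * (\<Sum>i\<in>UNIV. l0 $ i * R s $ i $ p)) has_vector_derivative
        ?e t * (\<Sum>i\<in>UNIV. l0 $ i * (A ** R t - R t ** J t) $ i $ p) + (- z * ?e t) * (\<Sum>i\<in>UNIV. l0 $ i * R t $ i $ p)) (at t)"
        by (intro has_vector_derivative_mult e' has_vector_derivative_sum has_vector_derivative_mult_right R')
      have 2: "(\<Sum>i\<in>UNIV. l0 $ i * (A ** R t - R t ** J t) $ i $ p) = (z *s (l0 v* R t)) $ p - ((l0 v* R t) v* J t) $ p"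
      proof -
        have "(\<Sum>i\<in>UNIV. l0 $ i * (A ** R t - R t ** J t) $ i $ p) = (l0 v* (A ** R t - R t ** J t)) $ p"
          by (simp add: vector_matrix_mult_def)
        also have "l0 v* (A ** R t - R t ** J t) = (l0 v* A) v* R t - (l0 v* R t) v* J t"
          by (simp add: vector_matrix_mult_diff_rdistrib vector_matrix_mul_assoc)
        also have "(l0 v* A) v* R t = z *s (l0 v* R t)"
          unfolding l0(2) by (simp add: vector_matrix_mult_def vec_eq_iff sum_distrib_left mult.assoc)
        finally show ?thesis by simp
      qed
      have 3: "(\<Sum>i\<in>UNIV. l0 $ i * R t $ i $ p) = (l0 v* R t) $ p" for t
        by (simp add: vector_matrix_mult_def)
      have 4: "?e t * ((z *s (l0 v* R t)) $ p - ((l0 v* R t) v* J t) $ p) + (- z * ?e t) * (l0 v* R t) $ p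
         = - (?e t * ((l0 v* R t) v* J t) $ p)"
        by (simp add: algebra_simps)
      have 5: "(\<lambda>s. l s $ p) = (\<lambda>s. ?e s * (l0 v* R s) $ p)" by (simp add: l_def)
      have "((\<lambda>s. l s $ p) has_vector_derivative - (?e t * ((l0 v* R t) v* J t) $ p)) (at t)"
        using 1 unfolding 2 3 4 5 .
      moreover have "?e t * ((l0 v* R t) v* J t) $ p = (\<Sum>i\<in>UNIV. l t $ i * mcoeff (G t i) (axis p 1))"
        unfolding l_def G_def mcoeff_diff taylor_linear_coeff[OF f \<phi>\<Omega>] J_def
        by (simp add: mcoeff_mconst vector_matrix_mult_def sum_distrib_left sum_distrib_right mult_ac)
      ultimately show ?thesis using has_vector_derivative_at_within by metis
    qed
    have "R (t0 + T) = R t0" by (simp add: R_def Qper)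
    then show "l (t0 + T) = exp (- z * of_real T) *s l t0" by (simp add: l_def)
    show "l t0 \<noteq> 0"
    proof
      assume "l t0 = 0"
      then have "(l0 v* R t0) v* Q t0 = 0" by (simp add: l_def)
      then show False using l0(1) by (simp add: vector_matrix_mul_assoc QR)
    qed
    show "(\<Sum>i\<in>UNIV. l t0 $ i * mcoeff (taylor (\<lambda>x. f x $ i) (\<phi> t0)) 0) = 0"
    proof -
      have dot: "(\<Sum>i\<in>UNIV. (x v* M) $ i * y $ i) = (\<Sum>i\<in>UNIV. x $ i * (M *v y) $ i)"
        for x y :: "complex ^ 'n" and M :: "complex ^ 'n ^ 'n"
        unfolding vector_matrix_mult_def matrix_vector_mult_def
        by (simp add: sum_distrib_left sum_distrib_right mult.assoc) (rule sum.swap)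
      obtain c where c: "Q t0 *v v = c *s cvec (f (\<phi> t0))" using v(3) by blast
      have "c \<noteq> 0"
      proof
        assume "c = 0"
        then have "R t0 *v (Q t0 *v v) = 0" using c by simp
        then show False using v(1) by (simp add: matrix_vector_mul_assoc QR)
      qed
      \<comment> \<open>A left eigenvector for \<open>z\<close> is paired with a right eigenvector
        for 0; since \<open>z\<close> is nonzero, the pairing vanishes.\<close>
      have "z * (\<Sum>i\<in>UNIV. l0 $ i * v $ i) = (\<Sum>i\<in>UNIV. (l0 v* A) $ i * v $ i)"
        by (simp add: l0(2) sum_distrib_left mult.assoc)
      also have "\<dots> = 0" unfolding dot by (simp add: v(2))
      finally have l0v: "(\<Sum>i\<in>UNIV. l0 $ i * v $ i) = 0" using z by simp
      have "c * (\<Sum>i\<in>UNIV. (l0 v* R t0) $ i * cvec (f (\<phi> t0)) $ i) = (\<Sum>i\<in>UNIV. (l0 v* R t0) $ i * (Q t0 *v v) $ i)"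
        by (simp add: c sum_distrib_left mult_ac)
      also have "\<dots> = (\<Sum>i\<in>UNIV. ((l0 v* R t0) v* Q t0) $ i * v $ i)" by (rule dot[symmetric])
      also have "\<dots> = 0" using l0v by (simp add: vector_matrix_mul_assoc QR)
      finally show ?thesis
        using \<open>c \<noteq> 0\<close> by (simp add: l_def taylor_const_coeff[OF f \<phi>\<Omega>] cvec_def)
    qed
  next
    fix Z Z' :: "'n \<Rightarrow> (complex, 'n) mfps" and i j
    assume "\<And>x. x \<in> S \<Longrightarrow> (\<Sum>i\<in>UNIV. Z i * mpartial i (K x t0)) = 0"
      "\<And>x. x \<in> S \<Longrightarrow> (\<Sum>i\<in>UNIV. Z' i * mpartial i (K x t0)) = 0"
    then show "Z i * Z' j = Z j * Z' i" by (rule rank)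
  qed
  then obtain r where "- z * of_real T = of_rat r * (2 * of_real pi * \<i>)" by blast
  then have "z * of_real T = of_rat (- r) * (2 * of_real pi * \<i>)"
    by (simp add: of_rat_minus) (metis minus_equation_iff)
  then show ?thesis by blast
qed

section \<open>Linear substitutions in power series\<close>

definition form_prod :: "'a :: comm_ring_1 ^ 'n ^ 'n \<Rightarrow> nat ^ 'n \<Rightarrow> ('a, 'n :: finite) mfps" where
  "form_prod M k = (\<Prod>i\<in>UNIV. linear_form (M $ i) ^ (k $ i))"

lemma mcoeff_msubst: "mcoeff (msubst M h) m = (\<Sum>k | mdeg k = mdeg m. mcoeff h k * mcoeff (form_prod M k) m)"
  by (simp add: msubst_def form_prod_def)

section \<open>Homogeneous series\<close>

definition homogeneous :: "nat \<Rightarrow> ('a :: comm_ring_1, 'n :: finite) mfps \<Rightarrow> bool" where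
  "homogeneous d h \<longleftrightarrow> (\<forall>m. mdeg m \<noteq> d \<longrightarrow> mcoeff h m = 0)"

lemma homogeneous_mult: 
  fixes f g :: "('a :: comm_ring_1, 'n :: finite) mfps"
  assumes "homogeneous d f" "homogeneous e g" shows "homogeneous (d + e) (f * g)"
  unfolding homogeneous_def
proof (intro allI impI)
  fix m :: "nat ^ 'n" assume m: "mdeg m \<noteq> d + e"
  have "mcoeff f k * mcoeff g l = 0" if "(k, l) \<in> splits m" for k l
  proof -
    have "mdeg k + mdeg l = mdeg m" using that by (auto simp: splits_def)
    then have "mdeg k \<noteq> d \<or> mdeg l \<noteq> e" using m by auto
    then show ?thesis using assms by (auto simp: homogeneous_def)
  qed
  then show "mcoeff (f * g) m = 0" unfolding mcoeff_mult by (intro sum.neutral) auto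
qed

lemma homogeneous_1: "homogeneous 0 1"
  by (simp add: homogeneous_def mcoeff_one)

lemma homogeneous_linear_form: "homogeneous 1 (linear_form r)"
  by (auto simp: homogeneous_def mcoeff_linear_form intro!: sum.neutral)

lemma homogeneous_power: "homogeneous d f \<Longrightarrow> homogeneous (d * k) (f ^ k)"
  by (induction k) (simp_all add: homogeneous_1 homogeneous_mult)

lemma homogeneous_prod: "finite A \<Longrightarrow> (\<And>a. a \<in> A \<Longrightarrow> homogeneous (d a) (f a)) \<Longrightarrow> homogeneous (sum d A) (prod f A)"
  by (induction A rule: finite_induct) (simp_all add: homogeneous_1 homogeneous_mult)

lemma homogeneous_form_prod: "homogeneous (mdeg k) (form_prod M k)"
proof -
  have "homogeneous (k $ i) (linear_form (M $ i) ^ (k $ i))" for i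
    using homogeneous_power[OF homogeneous_linear_form, of "k $ i" "M $ i"] by simp
  then show ?thesis unfolding form_prod_def mdeg_def by (intro homogeneous_prod) auto
qed

lemma form_prod_0 [simp]: "form_prod M 0 = 1" by (simp add: form_prod_def)

lemma form_prod_axis: "form_prod M (k + axis j 1) = form_prod M k * linear_form (M $ j)"
proof -
  have "(\<Prod>i\<in>UNIV. linear_form (M $ i) ^ (axis j 1 $ i)) = (\<Prod>i\<in>UNIV. if i = j then linear_form (M $ i) else 1)"
    by (rule prod.cong) (auto simp: axis_def)
  then show ?thesis by (simp add: form_prod_def power_add prod.distrib)
qed

section \<open>Substitution as a ring homomorphism\<close>

lemma msubst_add: "msubst M (f + g) = msubst M f + msubst M g"
  by (rule mfps_eqI) (simp add: mcoeff_msubst ring_distribs sum.distrib)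

lemma msubst_cmult: "msubst M (mconst c * f) = mconst c * msubst M f"
  by (rule mfps_eqI) (simp add: mcoeff_msubst sum_distrib_left mult.assoc)

lemma msubst_0 [simp]: "msubst M 0 = 0"
  by (rule mfps_eqI) (simp add: mcoeff_msubst)

lemma msubst_sum: "msubst M (sum f A) = (\<Sum>a\<in>A. msubst M (f a))"
  by (induction A rule: infinite_finite_induct) (simp_all add: msubst_add)

lemma msubst_mmono: "msubst M (mmono k) = form_prod M k"
proof (rule mfps_eqI)
  fix m
  have "mcoeff (msubst M (mmono k)) m = (\<Sum>l | mdeg l = mdeg m. if l = k then mcoeff (form_prod M l) m else 0)"
    unfolding mcoeff_msubst by (rule sum.cong) (auto simp: mcoeff_mmono)
  also have "\<dots> = (if mdeg k = mdeg m then mcoeff (form_prod M k) m else 0)"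
    by (simp add: finite_mdeg_eq sum.delta')
  also have "\<dots> = mcoeff (form_prod M k) m"
    using homogeneous_form_prod[of k M] by (auto simp: homogeneous_def)
  finally show "mcoeff (msubst M (mmono k)) m = mcoeff (form_prod M k) m" .
qed

lemma msubst_vanish: "vanish N h \<Longrightarrow> vanish N (msubst M h)"
  by (auto simp: vanish_def mcoeff_msubst intro!: sum.neutral)

lemma msubst_1 [simp]: "msubst M 1 = 1"
  using msubst_mmono[of M 0] by simp

lemma msubst_mconst [simp]: "msubst M (mconst c) = mconst c"
  using msubst_cmult[of M c 1] by simp

lemma vanish_SucD: "vanish (Suc N) h \<Longrightarrow> vanish N h"
  by (simp add: vanish_def)

lemma msubst_mult_mvar: "msubst M (h * mvar j) = msubst M h * linear_form (M $ j)"
proof (rule additive_eqI[where \<Phi> = "\<lambda>h. msubst M (h * mvar j)" and \<Psi> = "\<lambda>h. msubst M h * linear_form (M $ j)"])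
  fix c and k :: "nat ^ 'b"
  have "msubst M (mconst c * mmono k * mvar j) = mconst c * form_prod M (k + axis j 1)"
    by (simp only: mult.assoc msubst_cmult flip: mmono_axis) (simp add: msubst_mmono)
  then show "msubst M (mconst c * mmono k * mvar j) = msubst M (mconst c * mmono k) * linear_form (M $ j)"
    by (simp add: msubst_cmult msubst_mmono form_prod_axis mult.assoc)
qed (auto simp: msubst_add ring_distribs dest!: vanish_SucD intro: vanish_mult1 msubst_vanish)

text \<open>Known for one variable as second factor; induction adds variables up to monomials, and
  \<open>additive_eqI\<close> passes to all series.\<close>

lemma msubst_mult: "msubst M (f * g) = msubst M f * msubst M g"
proof (rule additive_eqI[where \<Phi> = "\<lambda>g. msubst M (f * g)" and \<Psi> = "\<lambda>g. msubst M f * msubst M g"])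
  fix c and k :: "nat ^ 'b"
  show "msubst M (f * (mconst c * mmono k)) = msubst M f * msubst M (mconst c * mmono k)"
  proof (induction k rule: nat_vec_induct)
    case 0
    then show ?case using msubst_cmult[of M c f] by (simp add: mult.commute)
  next
    case (step k j)
    have "msubst M (f * (mconst c * mmono (k + axis j 1))) = msubst M (f * (mconst c * mmono k) * mvar j)"
      by (simp only: mmono_axis mult.assoc)
    also have "\<dots> = msubst M f * msubst M (mconst c * mmono k) * linear_form (M $ j)"
      by (simp only: msubst_mult_mvar step)
    also have "\<dots> = msubst M f * msubst M (mconst c * mmono k * mvar j)"
      by (simp only: msubst_mult_mvar) (simp only: mult.assoc)
    finally show ?case by (simp only: mmono_axis mult.assoc)
  qed
qed (auto simp: msubst_add ring_distribs dest!: vanish_SucD intro: vanish_mult2 msubst_vanish)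

lemma mvar_eq_linear_form: "mvar j = linear_form (axis j 1)"
  by (simp add: linear_form_eq axis_def if_distrib[of mconst] if_distrib[of "\<lambda>x. x * _"] cong: if_cong)

lemma msubst_mvar: "msubst M (mvar j) = linear_form (M $ j)"
  using msubst_mult_mvar[of M 1 j] by simp

lemma msubst_linear_form: "msubst M (linear_form r) = linear_form (r v* M)"
proof -
  have "msubst M (linear_form r) = (\<Sum>j\<in>UNIV. mconst (r $ j) * linear_form (M $ j))"
    by (simp add: linear_form_eq[of r] msubst_sum msubst_cmult msubst_mvar)
  also have "\<dots> = (\<Sum>j\<in>UNIV. \<Sum>k\<in>UNIV. mconst (r $ j * M $ j $ k) * mvar k)"
    by (simp add: linear_form_eq mconst_mult sum_distrib_left mult.assoc)
  also have "\<dots> = linear_form (r v* M)"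
    by (subst sum.swap) (simp add: linear_form_eq vector_matrix_mult_def mconst_sum sum_distrib_right)
  finally show ?thesis .
qed

text \<open>The inner substitution gives h(M Y), the outer one replaces Y by N Y, so the matrices
  multiply in the order \<open>M ** N\<close>.\<close>

lemma msubst_inverse:
  assumes "M ** N = mat 1" shows "msubst N (msubst M h) = h"
proof (rule additive_eqI[where \<Phi> = "\<lambda>h. msubst N (msubst M h)" and \<Psi> = "\<lambda>h. h"])
  fix c and k :: "nat ^ 'b"
  have lin: "msubst N (msubst M (mvar j)) = mvar j" for j
  proof -
    have "msubst N (msubst M (mvar j)) = linear_form ((axis j 1 v* M) v* N)"
      by (simp add: mvar_eq_linear_form msubst_linear_form)
    then show ?thesis by (simp add: vector_matrix_mul_assoc assms mvar_eq_linear_form)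
  qed
  show "msubst N (msubst M (mconst c * mmono k)) = mconst c * mmono k"
  proof (induction k rule: nat_vec_induct)
    case (step k j)
    have "msubst N (msubst M (mconst c * mmono k * mvar j)) = mconst c * mmono k * mvar j"
      by (simp only: msubst_mult[of M "mconst c * mmono k"] msubst_mult[of N "msubst M _"] step lin)
    then show ?case by (simp only: mmono_axis mult.assoc)
  qed simp
qed (auto simp: msubst_add dest!: vanish_SucD intro: msubst_vanish)

lemma mpartial_msubst: "mpartial p (msubst M h) = (\<Sum>j\<in>UNIV. mconst (M $ j $ p) * msubst M (mpartial j h))"
proof (rule additive_eqI[where \<Phi> = "\<lambda>h. mpartial p (msubst M h)"
      and \<Psi> = "\<lambda>h. \<Sum>j\<in>UNIV. mconst (M $ j $ p) * msubst M (mpartial j h)"])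
  fix c and k :: "nat ^ 'b"
  show "mpartial p (msubst M (mconst c * mmono k)) = (\<Sum>j\<in>UNIV. mconst (M $ j $ p) * msubst M (mpartial j (mconst c * mmono k)))"
  proof (induction k rule: nat_vec_induct)
    case (step k i)
    let ?h = "mconst c * mmono k"
    have "mpartial p (msubst M (?h * mvar i))
      = (\<Sum>j\<in>UNIV. mconst (M $ j $ p) * msubst M (mpartial j ?h)) * linear_form (M $ i) + msubst M ?h * mconst (M $ i $ p)"
      by (simp only: msubst_mult_mvar mpartial_mult mpartial_linear_form step)
    also have "msubst M ?h * mconst (M $ i $ p) = (\<Sum>j\<in>UNIV. mconst (M $ j $ p) * msubst M (?h * mpartial j (mvar i)))"
      by (simp add: mpartial_mvar if_distrib[of "\<lambda>x. _ * x"] if_distrib[of "msubst M"] mult.commute cong: if_cong)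
    also have "(\<Sum>j\<in>UNIV. mconst (M $ j $ p) * msubst M (mpartial j ?h)) * linear_form (M $ i)
      = (\<Sum>j\<in>UNIV. mconst (M $ j $ p) * msubst M (mpartial j ?h * mvar i))"
      by (simp only: msubst_mult_mvar sum_distrib_right mult.assoc)
    also have "(\<Sum>j\<in>UNIV. mconst (M $ j $ p) * msubst M (mpartial j ?h * mvar i)) +
        (\<Sum>j\<in>UNIV. mconst (M $ j $ p) * msubst M (?h * mpartial j (mvar i)))
      = (\<Sum>j\<in>UNIV. mconst (M $ j $ p) * msubst M (mpartial j (?h * mvar i)))"
      by (simp only: mpartial_mult[of _ ?h] msubst_add ring_distribs sum.distrib)
    finally show ?case by (simp only: mmono_axis mult.assoc)
  qed simp
qed (auto simp: msubst_add mpartial_add ring_distribs sum.distrib intro: vanish_sum vanish_mult2 vanish_mpartial msubst_vanish)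

text \<open>Unlike \<open>tderiv\<close>, which has some value even where the derivative does not
  exist, this relation carries differentiability along.\<close>

definition has_tderiv :: "(real \<Rightarrow> (complex, 'n :: finite) mfps) \<Rightarrow> (complex, 'n) mfps \<Rightarrow> real \<Rightarrow> bool" where
  "has_tderiv K K' t \<longleftrightarrow> (\<forall>m. ((\<lambda>s. mcoeff (K s) m) has_vector_derivative mcoeff K' m) (at t))"

lemma has_tderiv_tderiv: "has_tderiv K K' t \<Longrightarrow> tderiv K t = K'"
  by (rule mfps_eqI) (simp add: has_tderiv_def tderiv_def vector_derivative_at)

lemma has_tderiv_mult:
  fixes K L :: "real \<Rightarrow> (complex, 'n :: finite) mfps"
  assumes "has_tderiv K K' t" "has_tderiv L L' t"
  shows "has_tderiv (\<lambda>s. K s * L s) (K' * L t + K t * L') t"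
  unfolding has_tderiv_def
proof
  fix m :: "nat ^ 'n"
  have "((\<lambda>s. \<Sum>p\<in>splits m. mcoeff (K s) (fst p) * mcoeff (L s) (snd p)) has_vector_derivative
     (\<Sum>p\<in>splits m. mcoeff (K t) (fst p) * mcoeff L' (snd p) + mcoeff K' (fst p) * mcoeff (L t) (snd p))) (at t)"
    using assms by (intro has_vector_derivative_sum has_vector_derivative_mult) (auto simp: has_tderiv_def)
  then show "((\<lambda>s. mcoeff (K s * L s) m) has_vector_derivative mcoeff (K' * L t + K t * L') m) (at t)"
    by (simp add: mcoeff_mult case_prod_unfold sum.distrib add.commute)
qed

lemma has_tderiv_linear_form:
  assumes "\<And>j. ((\<lambda>s. r s $ j) has_vector_derivative r' $ j) (at t)"
  shows "has_tderiv (\<lambda>s. linear_form (r s)) (linear_form r') t"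
  unfolding has_tderiv_def mcoeff_linear_form
proof (intro allI has_vector_derivative_sum)
  show "((\<lambda>s. if m = axis j 1 then r s $ j else 0) has_vector_derivative (if m = axis j 1 then r' $ j else 0)) (at t)" for m j
    using assms[of j] by (cases "m = axis j 1") auto
qed

text \<open>The chain rule for a monomial at M(t) Y: its gradient there is paired with M'(t) Y. Each
  added variable contributes one term by the product rule.\<close>

lemma has_tderiv_form_prod:
  fixes M :: "real \<Rightarrow> complex ^ 'n ^ 'n :: finite"
  assumes M': "\<And>i j. ((\<lambda>s. M s $ i $ j) has_vector_derivative M' $ i $ j) (at t)"
  shows "has_tderiv (\<lambda>s. form_prod (M s) k) (\<Sum>j\<in>UNIV. msubst (M t) (mpartial j (mmono k)) * linear_form (M' $ j)) t"
proof (induction k rule: nat_vec_induct)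
  case 0
  then show ?case by (simp add: has_tderiv_def)
next
  case (step k i)
  have "(\<Sum>j\<in>UNIV. msubst (M t) (mpartial j (mmono k)) * linear_form (M' $ j)) * linear_form (M t $ i) + form_prod (M t) k * linear_form (M' $ i)
      = (\<Sum>j\<in>UNIV. msubst (M t) (mpartial j (mmono k * mvar i)) * linear_form (M' $ j))"
  proof -
    have "form_prod (M t) k * linear_form (M' $ i)
      = (\<Sum>j\<in>UNIV. msubst (M t) (mmono k * mpartial j (mvar i)) * linear_form (M' $ j))"
      by (simp add: mpartial_mvar msubst_mmono if_distrib[of "\<lambda>x. _ * x"] if_distrib[of "msubst _"] if_distrib[of "\<lambda>x. x * _"] cong: if_cong)
    moreover have "(\<Sum>j\<in>UNIV. msubst (M t) (mpartial j (mmono k)) * linear_form (M' $ j)) * linear_form (M t $ i)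
      = (\<Sum>j\<in>UNIV. msubst (M t) (mpartial j (mmono k) * mvar i) * linear_form (M' $ j))"
      by (simp only: msubst_mult_mvar sum_distrib_right) (simp only: mult_ac)
    ultimately show ?thesis
      by (simp only: mpartial_mult msubst_add distrib_right sum.distrib)
  qed
  then show ?case
    using has_tderiv_mult[OF step has_tderiv_linear_form[of "\<lambda>s. M s $ i" "M' $ i"]] M'
    by (simp only: form_prod_axis mmono_axis)
qed

lemma has_tderiv_msubst:
  fixes M :: "real \<Rightarrow> complex ^ 'n ^ 'n :: finite"
  assumes M': "\<And>i j. ((\<lambda>s. M s $ i $ j) has_vector_derivative M' $ i $ j) (at t)"
    and H: "has_tderiv H H' t"
  shows "has_tderiv (\<lambda>s. msubst (M s) (H s))
    (msubst (M t) H' + (\<Sum>j\<in>UNIV. msubst (M t) (mpartial j (H t)) * linear_form (M' $ j))) t"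
  unfolding has_tderiv_def
proof
  fix m :: "nat ^ 'n"
  \<comment> \<open>The contribution of the moving matrix. A partial derivative lowers the degree by
    one and a linear form raises it again, so the coefficient at \<open>m\<close> depends on the
    finitely many coefficients of \<open>h\<close> in degree \<open>mdeg m\<close>.\<close>
  define \<Psi> where "\<Psi> h = (\<Sum>j\<in>UNIV. msubst (M t) (mpartial j h) * linear_form (M' $ j))" for h
  have \<Psi>_coeff: "mcoeff (\<Psi> h) m = (\<Sum>k | mdeg k = mdeg m. mcoeff h k * mcoeff (\<Psi> (mmono k)) m)" for h
  proof -
    have add: "\<Psi> (f + g) = \<Psi> f + \<Psi> g" for f g
      by (simp add: \<Psi>_def mpartial_add msubst_add ring_distribs sum.distrib)
    have cmult: "\<Psi> (mconst c * f) = mconst c * \<Psi> f" for c f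
      by (simp add: \<Psi>_def mpartial_mconst_mult msubst_cmult sum_distrib_left mult.assoc)
    have "\<Psi> 0 = 0" using cmult[of 0 0] by simp
    then have sum: "\<Psi> (sum f A) = (\<Sum>a\<in>A. \<Psi> (f a))" for f :: "nat ^ 'n \<Rightarrow> _" and A
      by (induction A rule: infinite_finite_induct) (simp_all add: add)
    have van: "mcoeff (\<Psi> h) m = 0" if "\<And>k. mdeg k = mdeg m \<Longrightarrow> mcoeff h k = 0" for h
    proof -
      have "mcoeff (msubst (M t) (mpartial j h) * linear_form (M' $ j)) m = 0" for j
      proof -
        have "mcoeff (msubst (M t) (mpartial j h)) k * mcoeff (linear_form (M' $ j)) l = 0"
          if "(k, l) \<in> splits m" for k l
        proof (cases "mdeg l = 1")
          case True
          have "mdeg (q + axis j 1) = mdeg m" if "mdeg q = mdeg k" for q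
            using \<open>(k, l) \<in> splits m\<close> that True by (auto simp: splits_def)
          then have "mcoeff (msubst (M t) (mpartial j h)) k = 0"
            unfolding mcoeff_msubst mcoeff_mpartial
            using \<open>\<And>k. mdeg k = mdeg m \<Longrightarrow> mcoeff h k = 0\<close> by (intro sum.neutral) auto
          then show ?thesis by simp
        next
          case False
          then show ?thesis using homogeneous_linear_form[of "M' $ j"] by (simp add: homogeneous_def)
        qed
        then show ?thesis unfolding mcoeff_mult by (intro sum.neutral) auto
      qed
      then show ?thesis by (simp add: \<Psi>_def)
    qed
    define p where "p = (\<Sum>k | mdeg k = mdeg m. mconst (mcoeff h k) * mmono k)"
    have "mcoeff h k = mcoeff p k" if "mdeg k = mdeg m" for k
      using that by (simp add: p_def mcoeff_mmono if_distrib[of "(*) _"] finite_mdeg_eq sum.delta' cong: if_cong)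
    then have "mcoeff (\<Psi> (h - p)) m = 0" by (intro van) simp
    moreover have "\<Psi> h = \<Psi> p + \<Psi> (h - p)" by (simp flip: add)
    moreover have "mcoeff (\<Psi> p) m = (\<Sum>k | mdeg k = mdeg m. mcoeff h k * mcoeff (\<Psi> (mmono k)) m)"
      by (simp add: p_def sum cmult)
    ultimately show ?thesis by simp
  qed
  have "((\<lambda>s. \<Sum>k | mdeg k = mdeg m. mcoeff (H s) k * mcoeff (form_prod (M s) k) m) has_vector_derivative
    (\<Sum>k | mdeg k = mdeg m. mcoeff (H t) k * mcoeff (\<Psi> (mmono k)) m + mcoeff H' k * mcoeff (form_prod (M t) k) m)) (at t)"
    using H has_tderiv_form_prod[OF M'] unfolding has_tderiv_def \<Psi>_def
    by (intro has_vector_derivative_sum has_vector_derivative_mult) auto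
  then show "((\<lambda>s. mcoeff (msubst (M s) (H s)) m) has_vector_derivative
     mcoeff (msubst (M t) H' + (\<Sum>j\<in>UNIV. msubst (M t) (mpartial j (H t)) * linear_form (M' $ j))) m) (at t)"
    unfolding \<Psi>_def[symmetric] mcoeff_add \<Psi>_coeff[of "H t"]
    by (simp add: mcoeff_msubst sum.distrib add.commute)
qed

section \<open>Minors and formal first integrals\<close>

lemma nat_det_eq_det: "nat_det k M = Determinant.det (Matrix.mat k k (\<lambda>(a, b). M a b))"
proof -
  have "Determinant.det (Matrix.mat k k (\<lambda>(a, b). M a b))
     = (\<Sum>p | p permutes {0..<k}. of_int (sign p) * (\<Prod>i = 0..<k. Matrix.mat k k (\<lambda>(a, b). M a b) $$ (i, p i)))"
    by (rule det_def') simp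
  also have "\<dots> = nat_det k M"
    unfolding nat_det_def atLeast0LessThan
  proof (intro sum.cong refl arg_cong2[where f = "(*)"] prod.cong)
    fix p i assume "p \<in> {p. p permutes {..<k}}" "i \<in> {..<k}"
    then have "p i < k" "i < k" using permutes_in_image[of p "{..<k}" i] by auto
    then show "Matrix.mat k k (\<lambda>(a, b). M a b) $$ (i, p i) = M i (p i)" by simp
  qed
  finally show ?thesis by simp
qed

text \<open>Multiplication by the adjugate matrix avoids division, as is necessary over a ring of
  series.\<close>

lemma nat_det_annihilates_kernel:
  fixes M :: "nat \<Rightarrow> nat \<Rightarrow> 'a :: comm_ring_1"
  assumes ker: "\<And>a. a < k \<Longrightarrow> (\<Sum>b<k. M a b * z b) = 0" and b: "b < k"
  shows "nat_det k M * z b = 0"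
proof -
  define A where "A = Matrix.mat k k (\<lambda>(a, b). M a b)"
  define v where "v = Matrix.vec k z"
  have A: "A \<in> carrier_mat k k" and v: "v \<in> carrier_vec k" by (simp_all add: A_def v_def)
  have Av: "A *\<^sub>v v = 0\<^sub>v k"
  proof (rule eq_vecI)
    fix i assume "i < dim_vec (0\<^sub>v k :: 'a Matrix.vec)"
    then show "vec_index (A *\<^sub>v v) i = vec_index (0\<^sub>v k) i"
      using ker[of i] by (simp add: A_def v_def scalar_prod_def atLeast0LessThan)
  qed (simp add: A_def)
  have "Determinant.det A \<cdot>\<^sub>v v = (Determinant.det A \<cdot>\<^sub>m 1\<^sub>m k) *\<^sub>v v"
    using v by auto
  also have "\<dots> = (adj_mat A * A) *\<^sub>v v" by (simp add: adj_mat(3)[OF A])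
  also have "\<dots> = adj_mat A *\<^sub>v (A *\<^sub>v v)"
    by (rule assoc_mult_mat_vec[OF adj_mat(1)[OF A] A v])
  also have "\<dots> = 0\<^sub>v k" unfolding Av using adj_mat(1)[OF A] by auto
  finally have "vec_index (Determinant.det A \<cdot>\<^sub>v v) b = 0" using b by simp
  then show ?thesis using b by (simp add: nat_det_eq_det A_def v_def)
qed

lemma nat_det_0_left_kernel:
  fixes M :: "nat \<Rightarrow> nat \<Rightarrow> 'a :: field"
  assumes "nat_det k M = 0"
  obtains c where "\<exists>a<k. c a \<noteq> 0" "\<And>b. b < k \<Longrightarrow> (\<Sum>a<k. c a * M a b) = 0"
proof -
  define A where "A = Matrix.mat k k (\<lambda>(a, b). M a b)"
  have A: "transpose_mat A \<in> carrier_mat k k" "A \<in> carrier_mat k k" by (simp_all add: A_def)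
  have "Determinant.det (transpose_mat A) = 0"
    unfolding Determinant.det_transpose[OF A(2)] using assms unfolding nat_det_eq_det A_def .
  then obtain v where v: "v \<in> carrier_vec k" "v \<noteq> 0\<^sub>v k" "transpose_mat A *\<^sub>v v = 0\<^sub>v k"
    using det_0_iff_vec_prod_zero_field[OF A(1)] by blast
  show ?thesis
  proof (rule that)
    show "\<exists>a<k. vec_index v a \<noteq> 0"
    proof (rule ccontr)
      assume "\<not> ?thesis"
      then have "v = 0\<^sub>v k" using v(1) by (intro eq_vecI) auto
      then show False using v(2) by simp
    qed
    fix b assume b: "b < k"
    have "vec_index (transpose_mat A *\<^sub>v v) b = 0" using v(3) b by simp
    then show "(\<Sum>a<k. vec_index v a * M a b) = 0"
      using b v(1) by (simp add: A_def scalar_prod_def atLeast0LessThan mult.commute)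
  qed
qed

text \<open>The nonzero minor leaves out one coordinate \<open>q\<close>, and a kernel vector with
  entry 0 at \<open>q\<close> is 0. This is applied to the combination of \<open>Z\<close> and
  \<open>Z'\<close> with coefficients \<open>Z' q\<close> and \<open>Z q\<close> whose entry at
  \<open>q\<close> cancels; cancellation replaces division in the field of fractions.\<close>

lemma rank_of_minor:
  fixes P :: "nat \<Rightarrow> 'n :: finite \<Rightarrow> 'a :: idom"
  assumes s: "inj_on s {..<CARD('n) - 1}" and det: "nat_det (CARD('n) - 1) (\<lambda>a b. P a (s b)) \<noteq> 0"
    and Z: "\<And>a. a < CARD('n) - 1 \<Longrightarrow> (\<Sum>i\<in>UNIV. Z i * P a i) = 0"
    and Z': "\<And>a. a < CARD('n) - 1 \<Longrightarrow> (\<Sum>i\<in>UNIV. Z' i * P a i) = 0"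
  shows "Z i * Z' j = Z j * Z' i"
proof -
  define k where "k = CARD('n) - 1"
  have "card (UNIV - s ` {..<k}) = 1"
  proof -
    have "card (s ` {..<k}) = k" using s by (simp add: card_image k_def)
    moreover have "CARD('n) - k = 1" using zero_less_card_finite[where 'a = 'n] unfolding k_def by linarith
    ultimately show ?thesis by (simp add: card_Diff_subset)
  qed
  then obtain q where q: "UNIV - s ` {..<k} = {q}" by (rule card_1_singletonE)
  have vanish: "X i = 0" if X: "\<And>a. a < k \<Longrightarrow> (\<Sum>i\<in>UNIV. X i * P a i) = 0" and "X q = 0" for X i
  proof (cases "i = q")
    case False
    then obtain b where b: "b < k" "i = s b" using q by blast
    have "(\<Sum>c<k. P a (s c) * X (s c)) = 0" if "a < k" for a
    proof -
      have "(\<Sum>i\<in>UNIV. X i * P a i) = (\<Sum>i\<in>s ` {..<k}. X i * P a i)"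
        using q \<open>X q = 0\<close> by (intro sum.mono_neutral_right) auto
      also have "\<dots> = (\<Sum>c<k. P a (s c) * X (s c))"
        using s by (subst sum.reindex) (simp_all add: k_def mult.commute)
      finally show ?thesis using X[OF that] by simp
    qed
    then have "nat_det k (\<lambda>a b. P a (s b)) * X (s b) = 0"
      by (intro nat_det_annihilates_kernel b(1)) auto
    then show ?thesis using det b(2) by (simp add: k_def)
  qed (use that in simp)
  have cross: "Z q * Z' i = Z' q * Z i" for i
  proof -
    have "Z q * Z' i - Z' q * Z i = 0"
    proof (rule vanish)
      fix a assume a: "a < k"
      have "(\<Sum>i\<in>UNIV. (Z q * Z' i - Z' q * Z i) * P a i)
        = Z q * (\<Sum>i\<in>UNIV. Z' i * P a i) - Z' q * (\<Sum>i\<in>UNIV. Z i * P a i)"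
        by (simp add: left_diff_distrib sum_subtractf sum_distrib_left mult.assoc)
      then show "(\<Sum>i\<in>UNIV. (Z q * Z' i - Z' q * Z i) * P a i) = 0"
        using Z[of a] Z'[of a] a by (simp add: k_def)
    qed simp
    then show ?thesis by simp
  qed
  consider "Z q \<noteq> 0" | "Z' q \<noteq> 0" | "Z q = 0" "Z' q = 0" by blast
  then show ?thesis
  proof cases
    case 1
    have e: "Z q * (Z i * Z' j) = Z i * (Z' q * Z j)" "Z q * (Z j * Z' i) = Z j * (Z' q * Z i)"
      by (subst cross[symmetric], simp add: mult_ac)+
    have "Z q * (Z i * Z' j) = Z q * (Z j * Z' i)" unfolding e by (simp only: mult_ac)
    then show ?thesis using 1 by simp
  next
    case 2
    have e: "Z' q * (Z i * Z' j) = Z' j * (Z q * Z' i)" "Z' q * (Z j * Z' i) = Z' i * (Z q * Z' j)"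
      by (subst cross, simp add: mult_ac)+
    have "Z' q * (Z i * Z' j) = Z' q * (Z j * Z' i)" unfolding e by (simp only: mult_ac)
    then show ?thesis using 2 by simp
  next
    case 3
    have "Z i = 0" for i using vanish[of Z i] Z 3 by (simp add: k_def)
    then show ?thesis by simp
  qed
qed

text \<open>In the coordinate X = Q(t) Y the integral becomes K(X,t) = H(R(t) X, t). As R' = A R - R
  J, the term A Y of the reduced system drops out and <\<partial>_X K, J X + g> = - \<partial>_t K
  remains.\<close>

lemma exponent_formal_case:
  fixes f :: "real ^ 'n :: finite \<Rightarrow> real ^ 'n" and H :: "nat \<Rightarrow> real \<Rightarrow> (complex, 'n) mfps"
  assumes op: "open \<Omega>" and f: "\<And>i. real_analytic_on (\<lambda>x. f x $ i) \<Omega>"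
    and orbit: "periodic_orbit \<Omega> f \<phi> T" and red: "floquet_reduction f \<phi> T Q A"
    and eig: "det (mat z - A) = 0"
    and H: "\<And>a. a < CARD('n) - 1 \<Longrightarrow> formal_first_integral f \<phi> T Q A (H a)"
    and ind: "formally_independent (CARD('n) - 1) H"
  shows "\<exists>q. z * of_real T = of_rat q * (2 * of_real pi * \<i>)"
proof -
  define R where "R t = matrix_inv (Q t)" for t
  define J where "J t = cmat (jacobian f (\<phi> t))" for t
  define K where "K a t = msubst (R t) (H a t)" for a t
  have inv: "\<And>t. invertible (Q t)" and Qper: "\<And>t. Q (t + T) = Q t"
    using red by (auto simp: floquet_reduction_def)
  have QR: "Q t ** R t = mat 1" "R t ** Q t = mat 1" for t
    by (simp_all add: R_def matrix_inv_inverse inv)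
  have \<phi>\<Omega>: "\<phi> t \<in> \<Omega>" for t using orbit by (auto simp: periodic_orbit_def)
  have R': "((\<lambda>s. R s $ i $ j) has_vector_derivative (A ** R t - R t ** J t) $ i $ j) (at t)" for i j t
    unfolding R_def J_def by (rule floquet_inverse_derivative[OF red])
  have Hper: "H a (t + T) = H a t" and H_tderiv: "has_tderiv (H a) (tderiv (H a) t) t"
    and H_eq: "tderiv (H a) t + (\<Sum>i\<in>UNIV. mpartial i (H a t) * (linear_form (A $ i) + F_series f \<phi> Q t i)) = 0"
    and K_eq: "tderiv (K a) t = (\<Sum>i\<in>UNIV. mpartial i (K a t) * mconst (complex_of_real (f (\<phi> t) $ i)))"
    if "a < CARD('n) - 1" for a t
    using H[OF that] unfolding formal_first_integral_def formal_first_integral_reduced_def time_independent_def Let_def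
      has_tderiv_def tderiv_def mcoeff_Abs vector_derivative_works[symmetric] K_def R_def by auto
  have K_tderiv: "has_tderiv (K a) (msubst (R t) (tderiv (H a) t) +
      (\<Sum>j\<in>UNIV. msubst (R t) (mpartial j (H a t)) * linear_form ((A ** R t - R t ** J t) $ j))) t"
    if "a < CARD('n) - 1" for a t
    unfolding K_def by (rule has_tderiv_msubst[OF R' H_tderiv[OF that]])
  have partial_K: "mpartial p (K a t) = (\<Sum>j\<in>UNIV. mconst (R t $ j $ p) * msubst (R t) (mpartial j (H a t)))" for p a t
    unfolding K_def by (rule mpartial_msubst)
  have lf_add: "linear_form (u + v) = linear_form u + linear_form v"
    and lf_diff: "linear_form (u - v) = linear_form u - linear_form v" for u v :: "complex ^ 'n"
    by (simp_all add: linear_form_eq mconst_add mconst_diff ring_distribs sum.distrib sum_subtractf)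
  have RJ: "(\<Sum>p\<in>UNIV. mconst (R t $ j $ p) * linear_form (J t $ p)) = linear_form ((R t ** J t) $ j)" for j t
    using msubst_linear_form[of "J t" "R t $ j"]
    by (simp add: linear_form_eq[of "R t $ j"] msubst_sum msubst_cmult msubst_mvar vector_matrix_mult_def
        matrix_matrix_mult_def linear_form_eq[of "vec_lambda _"])
  obtain s t0 where s: "inj_on s {..<CARD('n) - 1}" "nat_det (CARD('n) - 1) (\<lambda>a b. mpartial (s b) (H a t0)) \<noteq> 0"
    using ind by (auto simp: formally_independent_def)
  show ?thesis
  proof (rule exponent_of_integrable_orbit[OF op f orbit red eig, where K = K and S = "{..<CARD('n) - 1}" and ?t0.0 = t0])
    fix a m t assume "a \<in> {..<CARD('n) - 1}"
    then have a: "a < CARD('n) - 1" by simp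
    show "((\<lambda>s. mcoeff (K a s) m) has_vector_derivative
       mcoeff (\<Sum>i\<in>UNIV. mpartial i (K a t) * mconst (complex_of_real (f (\<phi> t) $ i))) m) (at t)"
      using K_tderiv[OF a, of t] has_tderiv_tderiv[OF K_tderiv[OF a, of t]] K_eq[OF a, of t]
      by (simp add: has_tderiv_def)
    show "K a (t0 + T) = K a t0" by (simp add: K_def R_def Qper Hper[OF a])
    define g where "g p = g_series f \<phi> t p" for p
    define h where "h j = msubst (R t) (mpartial j (H a t))" for j
    have taylor: "taylor (\<lambda>x. f x $ p) (\<phi> t) = mconst (complex_of_real (f (\<phi> t) $ p)) + (linear_form (J t $ p) + g p)" for p
    proof (rule mfps_eqI)
      fix m :: "nat ^ 'n"
      consider "mdeg m = 0" | "mdeg m = 1" | "mdeg m > 1" by linarith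
      then show "mcoeff (taylor (\<lambda>x. f x $ p) (\<phi> t)) m =
         mcoeff (mconst (complex_of_real (f (\<phi> t) $ p)) + (linear_form (J t $ p) + g p)) m"
      proof cases
        case 1
        then show ?thesis
          by (simp add: taylor_const_coeff[OF f \<phi>\<Omega>] mcoeff_mconst mcoeff_linear_form g_def g_series_def drop_affine_def)
      next
        case 2
        then obtain j where "m = axis j 1" by (rule mdeg_eq_1_cases)
        then show ?thesis
          by (simp add: taylor_linear_coeff[OF f \<phi>\<Omega>] mcoeff_mconst J_def g_def g_series_def drop_affine_def)
      next
        case 3
        then have "m \<noteq> 0" "\<And>j. m \<noteq> axis j 1" by auto
        then show ?thesis using 3 by (simp add: mcoeff_mconst mcoeff_linear_form g_def g_series_def drop_affine_def)
      qed
    qed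
    have F: "msubst (R t) (F_series f \<phi> Q t j) = (\<Sum>p\<in>UNIV. mconst (R t $ j $ p) * g p)" for j
      by (simp add: F_series_def msubst_sum msubst_cmult msubst_inverse[OF QR(1)] g_def flip: R_def)
    have "msubst (R t) (tderiv (H a) t) = - (\<Sum>j\<in>UNIV. h j * (linear_form ((A ** R t) $ j) + (\<Sum>p\<in>UNIV. mconst (R t $ j $ p) * g p)))"
    proof -
      have "msubst (R t) (tderiv (H a) t) + msubst (R t) (\<Sum>i\<in>UNIV. mpartial i (H a t) * (linear_form (A $ i) + F_series f \<phi> Q t i)) = 0"
        using arg_cong[OF H_eq[OF a, of t], of "msubst (R t)"] by (simp add: msubst_add)
      moreover have "(A $ j) v* R t = (A ** R t) $ j" for j
        by (simp add: vector_matrix_mult_def matrix_matrix_mult_def vec_eq_iff)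
      ultimately show ?thesis
        by (simp add: msubst_sum msubst_mult msubst_add msubst_linear_form F h_def eq_neg_iff_add_eq_0)
    qed
    then have "tderiv (K a) t = (\<Sum>j\<in>UNIV. h j * linear_form ((A ** R t - R t ** J t) $ j))
        - (\<Sum>j\<in>UNIV. h j * (linear_form ((A ** R t) $ j) + (\<Sum>p\<in>UNIV. mconst (R t $ j $ p) * g p)))"
      using has_tderiv_tderiv[OF K_tderiv[OF a, of t]] by (simp add: h_def)
    also have "\<dots> = - (\<Sum>j\<in>UNIV. h j * (linear_form ((R t ** J t) $ j) + (\<Sum>p\<in>UNIV. mconst (R t $ j $ p) * g p)))"
      by (simp add: lf_diff ring_distribs sum_subtractf sum.distrib)
    also have "\<dots> = - (\<Sum>j\<in>UNIV. h j * (\<Sum>p\<in>UNIV. mconst (R t $ j $ p) * (linear_form (J t $ p) + g p)))"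
      by (simp add: RJ[symmetric] distrib_left sum.distrib)
    also have "\<dots> = - (\<Sum>p\<in>UNIV. mpartial p (K a t) * (linear_form (J t $ p) + g p))"
      unfolding partial_K h_def[symmetric] sum_distrib_left sum_distrib_right
      by (subst sum.swap) (simp only: mult_ac)
    finally have "(\<Sum>p\<in>UNIV. mpartial p (K a t) * (linear_form (J t $ p) + g p)) = - tderiv (K a) t" by simp
    \<comment> \<open>The constant part of the Taylor series contributes
      \<open>tderiv (K a) t\<close>, by time independence, and cancels the rest.\<close>
    then show "(\<Sum>i\<in>UNIV. mpartial i (K a t) * taylor (\<lambda>x. f x $ i) (\<phi> t)) = 0"
      unfolding taylor by (subst distrib_left) (simp add: sum.distrib K_eq[OF a, of t])
  next
    fix Z Z' :: "'n \<Rightarrow> (complex, 'n) mfps" and i j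
    assume Z: "\<And>a. a \<in> {..<CARD('n) - 1} \<Longrightarrow> (\<Sum>i\<in>UNIV. Z i * mpartial i (K a t0)) = 0"
      and Z': "\<And>a. a \<in> {..<CARD('n) - 1} \<Longrightarrow> (\<Sum>i\<in>UNIV. Z' i * mpartial i (K a t0)) = 0"
    \<comment> \<open>The components of the field \<open>Z\<close> in the coordinate Y; after
      substitution of Q(t0) Y they annihilate the series \<open>H a t0\<close>, for which the
      nonzero minor is given.\<close>
    define X where "X Z j = (\<Sum>p\<in>UNIV. mconst (R t0 $ j $ p) * Z p)" for Z :: "'n \<Rightarrow> (complex, 'n) mfps" and j
    have kernel: "(\<Sum>j\<in>UNIV. msubst (Q t0) (X Z j) * mpartial j (H a t0)) = 0"
      if "(\<Sum>i\<in>UNIV. Z i * mpartial i (K a t0)) = 0" for Z a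
    proof -
      have "(\<Sum>i\<in>UNIV. Z i * mpartial i (K a t0)) = (\<Sum>j\<in>UNIV. X Z j * msubst (R t0) (mpartial j (H a t0)))"
        unfolding partial_K X_def sum_distrib_left sum_distrib_right
        by (subst sum.swap) (simp only: mult_ac)
      then have "msubst (Q t0) (\<Sum>j\<in>UNIV. X Z j * msubst (R t0) (mpartial j (H a t0))) = 0" using that by simp
      then show ?thesis by (simp add: msubst_sum msubst_mult msubst_inverse[OF QR(2)])
    qed
    have "msubst (Q t0) (X Z i) * msubst (Q t0) (X Z' j) = msubst (Q t0) (X Z j) * msubst (Q t0) (X Z' i)" for i j
      by (rule rank_of_minor[OF s, where Z = "\<lambda>i. msubst (Q t0) (X Z i)" and Z' = "\<lambda>i. msubst (Q t0) (X Z' i)"])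
        (use Z Z' kernel in auto)
    then have "msubst (R t0) (msubst (Q t0) (X Z i * X Z' j)) = msubst (R t0) (msubst (Q t0) (X Z j * X Z' i))" for i j
      by (simp only: msubst_mult)
    then have XX: "X Z i * X Z' j = X Z j * X Z' i" for i j
      by (simp only: msubst_inverse[OF QR(1)])
    have recover: "Z p = (\<Sum>j\<in>UNIV. mconst (Q t0 $ p $ j) * X Z j)" for Z p
    proof -
      have "(\<Sum>j\<in>UNIV. mconst (Q t0 $ p $ j) * X Z j) = (\<Sum>r\<in>UNIV. mconst ((Q t0 ** R t0) $ p $ r) * Z r)"
        unfolding X_def sum_distrib_left
        by (subst sum.swap) (simp add: matrix_matrix_mult_def mconst_sum mconst_mult sum_distrib_right mult.assoc)
      also have "\<dots> = Z p" unfolding QR by (simp add: mat_def if_distrib[of mconst] if_distrib[of "\<lambda>x. x * _"] cong: if_cong)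
      finally show ?thesis by simp
    qed
    have "Z i * Z' j = (\<Sum>p\<in>UNIV. \<Sum>r\<in>UNIV. (mconst (Q t0 $ i $ p) * mconst (Q t0 $ j $ r)) * (X Z p * X Z' r))"
      by (subst recover[of Z i], subst recover[of Z' j], subst sum_product) (simp only: mult_ac)
    also have "\<dots> = (\<Sum>p\<in>UNIV. \<Sum>r\<in>UNIV. (mconst (Q t0 $ i $ p) * mconst (Q t0 $ j $ r)) * (X Z r * X Z' p))"
      by (subst XX) (rule refl)
    also have "\<dots> = Z j * Z' i"
      by (subst recover[of Z j], subst recover[of Z' i], subst sum_product, subst sum.swap) (simp only: mult_ac)
    finally show "Z i * Z' j = Z j * Z' i" .
  qed
qed

section \<open>Analytic first integrals\<close>

lemma grad_continuous:
  assumes "real_analytic_on h S" shows "continuous_on S (\<lambda>x. grad h x $ i)"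
  by (rule continuous_at_imp_continuous_on)
    (blast intro: has_derivative_continuous analytic_derivative[OF analytic_grad[OF assms]])

text \<open>Continuous gradients are bounded on a closed ball, and the ball is convex, so the mean
  value inequality applies to each component.\<close>

lemma analytic_lipschitz_on_ball:
  fixes f :: "real ^ 'n :: finite \<Rightarrow> real ^ 'n"
  assumes f: "\<And>i. real_analytic_on (\<lambda>x. f x $ i) \<Omega>" and sub: "cball x0 r \<subseteq> \<Omega>"
  shows "\<exists>L. \<forall>x\<in>cball x0 r. \<forall>y\<in>cball x0 r. norm (f x - f y) \<le> L * norm (x - y)"
proof -
  have "\<exists>B. \<forall>x\<in>cball x0 r. \<bar>grad (\<lambda>x. f x $ i) x $ j\<bar> \<le> B" for i j
  proof -
    have "continuous_on (cball x0 r) (\<lambda>x. grad (\<lambda>x. f x $ i) x $ j)"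
      using grad_continuous[OF f] sub by (rule continuous_on_subset)
    then have "bounded ((\<lambda>x. grad (\<lambda>x. f x $ i) x $ j) ` cball x0 r)"
      by (intro compact_imp_bounded compact_continuous_image) auto
    then show ?thesis by (auto simp: bounded_iff)
  qed
  then obtain B where B: "\<And>i j x. x \<in> cball x0 r \<Longrightarrow> \<bar>grad (\<lambda>x. f x $ i) x $ j\<bar> \<le> B i j" by metis
  show ?thesis
  proof (intro exI[of _ "\<Sum>i\<in>UNIV. \<Sum>j\<in>UNIV. B i j"] ballI)
    fix x y assume x: "x \<in> cball x0 r" and y: "y \<in> cball x0 r"
    have comp: "norm (f x $ i - f y $ i) \<le> (\<Sum>j\<in>UNIV. B i j) * norm (x - y)" for i
    proof (rule differentiable_bound[where S = "cball x0 r" and f' = "\<lambda>x v. \<Sum>j\<in>UNIV. v $ j * grad (\<lambda>x. f x $ i) x $ j"])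
      fix z assume z: "z \<in> cball x0 r"
      show "((\<lambda>x. f x $ i) has_derivative (\<lambda>v. \<Sum>j\<in>UNIV. v $ j * grad (\<lambda>x. f x $ i) z $ j)) (at z within cball x0 r)"
        using analytic_derivative[OF f subsetD[OF sub z]] by (rule has_derivative_at_withinI)
      show "onorm (\<lambda>v. \<Sum>j\<in>UNIV. v $ j * grad (\<lambda>x. f x $ i) z $ j) \<le> (\<Sum>j\<in>UNIV. B i j)"
      proof (rule onorm_le)
        fix v :: "real ^ 'n"
        have "norm (\<Sum>j\<in>UNIV. v $ j * grad (\<lambda>x. f x $ i) z $ j) \<le> (\<Sum>j\<in>UNIV. norm v * B i j)"
        proof (rule sum_norm_le)
          fix j
          show "norm (v $ j * grad (\<lambda>x. f x $ i) z $ j) \<le> norm v * B i j"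
            unfolding norm_mult using B[OF z] by (intro mult_mono) (auto simp: component_le_norm_cart)
        qed
        then show "norm (\<Sum>j\<in>UNIV. v $ j * grad (\<lambda>x. f x $ i) z $ j) \<le> (\<Sum>j\<in>UNIV. B i j) * norm v"
          by (simp add: sum_distrib_left mult.commute)
      qed
    qed (use x y in auto)
    have "norm (f x - f y) \<le> (\<Sum>i\<in>UNIV. \<bar>(f x - f y) $ i\<bar>)" by (rule norm_le_l1_cart)
    also have "\<dots> \<le> (\<Sum>i\<in>UNIV. (\<Sum>j\<in>UNIV. B i j) * norm (x - y))"
      using comp by (intro sum_mono) simp
    finally show "norm (f x - f y) \<le> (\<Sum>i\<in>UNIV. \<Sum>j\<in>UNIV. B i j) * norm (x - y)"
      by (simp add: sum_distrib_right)
  qed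
qed

text \<open>Composing \<open>f\<close> with the closest-point map onto a ball makes it globally
  Lipschitz. For a short time the solution stays in the ball, where this map is the
  identity.\<close>

lemma local_solution:
  fixes f :: "real ^ 'n :: finite \<Rightarrow> real ^ 'n"
  assumes f: "\<And>i. real_analytic_on (\<lambda>x. f x $ i) \<Omega>" and D: "open D" "D \<subseteq> \<Omega>" "x0 \<in> D"
  shows "\<exists>x \<delta>. 0 < \<delta> \<and> x 0 = x0 \<and> continuous_on {0..\<delta>} x \<and> x ` {0..\<delta>} \<subseteq> D \<and>
    (\<forall>t\<in>{0<..<\<delta>}. (x has_vector_derivative f (x t)) (at t))"
proof -
  obtain r where r: "r > 0" "cball x0 r \<subseteq> D" using D open_contains_cball by blast
  define C where "C = cball x0 r"
  have C: "convex C" "closed C" "C \<noteq> {}" using r(1) by (auto simp: C_def)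
  obtain L where L: "\<And>x y. x \<in> C \<Longrightarrow> y \<in> C \<Longrightarrow> norm (f x - f y) \<le> L * norm (x - y)"
    using analytic_lipschitz_on_ball[OF f, of x0 r] r(2) D(2) unfolding C_def by blast
  define p where "p = closest_point C"
  have pC: "p x \<in> C" for x unfolding p_def by (rule closest_point_in_set[OF C(2,3)])
  have lip: "norm (f (p x) - f (p y)) \<le> \<bar>L\<bar> * norm (x - y)" for x y
  proof -
    have "norm (f (p x) - f (p y)) \<le> L * norm (p x - p y)" by (rule L[OF pC pC])
    also have "\<dots> \<le> \<bar>L\<bar> * norm (x - y)"
      using closest_point_lipschitz[OF C, of x y] by (intro mult_mono) (auto simp: p_def dist_norm)
    finally show ?thesis .
  qed
  have cont: "continuous_on UNIV (\<lambda>x. f (p x))"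
  proof -
    have "\<bar>L\<bar>-lipschitz_on UNIV (\<lambda>x. f (p x))"
      using lip by (intro lipschitz_onI) (auto simp: dist_norm)
    then show ?thesis by (rule lipschitz_on_continuous_on)
  qed
  have "\<exists>u. u 0 = x0 \<and> (\<forall>t\<in>{0..1}. (u has_vector_derivative f (p (u t))) (at t within {0..1}))"
    by (rule picard_lindelof[where f = "\<lambda>t x. f (p x)" and L = "\<bar>L\<bar>"])
      (use lip in \<open>auto intro: continuous_on_compose2[OF cont]\<close>)
  then obtain u where u: "u 0 = x0" "\<And>t. t \<in> {0..1} \<Longrightarrow> (u has_vector_derivative f (p (u t))) (at t within {0..1})"
    by blast
  have u_cont: "continuous_on {0..1} u"
    unfolding continuous_on_eq_continuous_within
    by (intro ballI has_vector_derivative_continuous[OF u(2)])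
  then obtain d where d: "d > 0" "\<And>t. t \<in> {0..1} \<Longrightarrow> dist t 0 < d \<Longrightarrow> dist (u t) (u 0) < r"
    unfolding continuous_on_iff using r(1) by (metis atLeastAtMost_iff order_refl zero_le_one)
  define \<delta> where "\<delta> = min 1 (d / 2)"
  have \<delta>: "0 < \<delta>" "\<delta> \<le> 1" "\<delta> < d" using d(1) by (auto simp: \<delta>_def)
  have uC: "u t \<in> C" if "t \<in> {0..\<delta>}" for t
    using d(2)[of t] that \<delta> u(1) by (auto simp: C_def dist_norm norm_minus_commute less_imp_le)
  show ?thesis
  proof (intro exI[of _ u] exI[of _ \<delta>] conjI ballI)
    show "continuous_on {0..\<delta>} u" using u_cont \<delta> by (auto elim: continuous_on_subset)
    show "u ` {0..\<delta>} \<subseteq> D" using uC r(2) by (auto simp: C_def)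
    fix t assume t: "t \<in> {0<..<\<delta>}"
    then have "(u has_vector_derivative f (p (u t))) (at t)"
      using u(2)[of t] \<delta> by (simp add: at_within_Icc_at)
    moreover have "p (u t) = u t" unfolding p_def using uC[of t] t by (intro closest_point_self) auto
    ultimately show "(u has_vector_derivative f (u t)) (at t)" by simp
  qed (use \<delta> u in auto)
qed

text \<open>Constancy is assumed over open time intervals, so a solution issuing from
  \<open>x0\<close> is differentiated at positive times and the identity reaches \<open>x0\<close>
  by continuity.\<close>

lemma first_integral_grad:
  fixes f :: "real ^ 'n :: finite \<Rightarrow> real ^ 'n"
  assumes f: "\<And>i. real_analytic_on (\<lambda>x. f x $ i) \<Omega>" and D: "open D" "D \<subseteq> \<Omega>" "x0 \<in> D"
    and H: "real_analytic_on H D" "first_integral f D H"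
  shows "(\<Sum>i\<in>UNIV. grad H x0 $ i * f x0 $ i) = 0"
proof -
  obtain x \<delta> where x: "0 < \<delta>" "x 0 = x0" "continuous_on {0..\<delta>} x" "x ` {0..\<delta>} \<subseteq> D"
    "\<And>t. t \<in> {0<..<\<delta>} \<Longrightarrow> (x has_vector_derivative f (x t)) (at t)"
    using local_solution[OF f D] by blast
  define g where "g y = (\<Sum>i\<in>UNIV. grad H y $ i * f y $ i)" for y
  have f_cont: "continuous_on D (\<lambda>y. f y $ i)" for i
    by (rule continuous_at_imp_continuous_on) (use D(2) in \<open>blast intro: has_derivative_continuous analytic_derivative[OF f]\<close>)
  have "continuous_on D g" unfolding g_def by (intro continuous_intros grad_continuous[OF H(1)] f_cont)
  then have cont: "continuous_on {0..\<delta>} (\<lambda>t. g (x t))"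
    using x(3,4) by (rule continuous_on_compose2)
  have "\<forall>t\<in>{0<..<\<delta>}. x t \<in> D \<and> (x has_vector_derivative f (x t)) (at t)" using x(4,5) by auto
  then have "(\<lambda>t. H (x t)) constant_on {0<..<\<delta>}"
    using H(2) unfolding first_integral_def by (metis (no_types, lifting) is_interval_oo open_greaterThanLessThan)
  then obtain c where c: "\<And>t. t \<in> {0<..<\<delta>} \<Longrightarrow> H (x t) = c" by (auto simp: constant_on_def)
  have zero: "g (x t) = 0" if t: "t \<in> {0<..<\<delta>}" for t
  proof -
    have "x t \<in> D" using x(4) t by auto
    from has_derivative_at_withinI[OF analytic_derivative[OF H(1) this]]
    have "(H has_derivative (\<lambda>v. \<Sum>i\<in>UNIV. v $ i * grad H (x t) $ i)) (at (x t) within range x)" .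
    from vector_derivative_diff_chain_within[OF x(5)[OF t] this]
    have "((\<lambda>s. H (x s)) has_vector_derivative g (x t)) (at t)" by (simp add: o_def g_def mult.commute)
    moreover have "((\<lambda>s. H (x s)) has_vector_derivative 0) (at t)"
      by (rule has_vector_derivative_transform_within_open[where f = "\<lambda>_. c" and S = "{0<..<\<delta>}"])
        (use c t in auto)
    ultimately show ?thesis by (rule vector_derivative_unique_at)
  qed
  have "closure {0<..<\<delta>} = {0..\<delta>}" using x(1) by simp
  then have "g (x 0) = 0"
    using continuous_constant_on_closure[of "{0<..<\<delta>}" "\<lambda>t. g (x t)" 0 0] cont zero x(1) by simp
  then show ?thesis by (simp add: x(2) g_def)
qed

text \<open>If the unit vector of \<open>q\<close> lies outside the span, deleting the coordinate
  \<open>q\<close> is injective on the span. The remaining columns then form a nonsingular matrix in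
  whatever order \<open>s\<close> lists them.\<close>

lemma independent_vectors_minor:
  fixes v :: "nat \<Rightarrow> real ^ 'n :: finite"
  assumes dim: "dim (v ` {..<CARD('n) - 1}) = CARD('n) - 1"
  shows "\<exists>q. \<forall>s. bij_betw s {..<CARD('n) - 1} (UNIV - {q}) \<longrightarrow> nat_det (CARD('n) - 1) (\<lambda>a b. v a $ s b) \<noteq> 0"
proof -
  define k where "k = CARD('n) - 1"
  have k: "k < CARD('n)" using zero_less_card_finite[where 'a = 'n] unfolding k_def by linarith
  have card_le: "card (v ` {..<k}) \<le> k" using card_image_le[of "{..<k}" v] by simp
  have indep: "independent (v ` {..<k})"
    using card_le_dim_spanning[of "v ` {..<k}" "v ` {..<k}"] dim card_le by (simp add: k_def span_superset)
  have "card (v ` {..<k}) = k" using dim_eq_card_independent[OF indep] dim by (simp add: k_def)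
  then have inj: "inj_on v {..<k}" by (intro eq_card_imp_inj_on) auto
  obtain q where q: "axis q 1 \<notin> span (v ` {..<k})"
  proof (rule ccontr)
    assume "\<not> thesis"
    then have "axis i 1 \<in> span (v ` {..<k})" for i using that by blast
    then have "(Basis :: (real ^ 'n) set) \<subseteq> span (v ` {..<k})" by (auto simp: Basis_vec_def)
    from span_minimal[OF this subspace_span] have "span (v ` {..<k}) = UNIV" by auto
    then have "dim (v ` {..<k}) = CARD('n)" using dim_span[of "v ` {..<k}"] by simp
    then show False using dim k by (simp add: k_def)
  qed
  show ?thesis
  proof (intro exI[of _ q] allI impI notI)
    fix s assume s: "bij_betw s {..<CARD('n) - 1} (UNIV - {q})"
      and nd: "nat_det (CARD('n) - 1) (\<lambda>a b. v a $ s b) = 0"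
    obtain c where c: "\<exists>a<k. c a \<noteq> 0" "\<And>b. b < k \<Longrightarrow> (\<Sum>a<k. c a * v a $ s b) = 0"
      using nat_det_0_left_kernel[OF nd] unfolding k_def by blast
    define w where "w = (\<Sum>a<k. c a *\<^sub>R v a)"
    have w_span: "w \<in> span (v ` {..<k})" unfolding w_def by (intro span_sum span_scale span_base) auto
    have "w $ i = 0" if i: "i \<noteq> q" for i
    proof -
      have "i \<in> s ` {..<k}" using s i unfolding bij_betw_def k_def by simp
      then show ?thesis using c(2) by (auto simp: w_def)
    qed
    then have w: "(w $ q) *\<^sub>R axis q 1 = w" by (auto simp: vec_eq_iff axis_def)
    have "w $ q = 0"
    proof (rule ccontr)
      assume "w $ q \<noteq> 0"
      then have "axis q 1 = (1 / (w $ q)) *\<^sub>R ((w $ q) *\<^sub>R axis q 1)" by simp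
      also have "\<dots> \<in> span (v ` {..<k})" unfolding w by (intro span_scale w_span)
      finally show False using q by simp
    qed
    then have "w = 0" by (subst w[symmetric]) simp
    then have "(\<Sum>y\<in>v ` {..<k}. c (the_inv_into {..<k} v y) *\<^sub>R y) = 0"
      unfolding w_def by (subst sum.reindex[OF inj]) (simp add: the_inv_into_f_f[OF inj])
    then have "c a = 0" if "a < k" for a
      using independentD[OF indep _ subset_refl, of "\<lambda>y. c (the_inv_into {..<k} v y)" "v a"] that
      by (simp add: the_inv_into_f_f[OF inj])
    then show False using c(1) by blast
  qed
qed

section \<open>Minors of gradients as power series\<close>

lemma nat_det_complexify: "complexify (nat_det k M) = nat_det k (\<lambda>a b. complexify (M a b))"
  by (simp add: nat_det_def complexify_sum complexify_mult complexify_prod complexify_of_int)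

lemma mconst_of_int: "mconst (of_int z) = of_int z"
proof -
  have "mconst (of_nat n) = of_nat n" for n :: nat by (induction n) (simp_all add: mconst_add)
  then show ?thesis by (cases z) (simp_all add: mconst_uminus del: of_nat_Suc)
qed

lemma PS_nat_det:
  assumes "\<And>a b. a < k \<Longrightarrow> b < k \<Longrightarrow> PS (h a b) x (M a b)"
  shows "PS (\<lambda>y. nat_det k (\<lambda>a b. h a b y)) x (nat_det k M)"
  unfolding nat_det_def
proof (rule PS_sum, rule PS_mult)
  fix p :: "nat \<Rightarrow> nat" assume p: "p \<in> {p. p permutes {..<k}}"
  show "PS (\<lambda>y. of_int (sign p)) x (of_int (sign p))"
    using PS_const[of "of_int (sign p)" x] by (simp add: mconst_of_int)
  show "PS (\<lambda>y. \<Prod>a<k. h a (p a) y) x (\<Prod>a<k. M a (p a))"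
  proof (rule PS_prod)
    fix a assume a: "a \<in> {..<k}"
    then have "p a < k" using permutes_in_image[of p "{..<k}" a] p by auto
    then show "PS (h a (p a)) x (M a (p a))" using a assms by simp
  qed
qed

lemma PS_zero: assumes "PS h a 0" shows "\<exists>U. open U \<and> a \<in> U \<and> (\<forall>x\<in>U. h x = 0)"
proof -
  obtain r where r: "r > 0" "\<And>x. x \<in> box_at a r \<Longrightarrow> ((\<lambda>k. mcoeff 0 k * monom_at k (x - a)) has_sum h x) UNIV"
    using assms by (auto simp: PS_iff)
  have "h x = 0" if "x \<in> box_at a r" for x
    using has_sum_unique[OF r(2)[OF that] has_sum_0] by simp
  then show ?thesis using r(1) by (intro exI[of _ "box_at a r"]) (simp add: open_box_at)
qed

text \<open>The gradients may be dependent all along the orbit, so the rank is tested on power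
  series: if all minors had zero expansion at \<open>\<phi> 0\<close>, they would vanish on a
  neighbourhood, while independence fails only on a negligible set.\<close>

lemma exponent_analytic_case:
  fixes f :: "real ^ 'n :: finite \<Rightarrow> real ^ 'n" and H :: "nat \<Rightarrow> real ^ 'n \<Rightarrow> real"
  assumes op: "open \<Omega>" and f: "\<And>i. real_analytic_on (\<lambda>x. f x $ i) \<Omega>"
    and orbit: "periodic_orbit \<Omega> f \<phi> T" and red: "floquet_reduction f \<phi> T Q A"
    and eig: "det (mat z - A) = 0"
    and D: "open D" "range \<phi> \<subseteq> D" "D \<subseteq> \<Omega>"
    and H: "\<And>a. a < CARD('n) - 1 \<Longrightarrow> real_analytic_on (H a) D \<and> first_integral f D (H a)"
    and ind: "functionally_independent (CARD('n) - 1) H D"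
  shows "\<exists>q. z * of_real T = of_rat q * (2 * of_real pi * \<i>)"
proof -
  define k where "k = CARD('n) - 1"
  have k: "k < CARD('n)" using zero_less_card_finite[where 'a = 'n] unfolding k_def by linarith
  have \<phi>D: "\<phi> t \<in> D" for t using D(2) by auto
  have \<phi>\<Omega>: "\<phi> t \<in> \<Omega>" for t using \<phi>D D(3) by auto
  have \<phi>': "(\<phi> has_vector_derivative f (\<phi> t)) (at t)" and \<phi>per: "\<phi> (t + T) = \<phi> t" for t
    using orbit by (auto simp: periodic_orbit_def)
  have Ha: "real_analytic_on (H a) D" if "a < k" for a using H that by (auto simp: k_def)
  \<comment> \<open>One enumeration of the columns other than \<open>q\<close> is fixed for each
    \<open>q\<close>, which leaves finitely many minors to consider.\<close>
  have "\<exists>s. bij_betw s {..<k} (UNIV - {q})" for q :: 'n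
  proof -
    have "card (UNIV - {q}) = k" by (simp add: k_def card_Diff_singleton)
    then show ?thesis using ex_bij_betw_nat_finite[of "UNIV - {q}"] by (auto simp: atLeast0LessThan)
  qed
  then obtain s where s: "\<And>q :: 'n. bij_betw (s q) {..<k} (UNIV - {q})" by metis
  define \<mu> where "\<mu> q = nat_det k (\<lambda>a b. mpartial (s q b) (rtaylor (H a) (\<phi> 0)))" for q
  have \<mu>: "PS (\<lambda>x. nat_det k (\<lambda>a b. grad (H a) x $ s q b)) (\<phi> 0) (\<mu> q)" for q
    unfolding \<mu>_def by (intro PS_nat_det PS_derivative(2) analytic_PS[OF Ha \<phi>D])
  obtain q where q: "\<mu> q \<noteq> 0"
  proof (rule ccontr)
    assume "\<not> thesis"
    then have "\<mu> q = 0" for q using that by blast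
    then have "PS (\<lambda>x. nat_det k (\<lambda>a b. grad (H a) x $ s q b)) (\<phi> 0) 0" for q using \<mu>[of q] by simp
    then have "\<forall>q. \<exists>U. open U \<and> \<phi> 0 \<in> U \<and> (\<forall>x\<in>U. nat_det k (\<lambda>a b. grad (H a) x $ s q b) = 0)"
      using PS_zero by blast
    from choice[OF this] obtain U where U: "\<And>q. open (U q)" "\<And>q. \<phi> 0 \<in> U q"
      "\<And>q x. x \<in> U q \<Longrightarrow> nat_det k (\<lambda>a b. grad (H a) x $ s q b) = 0" by blast
    define V where "V = D \<inter> (\<Inter>q. U q)"
    have V: "open V" "\<phi> 0 \<in> V" using U D(1) \<phi>D by (auto simp: V_def intro!: open_Int open_INT)
    have "V \<subseteq> {x \<in> D. dim ((\<lambda>a. grad (H a) x) ` {..<CARD('n) - 1}) \<noteq> CARD('n) - 1}"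
    proof (rule subsetI)
      fix x assume x: "x \<in> V"
      have "dim ((\<lambda>a. grad (H a) x) ` {..<CARD('n) - 1}) \<noteq> CARD('n) - 1"
      proof
        assume "dim ((\<lambda>a. grad (H a) x) ` {..<CARD('n) - 1}) = CARD('n) - 1"
        from independent_vectors_minor[OF this] obtain q
          where "\<forall>s. bij_betw s {..<k} (UNIV - {q}) \<longrightarrow> nat_det k (\<lambda>a b. grad (H a) x $ s b) \<noteq> 0"
          unfolding k_def by blast
        then have "nat_det k (\<lambda>a b. grad (H a) x $ s q b) \<noteq> 0" using s[of q] by simp
        moreover have "x \<in> U q" using x by (simp add: V_def)
        ultimately show False using U(3) by simp
      qed
      then show "x \<in> {x \<in> D. dim ((\<lambda>a. grad (H a) x) ` {..<CARD('n) - 1}) \<noteq> CARD('n) - 1}"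
        using x by (simp add: V_def)
    qed
    then have "negligible V" using ind negligible_subset unfolding functionally_independent_def by blast
    then show False using open_not_negligible[OF V(1)] V(2) by blast
  qed
  define K where "K a t = taylor (H a) (\<phi> t)" for a t
  have partial_K: "mpartial i (K a t) = complexify (mpartial i (rtaylor (H a) (\<phi> t)))" if "a < k" for i a t
    by (simp add: K_def analytic_taylor[OF Ha[OF that] \<phi>D] complexify_mpartial)
  have det: "nat_det (CARD('n) - 1) (\<lambda>a b. mpartial (s q b) (K a 0)) \<noteq> 0"
  proof -
    have "nat_det k (\<lambda>a b. mpartial (s q b) (K a 0)) = nat_det k (\<lambda>a b. complexify (mpartial (s q b) (rtaylor (H a) (\<phi> 0))))"
      unfolding nat_det_def by (intro sum.cong refl arg_cong2[where f = "(*)"] prod.cong) (simp add: partial_K)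
    then have "nat_det k (\<lambda>a b. mpartial (s q b) (K a 0)) = complexify (\<mu> q)"
      by (simp add: \<mu>_def nat_det_complexify)
    then show ?thesis using q by (simp add: complexify_eq_0_iff k_def)
  qed
  show ?thesis
  proof (rule exponent_of_integrable_orbit[OF op f orbit red eig, where K = K and S = "{..<k}" and ?t0.0 = 0])
    fix a t assume "a \<in> {..<k}"
    then have a: "a < k" by simp
    show "((\<lambda>s. mcoeff (K a s) m) has_vector_derivative
        mcoeff (\<Sum>i\<in>UNIV. mpartial i (K a t) * mconst (complex_of_real (f (\<phi> t) $ i))) m) (at t)" for m
      unfolding K_def by (rule taylor_along_curve[OF Ha[OF a] D(1) \<phi>D \<phi>'])
    show "K a (0 + T) = K a 0" using \<phi>per[of 0] by (simp add: K_def)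
    have "PS (\<lambda>x. \<Sum>i\<in>UNIV. grad (H a) x $ i * f x $ i) (\<phi> t) (\<Sum>i\<in>UNIV. mpartial i (rtaylor (H a) (\<phi> t)) * rtaylor (\<lambda>x. f x $ i) (\<phi> t))"
      by (intro PS_sum PS_mult PS_derivative(2) analytic_PS[OF Ha[OF a] \<phi>D] analytic_PS[OF f \<phi>\<Omega>])
    \<comment> \<open>The pairing of gradient and field vanishes on all of \<open>D\<close>, not
      just on the orbit, hence so does its whole expansion.\<close>
    then have "PS (\<lambda>_. 0) (\<phi> t) (\<Sum>i\<in>UNIV. mpartial i (rtaylor (H a) (\<phi> t)) * rtaylor (\<lambda>x. f x $ i) (\<phi> t))"
      by (rule PS_cong[OF _ D(1) \<phi>D]) (use first_integral_grad[OF f D(1,3)] H a in \<open>auto simp: k_def\<close>)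
    then have "(\<Sum>i\<in>UNIV. mpartial i (rtaylor (H a) (\<phi> t)) * rtaylor (\<lambda>x. f x $ i) (\<phi> t)) = 0"
      using PS_unique PS_const[of 0 "\<phi> t"] by fastforce
    from arg_cong[OF this, of complexify]
    show "(\<Sum>i\<in>UNIV. mpartial i (K a t) * taylor (\<lambda>x. f x $ i) (\<phi> t)) = 0"
      by (simp add: complexify_sum complexify_mult partial_K[OF a] analytic_taylor[OF f \<phi>\<Omega>])
  next
    fix Z Z' :: "'n \<Rightarrow> (complex, 'n) mfps" and i j
    assume "\<And>a. a \<in> {..<k} \<Longrightarrow> (\<Sum>i\<in>UNIV. Z i * mpartial i (K a 0)) = 0"
      "\<And>a. a \<in> {..<k} \<Longrightarrow> (\<Sum>i\<in>UNIV. Z' i * mpartial i (K a 0)) = 0"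
    moreover have "inj_on (s q) {..<CARD('n) - 1}" using s[of q] by (simp add: bij_betw_def k_def)
    ultimately show "Z i * Z' j = Z j * Z' i"
      using rank_of_minor[OF _ det, of Z Z' i j] by (simp add: k_def)
  qed
qed

text \<open>The unit is \<open>2 * pi / T\<close>: a change of time scale multiplies all exponents
  by a common real factor, so rationality has a meaning only relative to the frequency of the orbit.
  For period 2\<pi> the exponents themselves are rational multiples of \<i>.\<close>

theorem corollary1p2:
  fixes \<Omega> :: "(real ^ 'n :: finite) set"
    and f :: "real ^ 'n \<Rightarrow> real ^ 'n"
    and \<phi> :: "real \<Rightarrow> real ^ 'n"
    and T :: real
    and Q :: "real \<Rightarrow> complex ^ 'n ^ 'n"
    and A :: "complex ^ 'n ^ 'n"
    and l :: "'n \<Rightarrow> complex"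
  assumes "open \<Omega>"
    and "\<And>i. real_analytic_on (\<lambda>x. f x $ i) \<Omega>"
    and "periodic_orbit \<Omega> f \<phi> T"
    and "floquet_reduction f \<phi> T Q A"
    and "eigenvalue_listing A l"
    and "(\<exists>D H. open D \<and> range \<phi> \<subseteq> D \<and> D \<subseteq> \<Omega> \<and>
             (\<forall>a < CARD('n) - 1. real_analytic_on (H a) D \<and> first_integral f D (H a)) \<and>
             functionally_independent (CARD('n) - 1) H D) \<or>
         (\<exists>H. (\<forall>a < CARD('n) - 1. formal_first_integral f \<phi> T Q A (H a)) \<and>
             formally_independent (CARD('n) - 1) H)"
  shows "\<exists>\<nu> :: 'n \<Rightarrow> real. \<forall>j. \<nu> j \<in> \<rat> \<and> l j = complex_of_real (2 * pi / T * \<nu> j) * \<i>"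
proof -
  have T: "T > 0" using assms(3) by (simp add: periodic_orbit_def)
  have "\<forall>j. \<exists>q. l j * of_real T = of_rat q * (2 * of_real pi * \<i>)"
  proof
    fix j
    have "det (mat (l j) - A) = (\<Prod>i\<in>UNIV. l j - l i)" using assms(5) by (simp add: eigenvalue_listing_def)
    also have "\<dots> = 0" by (rule prod_zero) auto
    finally have eig: "det (mat (l j) - A) = 0" .
    from assms(6) show "\<exists>q. l j * of_real T = of_rat q * (2 * of_real pi * \<i>)"
    proof (elim disjE exE conjE)
      fix D and H :: "nat \<Rightarrow> real ^ 'n \<Rightarrow> real"
      assume "open D" "range \<phi> \<subseteq> D" "D \<subseteq> \<Omega>"
        "\<forall>a < CARD('n) - 1. real_analytic_on (H a) D \<and> first_integral f D (H a)"
        "functionally_independent (CARD('n) - 1) H D"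
      then show "\<exists>q. l j * of_real T = of_rat q * (2 * of_real pi * \<i>)"
        by (intro exponent_analytic_case[OF assms(1-4) eig, of D H]) blast+
    next
      fix H :: "nat \<Rightarrow> real \<Rightarrow> (complex, 'n) mfps"
      assume "\<forall>a < CARD('n) - 1. formal_first_integral f \<phi> T Q A (H a)"
        "formally_independent (CARD('n) - 1) H"
      then show "\<exists>q. l j * of_real T = of_rat q * (2 * of_real pi * \<i>)"
        by (intro exponent_formal_case[OF assms(1-4) eig, of H]) blast+
    qed
  qed
  from choice[OF this] obtain q where q: "\<And>j. l j * of_real T = of_rat (q j) * (2 * of_real pi * \<i>)" by blast
  show ?thesis
  proof (intro exI[of _ "\<lambda>j. of_rat (q j)"] allI conjI)
    fix j
    have "l j = of_rat (q j) * (2 * of_real pi * \<i>) / of_real T" using q[of j] T by (simp add: field_simps)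
    \<comment> \<open>The rational number enters \<complex> directly on one side and through \<real>
      on the other.\<close>
    also have "(of_rat (q j) :: complex) = of_real (of_rat (q j))" by (cases "q j") (simp add: of_rat_rat)
    finally show "l j = complex_of_real (2 * pi / T * of_rat (q j)) * \<i>" using T by (simp add: field_simps)
  qed simp
qed

end
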